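(* Let $\{\mu_n\}_{n=1}^\infty$ be a sequence of Borel probability measures on $\mathbb{R}^2$. Then $\mu_n$ converges weakly to a probability measure on $\mathbb{R}^2$ if and only if (1) there exists a Stolz angle $\Delta$ such that all $R_{\mu_n}$ are defined in the product domain $\Omega=(\Delta\cup\overline\Delta)\times(\Delta\cup\overline\Delta)$; (2) the pointwise limit $\lim_{n\to\infty}R_{\mu_n}(z,w)=R(z,w)$ exists for every $(z,w)$ in the domain $\Omega$; and (3) the limit $R_{\mu_n}(-iy,-iv)\to0$ holds uniformly in $n$ as $y,v\to0^+$. Moreover, if $\mu_n\Rightarrow\mu$, then $R=R_\mu$.
   Context: For a Borel probability measure $\mu$ on $\mathbb{R}^2$, its marginals are $\mu^{(j)}=\mu\circ\pi_j^{-1}$, $j=1,2$, where $\pi_1(s,t)=s$, $\pi_2(s,t)=t$, and its Cauchy transform is $G_\mu(z,w)=\int_{\mathbb{R}^2}\frac{1}{(z-s)(w-t)}\,d\mu(s,t)$ for $z,w\in\mathbb{C}\setminus\mathbb{R}$. For a probability measure $m$ on $\mathbb{R}$, $G_m(z)=\int_{\mathbb{R}}\frac{1}{z-x}\,dm(x)$, $z\notin\mathbb{R}$. For $\alpha,\beta>0$ the Stolz angle is $\Delta=\Delta_{\alpha,\beta}=\{x+iy\in\mathbb{C}: y<0,\ |x|<-\alpha y,\ y>-\beta\}$, and $\overline{\Delta}=\{\bar z:z\in\Delta\}$ is its reflection. The one-dimensional $R$-transform $R_m$ of a probability measure $m$ on $\mathbb{R}$ is the holomorphic function on $\Delta\cup\overline\Delta$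 (for a sufficiently small Stolz angle $\Delta$) with $1/z+R_m(z)\notin\mathbb{R}$, $G_m(1/z+R_m(z))=z$, and $zR_m(z)\to0$ as $z\to0$ in $\Delta\cup\overline\Delta$. The bi-free partial $R$-transform of a probability measure $\mu$ on $\mathbb{R}^2$ is $$R_\mu(z,w)=zR_{\mu^{(1)}}(z)+wR_{\mu^{(2)}}(w)+\left[1-\frac{1}{h_\mu(z,w)}\right],\quad h_\mu(z,w)=\frac{G_\mu\left(1/z+R_{\mu^{(1)}}(z),\,1/w+R_{\mu^{(2)}}(w)\right)}{zw},$$ which is defined and holomorphic on a product domain $\Omega=(\Delta\cup\overline\Delta)\times(\Delta\cup\overline\Delta)$ (with $\Delta$ small enough) on which $R_{\mu^{(1)}},R_{\mu^{(2)}}$ are defined and $h_\mu$ has no zeros. $\Rightarrow$ denotes weak convergence of measures. *)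

theory Defs
  imports "HOL-Complex_Analysis.Complex_Analysis" "HOL-Probability.Probability"
begin

definition borel_prob_measure :: "'a::topological_space measure \<Rightarrow> bool" where
  "borel_prob_measure M \<longleftrightarrow> prob_space M \<and> sets M = sets borel"

text \<open>The library's \<^const>\<open>weak_conv_m\<close> is specific to the real line (it is stated through
  distribution functions), so weak convergence is defined here by bounded continuous test
  functions.\<close>

definition weakly_converges ::
    "(nat \<Rightarrow> 'a::topological_space measure) \<Rightarrow> 'a measure \<Rightarrow> bool" where
  "weakly_converges M N \<longleftrightarrow>
    (\<forall>f :: 'a \<Rightarrow> real. continuous_on UNIV f \<and> bounded (range f) \<longrightarrow>
      (\<lambda>n. integral\<^sup>L (M n) f) \<longlonglongrightarrow> integral\<^sup>L N f)"

definition marginal1 :: "(real \<times> real) measure \<Rightarrow> real measure" where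
  "marginal1 M = distr M borel fst"

definition marginal2 :: "(real \<times> real) measure \<Rightarrow> real measure" where
  "marginal2 M = distr M borel snd"

definition cauchy_transform :: "real measure \<Rightarrow> complex \<Rightarrow> complex" where
  "cauchy_transform m z = (LINT x|m. 1 / (z - of_real x))"

definition cauchy_transform2 :: "(real \<times> real) measure \<Rightarrow> complex \<Rightarrow> complex \<Rightarrow> complex" where
  "cauchy_transform2 M z w =
    (LINT p|M. 1 / ((z - of_real (fst p)) * (w - of_real (snd p))))"

definition stolz_angle :: "real \<Rightarrow> real \<Rightarrow> complex set" where
  "stolz_angle \<alpha> \<beta> = {z. Im z < 0 \<and> \<bar>Re z\<bar> < - \<alpha> * Im z \<and> Im z > - \<beta>}"

definition double_stolz :: "real \<Rightarrow> real \<Rightarrow> complex set" where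
  "double_stolz \<alpha> \<beta> = stolz_angle \<alpha> \<beta> \<union> cnj ` stolz_angle \<alpha> \<beta>"

definition is_R_transform_on :: "complex set \<Rightarrow> real measure \<Rightarrow> (complex \<Rightarrow> complex) \<Rightarrow> bool" where
  "is_R_transform_on D m f \<longleftrightarrow>
    f holomorphic_on D \<and>
    (\<forall>z\<in>D. 1 / z + f z \<notin> \<real> \<and> cauchy_transform m (1 / z + f z) = z) \<and>
    ((\<lambda>z. z * f z) \<longlongrightarrow> 0) (at 0 within D)"

definition R_transform_defined :: "real \<Rightarrow> real \<Rightarrow> real measure \<Rightarrow> bool" where
  "R_transform_defined \<alpha> \<beta> m \<longleftrightarrow> (\<exists>f. is_R_transform_on (double_stolz \<alpha> \<beta>) m f)"

text \<open>The value does not depend on the Stolz angle. The Cauchy transform of a probability measure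
  is injective on truncated cones near infinity, so any two R-transforms agree near 0, hence,
  by the identity theorem, on the intersection of their domains, which is again given by a Stolz
  angle. Outside all domains of R-transforms the value is unspecified.\<close>

definition R_transform :: "real measure \<Rightarrow> complex \<Rightarrow> complex" where
  "R_transform m z = (THE c. \<exists>\<alpha>>0. \<exists>\<beta>>0. \<exists>f.
     is_R_transform_on (double_stolz \<alpha> \<beta>) m f \<and> z \<in> double_stolz \<alpha> \<beta> \<and> c = f z)"

definition bifree_h :: "(real \<times> real) measure \<Rightarrow> complex \<Rightarrow> complex \<Rightarrow> complex" where
  "bifree_h M z w =
     cauchy_transform2 M (1 / z + R_transform (marginal1 M) z) (1 / w + R_transform (marginal2 M) w)
       / (z * w)"

definition bifree_R :: "(real \<times> real) measure \<Rightarrow> complex \<Rightarrow> complex \<Rightarrow> complex" where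
  "bifree_R M z w =
     z * R_transform (marginal1 M) z + w * R_transform (marginal2 M) w + (1 - 1 / bifree_h M z w)"

definition bifree_R_defined :: "real \<Rightarrow> real \<Rightarrow> (real \<times> real) measure \<Rightarrow> bool" where
  "bifree_R_defined \<alpha> \<beta> M \<longleftrightarrow>
     R_transform_defined \<alpha> \<beta> (marginal1 M) \<and>
     R_transform_defined \<alpha> \<beta> (marginal2 M) \<and>
     (\<forall>z\<in>double_stolz \<alpha> \<beta>. \<forall>w\<in>double_stolz \<alpha> \<beta>. bifree_h M z w \<noteq> 0)"

end

theory Submission
  imports Defs
begin

text \<open>Write \<open>\<zeta> = 1/z + R(z) = (1 + u)/z\<close>. Then \<open>G(\<zeta>) = z\<close> says that \<open>u\<close> is a fixed point of
  \<open>u \<mapsto> e((1 + u)/z)\<close>, where \<open>e(\<zeta>) = \<zeta> G(\<zeta>) - 1 = \<integral> x/(\<zeta> - x) dm(x)\<close>. In a Stolz angle this map and its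
  Lipschitz constant are controlled by \<open>\<integral> min(1, r|x|) dm(x)\<close> with \<open>r\<close> comparable to \<open>|z|\<close>, which tends to 0
  with \<open>r\<close> uniformly over a tight family. So the R-transforms of a weakly convergent sequence exist on a
  common Stolz angle, converge there, and are uniformly small near 0, and the same bound controls
  \<open>h - 1\<close>. On a larger Stolz angle on which all \<open>R\<close> are given, \<open>z \<mapsto> 1/z + R(z)\<close> takes values in a
  half-plane, so the limit extends by Montel's theorem, and the open mapping theorem keeps it away from
  the real line and from infinity.

  Conversely, letting \<open>w \<rightarrow> 0\<close> in \<open>R\<^sub>\<mu>(z, w)\<close> leaves \<open>z R(z)\<close> for the first marginal, and smallness of
  \<open>u = z R(z)\<close> at \<open>z = - \<i>y\<close> bounds the mass outside \<open>[- 3/y, 3/y]\<close> through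
  \<open>Im G(\<zeta>) = - Im \<zeta> \<integral> 1/|\<zeta> - x|\<^sup>2 dm(x)\<close>. Hence (3) gives tightness. Subsequential limits agree, because the
  bi-free R-transform determines both marginal R-transforms, then \<open>h\<close>, hence the Cauchy transform on an
  open subset of each component of its domain, and Poisson kernels invert the latter.\<close>

text \<open>An R-transform given on some angle is controlled only near 0, through
  \<open>z * f z\<close> tending to 0, and \<open>double_stolz\<close> is disconnected, with one
  component in each half-plane. Hence a recurring pattern: a quantitative statement near 0, then
  analytic continuation inside one component, selected by a sign \<sigma>.

  Passing from R(z) to u = z R(z) makes the estimates invariant under rescaling the measure. The
  aperture \<alpha> then enters through the constant c = \<open>stolz_const\<close> \<alpha>, and
  the height \<beta> only through the radius at which the truncated moment is taken. This is why a
  common angle can be found with \<alpha> prescribed and only \<beta> shrunk.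

  The two-variable part needs no joint moment estimate: G(\<zeta>) = z normalises the rescaled
  kernel in the first variable to integral 1, so h - 1 is bounded by a quantity of the second
  marginal alone. On an angle where no smallness is available, h of the limit measure cannot vanish
  because convergence of the bi-free transforms forces 1/h to converge along the sequence.\<close>

section \<open>Preliminaries on measures and integrals\<close>

lemma borel_prob_measureD:
  assumes "borel_prob_measure M"
  shows "prob_space M" "sets M = sets borel" "space M = UNIV"
  using assms sets_eq_imp_space_eq[of M borel] by (auto simp: borel_prob_measure_def)

lemma norm_integral_le_integral:
  fixes f :: "'a \<Rightarrow> 'b::{banach, second_countable_topology}"
  assumes "integrable M f" "integrable M g" "\<And>x. norm (f x) \<le> g x"
  shows "norm (integral\<^sup>L M f) \<le> integral\<^sup>L M g"
proof -
  have "norm (integral\<^sup>L M f) \<le> (LINT x|M. norm (f x))"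
    by (rule integral_norm_bound)
  also have "\<dots> \<le> integral\<^sup>L M g"
    by (intro integral_mono assms integrable_norm)
  finally show ?thesis .
qed

subsection \<open>The Cauchy kernel\<close>

lemma abs_Im_le_norm_diff_of_real: "\<bar>Im \<zeta>\<bar> \<le> norm (\<zeta> - of_real x)"
  using abs_Im_le_cmod[of "\<zeta> - of_real x"] by simp

lemma diff_of_real_nonzero: "Im \<zeta> \<noteq> 0 \<Longrightarrow> \<zeta> - of_real x \<noteq> 0"
  by (auto simp: complex_eq_iff)

lemma norm_cauchy_kernel_le: "Im \<zeta> \<noteq> 0 \<Longrightarrow> norm (1 / (\<zeta> - of_real x)) \<le> 1 / \<bar>Im \<zeta>\<bar>"
  using abs_Im_le_norm_diff_of_real[of \<zeta> x] by (simp add: norm_divide divide_simps)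

text \<open>In the triangle with vertices 0, x and \<zeta>, the left side is base times height, that
  is twice the area. This never exceeds the product of the other two sides.\<close>

lemma abs_mult_abs_Im_le: "\<bar>x\<bar> * \<bar>Im \<zeta>\<bar> \<le> norm \<zeta> * norm (\<zeta> - of_real x)"
proof -
  have "Im ((\<zeta> - of_real x) * cnj \<zeta>) = x * Im \<zeta>"
    by (simp add: algebra_simps)
  then have "\<bar>x\<bar> * \<bar>Im \<zeta>\<bar> = \<bar>Im ((\<zeta> - of_real x) * cnj \<zeta>)\<bar>"
    by (simp add: abs_mult)
  also have "\<dots> \<le> norm ((\<zeta> - of_real x) * cnj \<zeta>)"
    by (rule abs_Im_le_cmod)
  also have "\<dots> = norm \<zeta> * norm (\<zeta> - of_real x)"
    by (simp add: norm_mult)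
  finally show ?thesis .
qed

lemma diff_of_real_bounds_in_cone:
  assumes "c * norm \<zeta> \<le> \<bar>Im \<zeta>\<bar>" "\<zeta> \<noteq> 0"
  shows "c * \<bar>x\<bar> \<le> norm (\<zeta> - of_real x)" "c * norm \<zeta> \<le> norm (\<zeta> - of_real x)"
proof -
  have "norm \<zeta> * (c * \<bar>x\<bar>) = \<bar>x\<bar> * (c * norm \<zeta>)" by (simp add: algebra_simps)
  also have "\<dots> \<le> \<bar>x\<bar> * \<bar>Im \<zeta>\<bar>" by (intro mult_left_mono assms) auto
  also have "\<dots> \<le> norm \<zeta> * norm (\<zeta> - of_real x)" by (rule abs_mult_abs_Im_le)
  finally show "c * \<bar>x\<bar> \<le> norm (\<zeta> - of_real x)" using assms(2) by simp
  show "c * norm \<zeta> \<le> norm (\<zeta> - of_real x)"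
    using assms(1) abs_Im_le_norm_diff_of_real[of \<zeta> x] by linarith
qed

lemma cauchy_kernel_lipschitz:
  assumes "Im \<zeta> \<noteq> 0" "Im \<eta> \<noteq> 0"
  shows "norm (1 / (\<zeta> - of_real x) - 1 / (\<eta> - of_real x)) \<le> norm (\<zeta> - \<eta>) / (\<bar>Im \<zeta>\<bar> * \<bar>Im \<eta>\<bar>)"
proof -
  have "1 / (\<zeta> - of_real x) - 1 / (\<eta> - of_real x) =
      (\<eta> - \<zeta>) * ((1 / (\<zeta> - of_real x)) * (1 / (\<eta> - of_real x)))"
    using diff_of_real_nonzero[OF assms(1)] diff_of_real_nonzero[OF assms(2)]
    by (simp add: field_simps)
  also have "norm \<dots> \<le> norm (\<eta> - \<zeta>) * ((1 / \<bar>Im \<zeta>\<bar>) * (1 / \<bar>Im \<eta>\<bar>))"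
    unfolding norm_mult
    by (intro mult_left_mono mult_mono norm_cauchy_kernel_le assms) auto
  finally show ?thesis by (simp add: norm_minus_commute)
qed

lemma (in finite_measure) integrable_cauchy_kernel:
  assumes [measurable]: "X \<in> borel_measurable M" "\<phi> \<in> borel_measurable M"
    and "\<And>p. norm (\<phi> p :: complex) \<le> B" "Im \<zeta> \<noteq> 0"
  shows "integrable M (\<lambda>p. \<phi> p / (\<zeta> - of_real (X p)))"
proof (rule integrable_const_bound[where B = "B * (1 / \<bar>Im \<zeta>\<bar>)"])
  have "norm (\<phi> p * (1 / (\<zeta> - of_real (X p)))) \<le> B * (1 / \<bar>Im \<zeta>\<bar>)" for p
    unfolding norm_mult
    using order.trans[OF norm_ge_zero assms(3)]
    by (intro mult_mono assms norm_cauchy_kernel_le) auto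
  then show "AE p in M. norm (\<phi> p / (\<zeta> - of_real (X p))) \<le> B * (1 / \<bar>Im \<zeta>\<bar>)"
    by simp
qed measurable

section \<open>Analytic properties of Cauchy integrals\<close>

text \<open>The weight \<phi> and the variable X are left general so that one proof covers both the
  transform on the line (\<phi> = 1) and each variable of the two-variable transform (\<phi> is the
  kernel in the other variable). The difference quotient differs from the candidate derivative by
  O(|\<eta> - \<zeta>|); keeping \<eta> within half of |Im \<zeta>| is what costs the factor 2 in
  \<open>K\<close>.\<close>

lemma (in finite_measure) holomorphic_cauchy_integral:
  assumes [measurable]: "X \<in> borel_measurable M" "\<phi> \<in> borel_measurable M"
    and B: "\<And>p. norm (\<phi> p :: complex) \<le> B"
  shows "(\<lambda>\<zeta>. LINT p|M. \<phi> p / (\<zeta> - of_real (X p))) holomorphic_on {\<zeta>. Im \<zeta> \<noteq> 0}"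
proof -
  have "((\<lambda>\<zeta>. LINT p|M. \<phi> p / (\<zeta> - of_real (X p))) has_field_derivative
      - (LINT p|M. \<phi> p / (\<zeta> - of_real (X p))\<^sup>2)) (at \<zeta>)" if \<zeta>: "Im \<zeta> \<noteq> 0" for \<zeta>
  proof -
    define d where "d = \<bar>Im \<zeta>\<bar>"
    have d: "d > 0" using \<zeta> by (simp add: d_def)
    define g where "g \<eta> = (LINT p|M. \<phi> p / (\<eta> - of_real (X p)))" for \<eta>
    define K where "K = B * (2 / d ^ 3) * measure M (space M)"
    have B0: "0 \<le> B" using order.trans[OF norm_ge_zero B] .
    have int: "integrable M (\<lambda>p. \<phi> p / (\<zeta> - of_real (X p))\<^sup>2)"
    proof (rule integrable_const_bound[where B = "B * (1 / d * (1 / d))"])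
      have "norm (\<phi> p * ((1 / (\<zeta> - of_real (X p))) * (1 / (\<zeta> - of_real (X p))))) \<le> B * (1 / d * (1 / d))" for p
        unfolding norm_mult d_def
        by (intro mult_mono B norm_cauchy_kernel_le \<zeta>) (auto simp: B0)
      then show "AE p in M. norm (\<phi> p / (\<zeta> - of_real (X p))\<^sup>2) \<le> B * (1 / d * (1 / d))"
        by (simp add: power2_eq_square)
    qed measurable
    have bound: "norm ((g \<eta> - g \<zeta>) / (\<eta> - \<zeta>) + (LINT p|M. \<phi> p / (\<zeta> - of_real (X p))\<^sup>2)) \<le> K * norm (\<eta> - \<zeta>)"
      if \<eta>: "norm (\<eta> - \<zeta>) < d / 2" "\<eta> \<noteq> \<zeta>" for \<eta>
    proof -
      have "\<bar>Im \<eta> - Im \<zeta>\<bar> < d / 2" using \<eta>(1) abs_Im_le_cmod[of "\<eta> - \<zeta>"] by simp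
      then have im: "\<bar>Im \<eta>\<bar> \<ge> d / 2" unfolding d_def by linarith
      then have im0: "Im \<eta> \<noteq> 0" using d by auto
      have eq: "(g \<eta> - g \<zeta>) / (\<eta> - \<zeta>) + (LINT p|M. \<phi> p / (\<zeta> - of_real (X p))\<^sup>2) =
         (LINT p|M. (\<phi> p / (\<eta> - of_real (X p)) - \<phi> p / (\<zeta> - of_real (X p))) / (\<eta> - \<zeta>)
            + \<phi> p / (\<zeta> - of_real (X p))\<^sup>2)"
        unfolding g_def
        using integrable_cauchy_kernel[OF assms im0] integrable_cauchy_kernel[OF assms \<zeta>] int
        by simp
      also have "norm \<dots> \<le> (LINT p|M. B * (2 / d ^ 3) * norm (\<eta> - \<zeta>))"
      proof (rule norm_integral_le_integral)
        fix p
        have nz: "\<eta> - of_real (X p) \<noteq> 0" "\<zeta> - of_real (X p) \<noteq> 0" "\<eta> - \<zeta> \<noteq> 0"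
          using diff_of_real_nonzero im0 \<zeta> \<eta>(2) by auto
        \<comment> \<open>The error of the difference quotient is an exact multiple of a - b, so no
          Taylor estimate under the integral is required.\<close>
        have alg: "(f / a - f / b) / (a - b) + f / b\<^sup>2 = f * (1 / a * (1 / b * (1 / b))) * (a - b)"
          if "a \<noteq> 0" "b \<noteq> 0" "a - b \<noteq> 0" for f a b :: complex
          using that by (simp add: divide_simps power2_eq_square) (simp add: algebra_simps)
        have "(\<phi> p / (\<eta> - of_real (X p)) - \<phi> p / (\<zeta> - of_real (X p))) / (\<eta> - \<zeta>)
            + \<phi> p / (\<zeta> - of_real (X p))\<^sup>2 =
            \<phi> p * (1 / (\<eta> - of_real (X p)) * (1 / (\<zeta> - of_real (X p)) * (1 / (\<zeta> - of_real (X p))))) * (\<eta> - \<zeta>)"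
          using alg[OF nz(1) nz(2)] nz(3) by simp
        also have "norm \<dots> \<le> B * ((1 / \<bar>Im \<eta>\<bar>) * ((1 / d) * (1 / d))) * norm (\<eta> - \<zeta>)"
          unfolding norm_mult d_def
          by (intro mult_right_mono mult_mono B norm_cauchy_kernel_le \<zeta> im0) (auto simp: B0)
        also have "\<dots> \<le> B * ((2 / d) * ((1 / d) * (1 / d))) * norm (\<eta> - \<zeta>)"
        proof -
          have "1 / \<bar>Im \<eta>\<bar> \<le> 2 / d" using im d by (simp add: divide_simps)
          then show ?thesis using B0 d by (intro mult_right_mono mult_left_mono) auto
        qed
        finally show "norm ((\<phi> p / (\<eta> - of_real (X p)) - \<phi> p / (\<zeta> - of_real (X p))) / (\<eta> - \<zeta>)
            + \<phi> p / (\<zeta> - of_real (X p))\<^sup>2) \<le> B * (2 / d ^ 3) * norm (\<eta> - \<zeta>)"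
          by (simp add: power3_eq_cube mult.assoc)
      qed (use integrable_cauchy_kernel[OF assms im0] integrable_cauchy_kernel[OF assms \<zeta>] int in auto)
      finally show ?thesis by (simp add: K_def algebra_simps)
    qed
    have "((\<lambda>\<eta>. (g \<eta> - g \<zeta>) / (\<eta> - \<zeta>) + (LINT p|M. \<phi> p / (\<zeta> - of_real (X p))\<^sup>2)) \<longlongrightarrow> 0) (at \<zeta>)"
    proof (rule Lim_null_comparison)
      show "\<forall>\<^sub>F \<eta> in at \<zeta>. norm ((g \<eta> - g \<zeta>) / (\<eta> - \<zeta>) + (LINT p|M. \<phi> p / (\<zeta> - of_real (X p))\<^sup>2)) \<le> K * norm (\<eta> - \<zeta>)"
        using d bound by (auto simp: eventually_at dist_norm intro!: exI[of _ "d / 2"])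
      show "((\<lambda>\<eta>. K * norm (\<eta> - \<zeta>)) \<longlongrightarrow> 0) (at \<zeta>)"
        by (rule tendsto_eq_intros refl | simp)+
    qed
    then have "((\<lambda>\<eta>. (g \<eta> - g \<zeta>) / (\<eta> - \<zeta>)) \<longlongrightarrow> - (LINT p|M. \<phi> p / (\<zeta> - of_real (X p))\<^sup>2)) (at \<zeta>)"
      using tendsto_diff[OF _ tendsto_const[of "LINT p|M. \<phi> p / (\<zeta> - of_real (X p))\<^sup>2"]] by fastforce
    then show ?thesis unfolding has_field_derivative_iff g_def .
  qed
  then show ?thesis
    unfolding holomorphic_on_def
    using field_differentiable_at_within field_differentiable_def by blast
qed

lemma open_Im_nonzero: "open {\<zeta>. Im \<zeta> \<noteq> 0}"
  by (intro open_Collect_neq continuous_intros)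

lemma integrable_cauchy_kernel1:
  assumes "borel_prob_measure m" "Im \<zeta> \<noteq> 0"
  shows "integrable m (\<lambda>x. 1 / (\<zeta> - of_real x))"
proof -
  interpret prob_space m by (rule borel_prob_measureD[OF assms(1)])
  have [measurable_cong]: "sets m = sets borel" using borel_prob_measureD[OF assms(1)] by simp
  show ?thesis
    by (rule integrable_cauchy_kernel[where B = 1]) (use assms in auto)
qed

lemma holomorphic_cauchy_transform:
  assumes "borel_prob_measure m"
  shows "cauchy_transform m holomorphic_on {\<zeta>. Im \<zeta> \<noteq> 0}"
proof -
  interpret prob_space m by (rule borel_prob_measureD[OF assms(1)])
  have [measurable_cong]: "sets m = sets borel" using borel_prob_measureD[OF assms(1)] by simp
  show ?thesis unfolding cauchy_transform_def[abs_def]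
    by (rule holomorphic_cauchy_integral[where B = 1]) auto
qed

text \<open>The third claim says that G exchanges the half-planes. Combined with G(\<zeta>) = z it
  fixes the half-plane of 1/z + R(z) on the whole domain of R, even far from 0 where R is not small.
  The first claim is the source of the later tail estimate.\<close>

lemma Im_cauchy_transform:
  assumes "borel_prob_measure m" "Im \<zeta> \<noteq> 0"
  shows "Im (cauchy_transform m \<zeta>) = - Im \<zeta> * (LINT x|m. 1 / (norm (\<zeta> - of_real x))\<^sup>2)"
    and "integrable m (\<lambda>x. 1 / (norm (\<zeta> - of_real x))\<^sup>2)"
    and "Im \<zeta> * Im (cauchy_transform m \<zeta>) < 0"
proof -
  interpret prob_space m by (rule borel_prob_measureD[OF assms(1)])
  have [measurable_cong]: "sets m = sets borel" using borel_prob_measureD[OF assms(1)] by simp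
  show int: "integrable m (\<lambda>x. 1 / (norm (\<zeta> - of_real x))\<^sup>2)"
  proof (rule integrable_const_bound[where B = "(1 / \<bar>Im \<zeta>\<bar>)\<^sup>2"])
    have "(norm (1 / (\<zeta> - of_real x)))\<^sup>2 \<le> (1 / \<bar>Im \<zeta>\<bar>)\<^sup>2" for x
      by (intro power_mono norm_cauchy_kernel_le assms) auto
    then show "AE x in m. norm (1 / (norm (\<zeta> - of_real x))\<^sup>2) \<le> (1 / \<bar>Im \<zeta>\<bar>)\<^sup>2"
      by (simp add: norm_divide power_divide)
  qed measurable
  have im: "Im (1 / (\<zeta> - of_real x)) = - Im \<zeta> * (1 / (norm (\<zeta> - of_real x))\<^sup>2)" for x
    by (simp add: Im_divide cmod_power2)
  have "Im (cauchy_transform m \<zeta>) = (LINT x|m. Im (1 / (\<zeta> - of_real x)))"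
    unfolding cauchy_transform_def using integral_Im[OF integrable_cauchy_kernel1[OF assms]] by simp
  also have "\<dots> = - Im \<zeta> * (LINT x|m. 1 / (norm (\<zeta> - of_real x))\<^sup>2)"
    unfolding im by (rule integral_mult_right_zero)
  finally show eq: "Im (cauchy_transform m \<zeta>) = - Im \<zeta> * (LINT x|m. 1 / (norm (\<zeta> - of_real x))\<^sup>2)" .
  have "0 < (LINT x|m. 1 / (norm (\<zeta> - of_real x))\<^sup>2)"
  proof -
    have "(LINT x|m. 0) < (LINT x|m. 1 / (norm (\<zeta> - of_real x))\<^sup>2)"
      by (rule integral_less_AE_space)
         (use int diff_of_real_nonzero[OF assms(2)] in \<open>auto simp: emeasure_space_1\<close>)
    then show ?thesis by simp
  qed
  then show "Im \<zeta> * Im (cauchy_transform m \<zeta>) < 0"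
    unfolding eq using assms(2) by (simp add: mult_less_0_iff zero_less_mult_iff) (auto simp: linorder_neq_iff)
qed

subsection \<open>Truncated first moments and the fixed point equation\<close>

text \<open>A substitute for r times the first absolute moment, which may be infinite. The integrand
  is bounded and continuous, so for fixed r the quantity passes to weak limits.\<close>

definition truncated_moment :: "real measure \<Rightarrow> real \<Rightarrow> real" where
  "truncated_moment m r = (LINT x|m. min 1 (r * \<bar>x\<bar>))"

lemma integrable_truncated:
  fixes r :: real
  assumes "borel_prob_measure m" "0 \<le> r"
  shows "integrable m (\<lambda>x. min 1 (r * \<bar>x\<bar>))"
proof -
  interpret prob_space m by (rule borel_prob_measureD[OF assms(1)])
  have [measurable_cong]: "sets m = sets borel" using borel_prob_measureD[OF assms(1)] by simp
  show ?thesis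
    by (rule integrable_const_bound[where B = 1]) (use assms in \<open>auto simp: abs_le_iff\<close>)
qed

lemma truncated_moment_nonneg: "0 \<le> r \<Longrightarrow> 0 \<le> truncated_moment m r"
  unfolding truncated_moment_def by (rule integral_nonneg_AE) auto

lemma truncated_moment_mono:
  assumes "borel_prob_measure m" "0 \<le> r" "r \<le> r'"
  shows "truncated_moment m r \<le> truncated_moment m r'"
  unfolding truncated_moment_def
  by (intro integral_mono integrable_truncated min.mono mult_right_mono assms) (use assms in auto)

lemma truncated_moment_tendsto_0:
  assumes "borel_prob_measure m"
  shows "(\<lambda>k. truncated_moment m (1 / real (Suc k))) \<longlonglongrightarrow> 0"
proof -
  interpret prob_space m by (rule borel_prob_measureD[OF assms(1)])
  have [measurable_cong]: "sets m = sets borel" using borel_prob_measureD[OF assms(1)] by simp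
  have "(\<lambda>k. truncated_moment m (1 / real (Suc k))) \<longlonglongrightarrow> (LINT x|m. (0::real))"
    unfolding truncated_moment_def
  proof (rule integral_dominated_convergence[where w = "\<lambda>_. 1"])
    have "(\<lambda>k. min 1 (1 / real (Suc k) * \<bar>x\<bar>)) \<longlonglongrightarrow> min 1 (0 * \<bar>x\<bar>)" for x
      by (intro tendsto_min tendsto_mult tendsto_const LIMSEQ_Suc lim_1_over_n)
    then show "AE x in m. (\<lambda>k. min 1 (1 / real (Suc k) * \<bar>x\<bar>)) \<longlonglongrightarrow> (0::real)" by simp
  qed (auto simp: abs_le_iff)
  then show ?thesis by simp
qed

lemma truncated_moment_small:
  assumes "borel_prob_measure m" "0 < e"
  obtains \<rho> where "0 < \<rho>" "\<And>r. 0 \<le> r \<Longrightarrow> r \<le> \<rho> \<Longrightarrow> truncated_moment m r < e"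
proof -
  obtain k where k: "truncated_moment m (1 / real (Suc k)) < e"
    using order_tendstoD(2)[OF truncated_moment_tendsto_0[OF assms(1)] assms(2)]
    by (auto simp: eventually_sequentially)
  show thesis
    by (rule that[of "1 / real (Suc k)"])
       (use k truncated_moment_mono[OF assms(1)] in \<open>auto intro: le_less_trans\<close>)
qed

definition cauchy_remainder :: "real measure \<Rightarrow> complex \<Rightarrow> complex" where
  "cauchy_remainder m \<zeta> = \<zeta> * cauchy_transform m \<zeta> - 1"

lemma cauchy_remainder_eq:
  assumes "borel_prob_measure m" "Im \<zeta> \<noteq> 0"
  shows "cauchy_remainder m \<zeta> = (LINT x|m. of_real x / (\<zeta> - of_real x))"
    and "integrable m (\<lambda>x. of_real x / (\<zeta> - of_real x))"
proof -
  interpret prob_space m by (rule borel_prob_measureD[OF assms(1)])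
  note int = integrable_cauchy_kernel1[OF assms]
  have eq: "of_real x / (\<zeta> - of_real x) = \<zeta> * (1 / (\<zeta> - of_real x)) - 1" for x
    using diff_of_real_nonzero[OF assms(2)] by (simp add: field_simps)
  show "integrable m (\<lambda>x. of_real x / (\<zeta> - of_real x))"
    unfolding eq using int by (intro Bochner_Integration.integrable_diff integrable_mult_right) auto
  have "(LINT x|m. \<zeta> * (1 / (\<zeta> - of_real x)) - 1) = (LINT x|m. \<zeta> * (1 / (\<zeta> - of_real x))) - (LINT x|m. 1)"
    using int by (intro Bochner_Integration.integral_diff integrable_mult_right) auto
  also have "(LINT x|m. \<zeta> * (1 / (\<zeta> - of_real x))) = \<zeta> * cauchy_transform m \<zeta>"
    unfolding cauchy_transform_def by (rule integral_mult_right_zero)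
  also have "(LINT x|m. (1::complex)) = 1" using prob_space by simp
  finally show "cauchy_remainder m \<zeta> = (LINT x|m. of_real x / (\<zeta> - of_real x))"
    unfolding eq cauchy_remainder_def by simp
qed

lemma holomorphic_cauchy_remainder:
  "borel_prob_measure m \<Longrightarrow> cauchy_remainder m holomorphic_on {\<zeta>. Im \<zeta> \<noteq> 0}"
  unfolding cauchy_remainder_def[abs_def]
  by (intro holomorphic_intros holomorphic_cauchy_transform)

lemma cone_Im_nonzero:
  assumes "0 < c" "\<zeta> \<noteq> 0" "c * norm \<zeta> \<le> \<bar>Im \<zeta>\<bar>"
  shows "Im \<zeta> \<noteq> 0"
  using assms by (metis abs_zero mult_pos_pos not_less zero_less_norm_iff)

text \<open>Inside a cone around the imaginary axis, |\<zeta> - x| dominates both |x| and |\<zeta>|.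
  The first bound gives the constant arm of the minimum, the second the linear arm.\<close>

lemma kernel_ratio_le:
  assumes "0 < c" "\<zeta> \<noteq> 0" "c * norm \<zeta> \<le> \<bar>Im \<zeta>\<bar>"
  shows "norm (of_real x / (\<zeta> - of_real x)) \<le> (1 / c) * min 1 (1 / norm \<zeta> * \<bar>x\<bar>)"
proof -
  have pos: "0 < norm (\<zeta> - of_real x)"
    using diff_of_real_nonzero[OF cone_Im_nonzero[OF assms]] by simp
  have "\<bar>x\<bar> / norm (\<zeta> - of_real x) \<le> 1 / c"
    using diff_of_real_bounds_in_cone(1)[OF assms(3,2), of x] assms(1) pos by (simp add: field_simps)
  moreover have "\<bar>x\<bar> / norm (\<zeta> - of_real x) \<le> 1 / c * (1 / norm \<zeta> * \<bar>x\<bar>)"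
  proof -
    have "\<bar>x\<bar> / norm (\<zeta> - of_real x) \<le> \<bar>x\<bar> / (c * norm \<zeta>)"
      using diff_of_real_bounds_in_cone(2)[OF assms(3,2), of x] assms pos
      by (intro divide_left_mono mult_pos_pos) auto
    then show ?thesis by simp
  qed
  ultimately show ?thesis
    using assms(1) by (auto simp: norm_divide min_def simp del: times_divide_eq_left times_divide_eq_right)
qed

lemma norm_cauchy_remainder_le:
  assumes "borel_prob_measure m" "0 < c" "\<zeta> \<noteq> 0" "c * norm \<zeta> \<le> \<bar>Im \<zeta>\<bar>"
  shows "norm (cauchy_remainder m \<zeta>) \<le> (1 / c) * truncated_moment m (1 / norm \<zeta>)"
proof -
  note im = cone_Im_nonzero[OF assms(2-4)]
  have "norm (LINT x|m. of_real x / (\<zeta> - of_real x)) \<le> (LINT x|m. (1 / c) * min 1 (1 / norm \<zeta> * \<bar>x\<bar>))"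
    by (intro norm_integral_le_integral cauchy_remainder_eq assms im integrable_mult_right
        integrable_truncated kernel_ratio_le) auto
  then show ?thesis
    by (simp add: cauchy_remainder_eq(1)[OF assms(1) im] truncated_moment_def)
qed

text \<open>The difference of the integrands factors as (\<zeta> - \<eta>)/(\<eta> - x) times
  x/(\<zeta> - x), up to sign. Keeping x in the numerator of one factor makes the Lipschitz constant
  small together with the truncated moment, instead of merely bounded.\<close>

lemma norm_cauchy_remainder_diff_le:
  assumes "borel_prob_measure m" "0 < c" "\<zeta> \<noteq> 0" "c * norm \<zeta> \<le> \<bar>Im \<zeta>\<bar>"
    "\<eta> \<noteq> 0" "c * norm \<eta> \<le> \<bar>Im \<eta>\<bar>"
  shows "norm (cauchy_remainder m \<zeta> - cauchy_remainder m \<eta>) \<le>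
    norm (\<zeta> - \<eta>) * (1 / (c * norm \<eta>)) * ((1 / c) * truncated_moment m (1 / norm \<zeta>))"
proof -
  note im = cone_Im_nonzero[OF assms(2-4)] cone_Im_nonzero[OF assms(2,5,6)]
  let ?K = "norm (\<zeta> - \<eta>) * (1 / (c * norm \<eta>))"
  have "norm (LINT x|m. of_real x / (\<zeta> - of_real x) - of_real x / (\<eta> - of_real x))
     \<le> (LINT x|m. ?K * ((1 / c) * min 1 (1 / norm \<zeta> * \<bar>x\<bar>)))"
  proof (intro norm_integral_le_integral Bochner_Integration.integrable_diff
      cauchy_remainder_eq assms im integrable_mult_right integrable_truncated)
    fix x
    have nz: "\<zeta> - of_real x \<noteq> 0" "\<eta> - of_real x \<noteq> 0" using diff_of_real_nonzero im by auto
    then have "of_real x / (\<zeta> - of_real x) - of_real x / (\<eta> - of_real x) =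
        - ((\<zeta> - \<eta>) * (1 / (\<eta> - of_real x)) * (of_real x / (\<zeta> - of_real x)))"
      by (simp add: divide_simps) (simp add: algebra_simps)
    also have "norm \<dots> = norm (\<zeta> - \<eta>) * norm (1 / (\<eta> - of_real x)) * norm (of_real x / (\<zeta> - of_real x))"
      by (simp only: norm_minus_cancel norm_mult)
    also have "\<dots> \<le> ?K * ((1 / c) * min 1 (1 / norm \<zeta> * \<bar>x\<bar>))"
    proof (intro mult_mono kernel_ratio_le assms)
      have "0 < c * norm \<eta>" using assms by simp
      then show "norm (1 / (\<eta> - of_real x)) \<le> 1 / (c * norm \<eta>)"
        using diff_of_real_bounds_in_cone(2)[OF assms(6,5), of x]
        by (simp add: norm_divide frac_le)
    qed (use assms in auto)
    finally show "norm (of_real x / (\<zeta> - of_real x) - of_real x / (\<eta> - of_real x)) \<le>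
        ?K * ((1 / c) * min 1 (1 / norm \<zeta> * \<bar>x\<bar>))" .
  qed auto
  moreover have "cauchy_remainder m \<zeta> - cauchy_remainder m \<eta> =
     (LINT x|m. of_real x / (\<zeta> - of_real x) - of_real x / (\<eta> - of_real x))"
    unfolding cauchy_remainder_eq(1)[OF assms(1) im(1)] cauchy_remainder_eq(1)[OF assms(1) im(2)]
    by (intro Bochner_Integration.integral_diff[symmetric] cauchy_remainder_eq assms im)
  ultimately show ?thesis
    by (simp add: truncated_moment_def)
qed

section \<open>The fixed point map u -> e((1 + u)/z)\<close>

text \<open>Inversion preserves the ratio of |Im z| to |z|, so 1/z lies in the cone with constant
  2c. The factor 1 + u spoils this by an amount of relative size at most c/2, and the spare factor 2
  absorbs it. That c is at most 1/2 follows from |Im z| \<le> |z|, and it keeps |1 + u| above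
  1/2.\<close>

lemma perturbed_inverse_in_cone:
  assumes "0 < c" "z \<noteq> 0" "2 * c * norm z \<le> \<bar>Im z\<bar>" "norm u \<le> c / 2"
  shows "c \<le> 1 / 2" "(1 + u) / z \<noteq> 0" "c * norm ((1 + u) / z) \<le> \<bar>Im ((1 + u) / z)\<bar>"
    "1 / norm ((1 + u) / z) \<le> 2 * norm z"
proof -
  have "2 * c * norm z \<le> 1 * norm z" using assms(3) abs_Im_le_cmod[of z] by linarith
  then show c: "c \<le> 1 / 2" using assms(2) by simp
  have n: "norm (1 + u) \<le> 1 + c / 2" "1 / 2 \<le> norm (1 + u)"
    using norm_triangle_ineq[of 1 u] norm_triangle_ineq2[of 1 "- u"] assms(4) c by auto
  then show "(1 + u) / z \<noteq> 0" using assms(2) by auto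
  show "1 / norm ((1 + u) / z) \<le> 2 * norm z"
    using n(2) assms(2) by (auto simp: norm_divide divide_simps)
  have im1: "\<bar>Im (1 / z)\<bar> \<ge> 2 * c * (1 / norm z)"
  proof -
    have "\<bar>Im (1 / z)\<bar> = \<bar>Im z\<bar> / (norm z)\<^sup>2" by (simp add: Im_divide cmod_power2)
    also have "\<dots> \<ge> 2 * c * norm z / (norm z)\<^sup>2" using assms(3) by (intro divide_right_mono) auto
    also have "2 * c * norm z / (norm z)\<^sup>2 = 2 * c * (1 / norm z)" by (simp add: power2_eq_square)
    finally show ?thesis .
  qed
  have "c * norm ((1 + u) / z) \<le> c * ((1 + c / 2) / norm z)"
    using n(1) assms(1) by (intro mult_left_mono) (auto simp: norm_divide intro: divide_right_mono)
  \<comment> \<open>After cancelling c/|z|, the inequality 1 + c/2 \<le> 2 - 1/2 is just c \<le>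
    1.\<close>
  also have "\<dots> \<le> (2 * c - c / 2) / norm z"
    using assms(1) c by (auto simp: divide_simps)
  also have "\<dots> = 2 * c * (1 / norm z) - c / 2 / norm z" by (simp add: diff_divide_distrib)
  also have "\<dots> \<le> \<bar>Im (1 / z)\<bar> - norm u / norm z"
    using im1 assms(4) by (intro diff_mono divide_right_mono) auto
  also have "\<dots> \<le> \<bar>Im (1 / z)\<bar> - \<bar>Im (u / z)\<bar>"
    using abs_Im_le_cmod[of "u / z"] by (simp add: norm_divide)
  also have "\<dots> \<le> \<bar>Im ((1 + u) / z)\<bar>"
    by (simp add: add_divide_distrib)
  finally show "c * norm ((1 + u) / z) \<le> \<bar>Im ((1 + u) / z)\<bar>" .
qed

lemma norm_fixed_point_map_le:
  assumes "borel_prob_measure m" "0 < c" "z \<noteq> 0" "2 * c * norm z \<le> \<bar>Im z\<bar>" "norm u \<le> c / 2"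
  shows "norm (cauchy_remainder m ((1 + u) / z)) \<le> (1 / c) * truncated_moment m (2 * norm z)"
proof -
  note p = perturbed_inverse_in_cone[OF assms(2-5)]
  have "norm (cauchy_remainder m ((1 + u) / z)) \<le> (1 / c) * truncated_moment m (1 / norm ((1 + u) / z))"
    by (intro norm_cauchy_remainder_le assms p)
  also have "\<dots> \<le> (1 / c) * truncated_moment m (2 * norm z)"
    using assms(2) by (intro mult_left_mono truncated_moment_mono assms(1) p) auto
  finally show ?thesis .
qed

text \<open>The powers of |z| cancel: displacement (u - v)/z against a kernel of size 2|z|/c. What
  remains is the Lipschitz constant 2T/c^2 for the truncated moment T, and the threshold c^2/4 makes
  it 1/2. The same threshold gives values of size at most T/c \<le> c/4, so the disc of radius c/2
  is mapped into itself.\<close>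

lemma fixed_point_map_contraction:
  assumes "borel_prob_measure m" "0 < c" "z \<noteq> 0" "2 * c * norm z \<le> \<bar>Im z\<bar>" "norm u \<le> c / 2"
    "norm v \<le> c / 2" "truncated_moment m (2 * norm z) \<le> c\<^sup>2 / 4"
  shows "norm (cauchy_remainder m ((1 + u) / z) - cauchy_remainder m ((1 + v) / z)) \<le> norm (u - v) / 2"
proof -
  note p = perturbed_inverse_in_cone[OF assms(2-5)] and q = perturbed_inverse_in_cone[OF assms(2-4,6)]
  have "norm (cauchy_remainder m ((1 + u) / z) - cauchy_remainder m ((1 + v) / z)) \<le>
    norm ((1 + u) / z - (1 + v) / z) * (1 / (c * norm ((1 + v) / z))) *
      ((1 / c) * truncated_moment m (1 / norm ((1 + u) / z)))"
    by (rule norm_cauchy_remainder_diff_le[OF assms(1,2) p(2,3) q(2,3)])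
  also have "norm ((1 + u) / z - (1 + v) / z) = norm (u - v) / norm z"
    by (simp add: norm_divide[symmetric] diff_divide_distrib[symmetric])
  also have "norm (u - v) / norm z * (1 / (c * norm ((1 + v) / z))) * ((1 / c) * truncated_moment m (1 / norm ((1 + u) / z)))
     \<le> norm (u - v) / norm z * (2 * norm z / c) * ((1 / c) * (c\<^sup>2 / 4))"
  proof (intro mult_mono)
    show "1 / (c * norm ((1 + v) / z)) \<le> 2 * norm z / c"
    proof -
      have "1 / (c * norm ((1 + v) / z)) = (1 / norm ((1 + v) / z)) / c" by simp
      also have "\<dots> \<le> 2 * norm z / c" using q(4) assms(2) by (intro divide_right_mono) auto
      finally show ?thesis .
    qed
    show "truncated_moment m (1 / norm ((1 + u) / z)) \<le> c\<^sup>2 / 4"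
      using truncated_moment_mono[OF assms(1) _ p(4)] assms(7) by simp
  qed (use assms truncated_moment_nonneg in auto)
  also have "\<dots> = norm (u - v) / 2"
    using assms(2,3) by (simp add: power2_eq_square)
  finally show ?thesis .
qed

text \<open>The value u = -1 has to be excluded: it corresponds to \<zeta> = 0, where \<zeta>
  G(\<zeta>) - 1 = -1 makes it a spurious fixed point for every measure.\<close>

lemma cauchy_transform_eq_iff_fixed_point:
  assumes "z \<noteq> 0" "1 + u \<noteq> 0"
  shows "cauchy_transform m ((1 + u) / z) = z \<longleftrightarrow> cauchy_remainder m ((1 + u) / z) = u"
proof
  assume "cauchy_remainder m ((1 + u) / z) = u"
  then have "(1 + u) * cauchy_transform m ((1 + u) / z) = (1 + u) * z"
    using assms(1) unfolding cauchy_remainder_def by (simp add: field_simps)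
  then show "cauchy_transform m ((1 + u) / z) = z" using assms(2) by simp
qed (use assms in \<open>simp add: cauchy_remainder_def\<close>)

lemma fixed_point_ex:
  assumes "borel_prob_measure m" "0 < c" "z \<noteq> 0" "2 * c * norm z \<le> \<bar>Im z\<bar>"
    "truncated_moment m (2 * norm z) \<le> c\<^sup>2 / 4"
  shows "\<exists>u. norm u \<le> c / 2 \<and> cauchy_remainder m ((1 + u) / z) = u"
proof -
  have "\<exists>!u\<in>cball 0 (c / 2). cauchy_remainder m ((1 + u) / z) = u"
  proof (rule Banach_fix[where c = "1 / 2"])
    have "norm (cauchy_remainder m ((1 + u) / z)) \<le> c / 2" if "norm u \<le> c / 2" for u
    proof -
      have "norm (cauchy_remainder m ((1 + u) / z)) \<le> (1 / c) * truncated_moment m (2 * norm z)"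
        by (intro norm_fixed_point_map_le assms that)
      also have "\<dots> \<le> (1 / c) * (c\<^sup>2 / 4)" using assms by (intro mult_left_mono) auto
      also have "\<dots> \<le> c / 2" using assms(2) by (simp add: power2_eq_square)
      finally show ?thesis .
    qed
    then show "(\<lambda>u. cauchy_remainder m ((1 + u) / z)) ` cball 0 (c / 2) \<subseteq> cball 0 (c / 2)" by auto
  next
    fix u v :: complex assume "u \<in> cball 0 (c / 2)" "v \<in> cball 0 (c / 2)"
    then show "dist (cauchy_remainder m ((1 + u) / z)) (cauchy_remainder m ((1 + v) / z)) \<le> 1 / 2 * dist u v"
      using fixed_point_map_contraction[OF assms(1-4) _ _ assms(5), of u v] by (simp add: dist_norm)
  qed (use assms in \<open>auto simp: complete_eq_closed\<close>)
  then show ?thesis by auto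
qed

lemma fixed_point_unique:
  assumes "borel_prob_measure m" "0 < c" "z \<noteq> 0" "2 * c * norm z \<le> \<bar>Im z\<bar>"
    "truncated_moment m (2 * norm z) \<le> c\<^sup>2 / 4"
    "norm u \<le> c / 2" "cauchy_remainder m ((1 + u) / z) = u"
    "norm v \<le> c / 2" "cauchy_remainder m ((1 + v) / z) = v"
  shows "u = v"
  using fixed_point_map_contraction[OF assms(1-4) assms(6,8,5)] assms(7,9) by simp

text \<open>A solution chosen pointwise is not visibly holomorphic in z. The contraction identifies
  it as the uniform limit of iterates, each of which is holomorphic.\<close>

lemma fixed_point_holomorphic:
  assumes m: "borel_prob_measure m" and c: "0 < c" and "open S"
    and S: "\<And>z. z \<in> S \<Longrightarrow> z \<noteq> 0 \<and> 2 * c * norm z \<le> \<bar>Im z\<bar> \<and> truncated_moment m (2 * norm z) \<le> c\<^sup>2 / 4"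
    and u: "\<And>z. z \<in> S \<Longrightarrow> norm (u z) \<le> c / 2 \<and> cauchy_remainder m ((1 + u z) / z) = u z"
  shows "u holomorphic_on S"
proof -
  \<comment> \<open>Iteration starts at the constant 0, at distance at most c/2 from the fixed
    point; each step halves the distance at a rate independent of z.\<close>
  define it where "it k z = ((\<lambda>v. cauchy_remainder m ((1 + v) / z)) ^^ k) 0" for k z
  have bound: "norm (it k z) \<le> c / 2" if "z \<in> S" for k z
  proof (induction k)
    case (Suc k)
    have "norm (cauchy_remainder m ((1 + it k z) / z)) \<le> (1 / c) * truncated_moment m (2 * norm z)"
      using S[OF that] by (intro norm_fixed_point_map_le m c Suc.IH) auto
    also have "\<dots> \<le> (1 / c) * (c\<^sup>2 / 4)" using S[OF that] c by (intro mult_left_mono) auto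
    also have "\<dots> \<le> c / 2" using c by (simp add: power2_eq_square)
    finally show ?case by (simp add: it_def)
  qed (use c in \<open>simp add: it_def\<close>)
  have hol: "it k holomorphic_on S" for k
  proof (induction k)
    case (Suc k)
    have "cauchy_remainder m \<circ> (\<lambda>z. (1 + it k z) / z) holomorphic_on S"
    proof (rule holomorphic_on_compose_gen[OF _ holomorphic_cauchy_remainder[OF m]])
      show "(\<lambda>z. (1 + it k z) / z) holomorphic_on S"
        using S by (intro holomorphic_intros Suc.IH) auto
      show "(\<lambda>z. (1 + it k z) / z) ` S \<subseteq> {\<zeta>. Im \<zeta> \<noteq> 0}"
      proof clarify
        fix z assume z: "z \<in> S" "Im ((1 + it k z) / z) = 0"
        then show False
          using cone_Im_nonzero[OF c] perturbed_inverse_in_cone(2,3)[OF c _ _ bound[OF z(1)]] S[OF z(1)]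
          by blast
      qed
    qed
    then show ?case by (simp add: it_def o_def)
  qed (simp add: it_def)
  have close: "norm (it k z - u z) \<le> c / 2 * (1 / 2) ^ k" if "z \<in> S" for k z
  proof (induction k)
    case (Suc k)
    have "norm (it (Suc k) z - u z) =
        norm (cauchy_remainder m ((1 + it k z) / z) - cauchy_remainder m ((1 + u z) / z))"
      using u[OF that] by (simp add: it_def)
    also have "\<dots> \<le> norm (it k z - u z) / 2"
      by (rule fixed_point_map_contraction[OF m c _ _ bound[OF that]]) (use S[OF that] u[OF that] in auto)
    also have "\<dots> \<le> c / 2 * (1 / 2) ^ k / 2" using Suc.IH by simp
    finally show ?case by simp
  qed (use u[OF that] in \<open>simp add: it_def\<close>)
  have unif: "uniform_limit S it u sequentially"
  proof (rule uniform_limitI)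
    fix e :: real assume "e > 0"
    have "(\<lambda>k. c / 2 * (1 / 2) ^ k) \<longlonglongrightarrow> c / 2 * 0"
      by (intro tendsto_mult tendsto_const LIMSEQ_power_zero) auto
    then have "\<forall>\<^sub>F k in sequentially. c / 2 * (1 / 2) ^ k < e"
      using \<open>e > 0\<close> by (intro order_tendstoD(2)) auto
    then show "\<forall>\<^sub>F k in sequentially. \<forall>z\<in>S. dist (it k z) (u z) < e"
    proof eventually_elim
      case (elim k)
      show ?case unfolding dist_norm by (intro ballI le_less_trans[OF close elim])
    qed
  qed
  show ?thesis
  proof (rule holomorphic_uniform_sequence[OF \<open>open S\<close> hol])
    fix z assume "z \<in> S"
    then obtain d where "d > 0" "cball z d \<subseteq> S" using \<open>open S\<close> open_contains_cball by blast
    then show "\<exists>d>0. cball z d \<subseteq> S \<and> uniform_limit (cball z d) it u sequentially"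
      using uniform_limit_on_subset[OF unif] by blast
  qed
qed

subsection \<open>Existence and uniqueness of the R-transform\<close>

lemma mem_double_stolz:
  "z \<in> double_stolz \<alpha> \<beta> \<longleftrightarrow> Im z \<noteq> 0 \<and> \<bar>Im z\<bar> < \<beta> \<and> \<bar>Re z\<bar> < \<alpha> * \<bar>Im z\<bar>"
proof -
  have "z \<in> double_stolz \<alpha> \<beta> \<longleftrightarrow> z \<in> stolz_angle \<alpha> \<beta> \<or> cnj z \<in> stolz_angle \<alpha> \<beta>"
    unfolding double_stolz_def by (auto simp: image_iff) (metis complex_cnj_cnj)
  then show ?thesis unfolding stolz_angle_def by (auto simp: abs_if)
qed

lemma double_stolz_Int:
  "double_stolz \<alpha> \<beta> \<inter> double_stolz \<alpha>' \<beta>' = double_stolz (min \<alpha> \<alpha>') (min \<beta> \<beta>')"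
proof -
  have "\<bar>Re z\<bar> < min \<alpha> \<alpha>' * \<bar>Im z\<bar> \<longleftrightarrow> \<bar>Re z\<bar> < \<alpha> * \<bar>Im z\<bar> \<and> \<bar>Re z\<bar> < \<alpha>' * \<bar>Im z\<bar>" for z
    by (auto simp: min_mult_distrib_right)
  then show ?thesis by (auto simp: mem_double_stolz)
qed

lemma double_stolz_mono: "\<beta> \<le> \<beta>' \<Longrightarrow> double_stolz \<alpha> \<beta> \<subseteq> double_stolz \<alpha> \<beta>'"
  by (auto simp: mem_double_stolz)

lemma imaginary_mem_double_stolz:
  "0 < \<alpha> \<Longrightarrow> 0 < y \<Longrightarrow> y < \<beta> \<Longrightarrow> - \<i> * complex_of_real y \<in> double_stolz \<alpha> \<beta>"
  by (simp add: mem_double_stolz)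

lemma open_double_stolz: "open (double_stolz \<alpha> \<beta>)"
proof -
  have "double_stolz \<alpha> \<beta> = {z. Im z \<noteq> 0} \<inter> {z. \<bar>Im z\<bar> < \<beta>} \<inter> {z. \<bar>Re z\<bar> < \<alpha> * \<bar>Im z\<bar>}"
    by (auto simp: mem_double_stolz)
  then show ?thesis
    by (auto intro!: open_Int open_Im_nonzero open_Collect_less continuous_intros)
qed

text \<open>The identity theorem and the open mapping theorem need a connected domain. With \<sigma>
  = 1 or -1 this is one component of the double angle, so both components are handled by a single
  argument.\<close>

definition half_stolz :: "real \<Rightarrow> real \<Rightarrow> real \<Rightarrow> complex set" where
  "half_stolz \<sigma> \<alpha> \<beta> = {z \<in> double_stolz \<alpha> \<beta>. 0 < \<sigma> * Im z}"

lemma open_half_stolz: "open (half_stolz \<sigma> \<alpha> \<beta>)"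
proof -
  have "half_stolz \<sigma> \<alpha> \<beta> = double_stolz \<alpha> \<beta> \<inter> {z. 0 < \<sigma> * Im z}"
    by (auto simp: half_stolz_def)
  then show ?thesis
    by (auto intro!: open_Int open_double_stolz open_Collect_less continuous_intros)
qed

lemma connected_half_stolz:
  assumes "\<sigma> \<in> {1, -1}"
  shows "connected (half_stolz \<sigma> \<alpha> \<beta>)"
proof (rule convex_connected)
  have eq: "half_stolz \<sigma> \<alpha> \<beta> = {z. 0 < \<sigma> * Im z} \<inter> {z. \<sigma> * Im z < \<beta>} \<inter>
      {z. Re z - \<alpha> * (\<sigma> * Im z) < 0} \<inter> {z. - Re z - \<alpha> * (\<sigma> * Im z) < 0}"
    using assms by (auto simp: half_stolz_def mem_double_stolz abs_if split: if_splits)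
  have lin: "linear (\<lambda>z. \<sigma> * Im z)" "linear (\<lambda>z. Re z - \<alpha> * (\<sigma> * Im z))" "linear (\<lambda>z. - Re z - \<alpha> * (\<sigma> * Im z))"
    by (auto intro!: linearI simp: algebra_simps)
  have gt: "convex {z. a < f z}" and lt: "convex {z. f z < a}" if "linear f"
    for f :: "complex \<Rightarrow> real" and a
  proof -
    have "{z. a < f z} = f -` {a<..}" "{z. f z < a} = f -` {..<a}" by auto
    then show "convex {z. a < f z}" "convex {z. f z < a}"
      using that by (auto intro!: convex_linear_vimage)
  qed
  show "convex (half_stolz \<sigma> \<alpha> \<beta>)"
    unfolding eq by (intro convex_Int gt lt lin)
qed

lemma double_stolz_eq_Un: "double_stolz \<alpha> \<beta> = half_stolz 1 \<alpha> \<beta> \<union> half_stolz (-1) \<alpha> \<beta>"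
  by (auto simp: half_stolz_def mem_double_stolz)

lemma half_stolz_cases:
  assumes "z \<in> double_stolz \<alpha> \<beta>"
  obtains \<sigma> where "\<sigma> \<in> {1, -1}" "z \<in> half_stolz \<sigma> \<alpha> \<beta>"
  using assms that unfolding double_stolz_eq_Un by blast

text \<open>On the angle |z| \<le> |Re z| + |Im z| \<le> (1 + \<alpha>)|Im z|, so 1/(1 + \<alpha>)
  is an admissible cone constant. Half of it is taken because
  \<open>perturbed_inverse_in_cone\<close> asks for 2c at z in order to keep c at (1 + u)/z.\<close>

definition stolz_const :: "real \<Rightarrow> real" where
  "stolz_const \<alpha> = 1 / (2 * (1 + \<alpha>))"

lemma stolz_const_bounds:
  assumes "0 < \<alpha>"
  shows "0 < stolz_const \<alpha>" "stolz_const \<alpha> < 1 / 2"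
  using assms by (auto simp: stolz_const_def field_simps)

lemma double_stolz_in_cone:
  assumes "0 < \<alpha>" "z \<in> double_stolz \<alpha> \<beta>"
  shows "z \<noteq> 0" "2 * stolz_const \<alpha> * norm z \<le> \<bar>Im z\<bar>" "norm z \<le> (1 + \<alpha>) * \<beta>"
proof -
  have z: "Im z \<noteq> 0" "\<bar>Im z\<bar> < \<beta>" "\<bar>Re z\<bar> < \<alpha> * \<bar>Im z\<bar>"
    using assms(2) by (auto simp: mem_double_stolz)
  then show "z \<noteq> 0" by auto
  have "norm z \<le> (1 + \<alpha>) * \<bar>Im z\<bar>"
    using cmod_le[of z] z(3) by (simp add: algebra_simps)
  then show "2 * stolz_const \<alpha> * norm z \<le> \<bar>Im z\<bar>" "norm z \<le> (1 + \<alpha>) * \<beta>"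
    using assms(1) z(2) mult_left_mono[of "\<bar>Im z\<bar>" \<beta> "1 + \<alpha>"]
    by (auto simp: stolz_const_def field_simps)
qed

text \<open>Smallness over the whole angle reduces to one number: |z| is at most (1 +
  \<alpha>)\<beta> there, the truncated moment increases with the radius, and the factor 2 comes
  from 1/|\<zeta>| \<le> 2|z|. The additional bounds are recorded because they fail to be part of
  the definition of an R-transform and drive all later estimates.\<close>

lemma R_transform_exists:
  assumes m: "borel_prob_measure m" and \<alpha>: "0 < \<alpha>" "0 < \<beta>"
    and small: "truncated_moment m (2 * ((1 + \<alpha>) * \<beta>)) \<le> (stolz_const \<alpha>)\<^sup>2 / 4"
  shows "\<exists>f. is_R_transform_on (double_stolz \<alpha> \<beta>) m f \<and>
    (\<forall>z\<in>double_stolz \<alpha> \<beta>. norm (z * f z) \<le> stolz_const \<alpha> / 2 \<and>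
      cauchy_remainder m ((1 + z * f z) / z) = z * f z \<and>
      norm (z * f z) \<le> (1 / stolz_const \<alpha>) * truncated_moment m (2 * norm z))"
proof -
  let ?D = "double_stolz \<alpha> \<beta>"
  define c where "c = stolz_const \<alpha>"
  have c: "0 < c" "c < 1 / 2" using stolz_const_bounds[OF \<alpha>(1)] by (auto simp: c_def)
  have D: "z \<noteq> 0" "2 * c * norm z \<le> \<bar>Im z\<bar>" "truncated_moment m (2 * norm z) \<le> c\<^sup>2 / 4" if "z \<in> ?D" for z
  proof -
    show "z \<noteq> 0" "2 * c * norm z \<le> \<bar>Im z\<bar>"
      using double_stolz_in_cone[OF \<alpha>(1) that] by (auto simp: c_def)
    have "truncated_moment m (2 * norm z) \<le> truncated_moment m (2 * ((1 + \<alpha>) * \<beta>))"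
      using double_stolz_in_cone(3)[OF \<alpha>(1) that] by (intro truncated_moment_mono m) auto
    then show "truncated_moment m (2 * norm z) \<le> c\<^sup>2 / 4" using small by (simp add: c_def)
  qed
  obtain u where u: "\<And>z. z \<in> ?D \<Longrightarrow> norm (u z) \<le> c / 2 \<and> cauchy_remainder m ((1 + u z) / z) = u z"
    using fixed_point_ex[OF m c(1) D] by metis
  have hol: "u holomorphic_on ?D"
    using D u by (intro fixed_point_holomorphic[OF m c(1) open_double_stolz]) auto
  have bound: "norm (u z) \<le> (1 / c) * truncated_moment m (2 * norm z)" if "z \<in> ?D" for z
    using norm_fixed_point_map_le[OF m c(1) D(1,2)[OF that], of "u z"] u[OF that] by simp
  define f where "f z = u z / z" for z
  have zf: "z * f z = u z" if "z \<in> ?D" for z using D(1)[OF that] by (simp add: f_def)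
  have Ff: "1 / z + f z = (1 + u z) / z" if "z \<in> ?D" for z
    using D(1)[OF that] by (simp add: f_def add_divide_distrib)
  have "is_R_transform_on ?D m f"
    unfolding is_R_transform_on_def
  proof (intro conjI ballI)
    show "f holomorphic_on ?D"
      unfolding f_def[abs_def] using D(1) by (intro holomorphic_intros hol) auto
    fix z assume z: "z \<in> ?D"
    show "1 / z + f z \<notin> \<real>"
      unfolding Ff[OF z] complex_is_Real_iff
      by (rule cone_Im_nonzero[OF c(1)]) (use perturbed_inverse_in_cone[OF c(1) D(1,2)[OF z]] u[OF z] in auto)
    have "1 + u z \<noteq> 0"
      using perturbed_inverse_in_cone(2)[OF c(1) D(1,2)[OF z]] u[OF z] by auto
    then show "cauchy_transform m (1 / z + f z) = z"
      unfolding Ff[OF z] using cauchy_transform_eq_iff_fixed_point[OF D(1)[OF z]] u[OF z] by blast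
  next
    show "((\<lambda>z. z * f z) \<longlongrightarrow> 0) (at 0 within ?D)"
    proof (rule tendstoI)
      fix e :: real assume "0 < e"
      then obtain \<rho> where \<rho>: "0 < \<rho>" "\<And>r. 0 \<le> r \<Longrightarrow> r \<le> \<rho> \<Longrightarrow> truncated_moment m r < c * e"
        using truncated_moment_small[OF m, of "c * e"] c by auto
      have "dist (z * f z) 0 < e" if "z \<in> ?D" "norm z < \<rho> / 2" for z
      proof -
        have "norm (u z) \<le> (1 / c) * truncated_moment m (2 * norm z)" by (rule bound[OF that(1)])
        also have "\<dots> < (1 / c) * (c * e)"
          using \<rho>(2)[of "2 * norm z"] that(2) c by (intro mult_strict_left_mono) auto
        also have "\<dots> = e" using c by simp
        finally show ?thesis using zf[OF that(1)] by simp
      qed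
      then show "\<forall>\<^sub>F z in at 0 within ?D. dist (z * f z) 0 < e"
        unfolding eventually_at using \<rho>(1) by (intro exI[of _ "\<rho> / 2"]) auto
    qed
  qed
  then show ?thesis using zf u bound unfolding c_def by auto
qed

text \<open>An arbitrary R-transform lies in the disc where the fixed point is unique only close to
  0; the radius depends on f. The bound c \<le> 1 keeps the spurious fixed point -1 out of the
  disc.\<close>

lemma R_transform_near_0_fixed_point:
  assumes "borel_prob_measure m" "is_R_transform_on (double_stolz \<alpha> \<beta>) m f" "0 < c" "c \<le> 1"
  obtains \<delta> where "0 < \<delta>" "\<And>z. z \<in> double_stolz \<alpha> \<beta> \<Longrightarrow> norm z < \<delta> \<Longrightarrow>
    norm (z * f z) \<le> c / 2 \<and> cauchy_remainder m ((1 + z * f z) / z) = z * f z"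
proof -
  have "\<forall>\<^sub>F z in at 0 within double_stolz \<alpha> \<beta>. dist (z * f z) 0 < c / 2"
    using assms(2,3) unfolding is_R_transform_on_def by (intro tendstoD) auto
  then obtain \<delta> where \<delta>: "0 < \<delta>"
    "\<And>z. z \<in> double_stolz \<alpha> \<beta> \<Longrightarrow> z \<noteq> 0 \<Longrightarrow> norm z < \<delta> \<Longrightarrow> norm (z * f z) < c / 2"
    unfolding eventually_at by auto
  have "norm (z * f z) \<le> c / 2 \<and> cauchy_remainder m ((1 + z * f z) / z) = z * f z"
    if z: "z \<in> double_stolz \<alpha> \<beta>" "norm z < \<delta>" for z
  proof -
    have z0: "z \<noteq> 0" using z(1) by (auto simp: mem_double_stolz)
    have "norm (z * f z) < c / 2" using \<delta>(2)[OF z(1) z0 z(2)] .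
    moreover have "1 + z * f z \<noteq> 0"
    proof
      assume "1 + z * f z = 0"
      then have "z * f z = - 1" by (simp add: add_eq_0_iff)
      then show False using \<open>norm (z * f z) < c / 2\<close> assms(4) by simp
    qed
    moreover have "1 / z + f z = (1 + z * f z) / z" using z0 by (simp add: field_simps)
    moreover have "cauchy_transform m (1 / z + f z) = z"
      using assms(2) z(1) by (auto simp: is_R_transform_on_def)
    ultimately show ?thesis
      using cauchy_transform_eq_iff_fixed_point[OF z0] by auto
  qed
  then show thesis using that[of \<delta>] \<delta>(1) by blast
qed

lemma R_transform_unique:
  assumes m: "borel_prob_measure m" and pos: "0 < \<alpha>" "0 < \<beta>" "0 < \<alpha>'" "0 < \<beta>'"
    and f: "is_R_transform_on (double_stolz \<alpha> \<beta>) m f"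
    and g: "is_R_transform_on (double_stolz \<alpha>' \<beta>') m g"
    and z: "z \<in> double_stolz \<alpha> \<beta>" "z \<in> double_stolz \<alpha>' \<beta>'"
  shows "f z = g z"
proof -
  define a b where "a = min \<alpha> \<alpha>'" and "b = min \<beta> \<beta>'"
  have ab: "0 < a" "0 < b" using pos by (auto simp: a_def b_def)
  have Int: "double_stolz \<alpha> \<beta> \<inter> double_stolz \<alpha>' \<beta>' = double_stolz a b"
    by (simp add: double_stolz_Int a_def b_def)
  define c where "c = stolz_const a"
  have c: "0 < c" "c \<le> 1" using stolz_const_bounds[OF ab(1)] by (auto simp: c_def)
  obtain d1 where d1: "0 < d1" "\<And>z. z \<in> double_stolz \<alpha> \<beta> \<Longrightarrow> norm z < d1 \<Longrightarrow>
    norm (z * f z) \<le> c / 2 \<and> cauchy_remainder m ((1 + z * f z) / z) = z * f z"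
    using R_transform_near_0_fixed_point[OF m f c] by blast
  obtain d2 where d2: "0 < d2" "\<And>z. z \<in> double_stolz \<alpha>' \<beta>' \<Longrightarrow> norm z < d2 \<Longrightarrow>
    norm (z * g z) \<le> c / 2 \<and> cauchy_remainder m ((1 + z * g z) / z) = z * g z"
    using R_transform_near_0_fixed_point[OF m g c] by blast
  obtain \<rho> where \<rho>: "0 < \<rho>" "\<And>r. 0 \<le> r \<Longrightarrow> r \<le> \<rho> \<Longrightarrow> truncated_moment m r < c\<^sup>2 / 4"
    using truncated_moment_small[OF m, of "c\<^sup>2 / 4"] c by auto
  define d where "d = min (min d1 d2) (\<rho> / 2)"
  have d: "0 < d" using d1(1) d2(1) \<rho>(1) by (auto simp: d_def)
  have eq: "f w = g w" if w: "w \<in> double_stolz a b" "norm w < d" for w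
  proof -
    have w': "w \<in> double_stolz \<alpha> \<beta>" "w \<in> double_stolz \<alpha>' \<beta>'" using w(1) Int by auto
    have tm: "truncated_moment m (2 * norm w) \<le> c\<^sup>2 / 4"
      using \<rho>(2)[of "2 * norm w"] w(2) by (simp add: d_def)
    note D = double_stolz_in_cone[OF ab(1) w(1), folded c_def]
    have "w * f w = w * g w"
      by (rule fixed_point_unique[OF m c(1) D(1,2) tm]) (use d1(2)[OF w'(1)] d2(2)[OF w'(2)] w(2) in \<open>auto simp: d_def\<close>)
    then show ?thesis using D(1) by simp
  qed
  obtain \<sigma> where \<sigma>: "\<sigma> \<in> {1, -1}" "z \<in> half_stolz \<sigma> a b"
    using half_stolz_cases[of z a b] z Int by blast
  have sub: "half_stolz \<sigma> a b \<subseteq> double_stolz a b" by (auto simp: half_stolz_def)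
  define y where "y = min b d / 2"
  have y: "0 < y" "y < b" "y < d" using ab d by (auto simp: y_def)
  \<comment> \<open>Every angle contains a segment of the imaginary axis ending at 0, so the
    neighbourhood of agreement meets the component of z.\<close>
  have point: "\<i> * of_real (\<sigma> * y) \<in> half_stolz \<sigma> a b \<inter> ball 0 d"
    using \<sigma>(1) y ab(1) by (auto simp: half_stolz_def mem_double_stolz abs_mult norm_mult)
  show ?thesis
  proof (rule analytic_continuation_open[where s = "half_stolz \<sigma> a b \<inter> ball 0 d" and s' = "half_stolz \<sigma> a b"
        and f = f and g = g and z = z])
    show "half_stolz \<sigma> a b \<inter> ball 0 d \<noteq> {}" using point by auto
    show "f holomorphic_on half_stolz \<sigma> a b" "g holomorphic_on half_stolz \<sigma> a b"
      using f g sub Int unfolding is_R_transform_on_def by (auto intro: holomorphic_on_subset)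
  qed (use \<sigma> sub eq in \<open>auto intro!: open_half_stolz connected_half_stolz\<close>)
qed

lemma R_transform_eq:
  assumes "borel_prob_measure m" "0 < \<alpha>" "0 < \<beta>" "is_R_transform_on (double_stolz \<alpha> \<beta>) m f"
    "z \<in> double_stolz \<alpha> \<beta>"
  shows "R_transform m z = f z"
  unfolding R_transform_def
proof (rule the_equality)
  show "\<exists>\<alpha>>0. \<exists>\<beta>>0. \<exists>g. is_R_transform_on (double_stolz \<alpha> \<beta>) m g \<and> z \<in> double_stolz \<alpha> \<beta> \<and> f z = g z"
    using assms(2-5) by blast
next
  fix c assume "\<exists>\<alpha>>0. \<exists>\<beta>>0. \<exists>g. is_R_transform_on (double_stolz \<alpha> \<beta>) m g \<and> z \<in> double_stolz \<alpha> \<beta> \<and> c = g z"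
  then show "c = f z" using R_transform_unique[OF assms(1)] assms(2-5) by metis
qed

lemma is_R_transform_on_cong:
  assumes "\<And>z. z \<in> D \<Longrightarrow> f z = g z"
  shows "is_R_transform_on D m f \<longleftrightarrow> is_R_transform_on D m g"
proof -
  have "((\<lambda>z. z * f z) \<longlongrightarrow> 0) (at 0 within D) \<longleftrightarrow> ((\<lambda>z. z * g z) \<longlongrightarrow> 0) (at 0 within D)"
    by (rule tendsto_cong) (auto simp: eventually_at_filter assms)
  moreover have "f holomorphic_on D \<longleftrightarrow> g holomorphic_on D"
    using assms by (rule holomorphic_cong[OF refl])
  ultimately show ?thesis using assms unfolding is_R_transform_on_def by auto
qed

lemma is_R_transform_on_R_transform:
  assumes "borel_prob_measure m" "0 < \<alpha>" "0 < \<beta>" "R_transform_defined \<alpha> \<beta> m"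
  shows "is_R_transform_on (double_stolz \<alpha> \<beta>) m (R_transform m)"
  using assms R_transform_eq[OF assms(1-3)] is_R_transform_on_cong unfolding R_transform_defined_def
  by metis

section \<open>The right inverse of the Cauchy transform\<close>

definition R_inverse :: "real measure \<Rightarrow> complex \<Rightarrow> complex" where
  "R_inverse m z = 1 / z + R_transform m z"

lemma R_inverse_props:
  assumes "borel_prob_measure m" "0 < \<alpha>" "0 < \<beta>" "R_transform_defined \<alpha> \<beta> m" "z \<in> double_stolz \<alpha> \<beta>"
  shows "Im (R_inverse m z) \<noteq> 0" "cauchy_transform m (R_inverse m z) = z"
    "Im z * Im (R_inverse m z) < 0" "z * R_inverse m z = 1 + z * R_transform m z"
proof -
  note R = is_R_transform_on_R_transform[OF assms(1-4)]
  show nz: "Im (R_inverse m z) \<noteq> 0" and G: "cauchy_transform m (R_inverse m z) = z"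
    using R assms(5) by (auto simp: is_R_transform_on_def R_inverse_def complex_is_Real_iff)
  show "Im z * Im (R_inverse m z) < 0"
    using Im_cauchy_transform(3)[OF assms(1) nz] G by (simp add: mult.commute)
  show "z * R_inverse m z = 1 + z * R_transform m z"
    using assms(5) by (auto simp: R_inverse_def mem_double_stolz field_simps)
qed

lemma holomorphic_R_inverse:
  assumes "borel_prob_measure m" "0 < \<alpha>" "0 < \<beta>" "R_transform_defined \<alpha> \<beta> m"
  shows "R_inverse m holomorphic_on double_stolz \<alpha> \<beta>"
  using is_R_transform_on_R_transform[OF assms]
  unfolding R_inverse_def[abs_def] is_R_transform_on_def
  by (intro holomorphic_intros) (auto simp: mem_double_stolz)

lemma R_transform_small_moment:
  assumes "borel_prob_measure m" "0 < \<alpha>" "0 < \<beta>"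
    and "truncated_moment m (2 * ((1 + \<alpha>) * \<beta>)) \<le> (stolz_const \<alpha>)\<^sup>2 / 4"
  shows "R_transform_defined \<alpha> \<beta> m"
    and "z \<in> double_stolz \<alpha> \<beta> \<Longrightarrow> norm (z * R_transform m z) \<le> stolz_const \<alpha> / 2"
    and "z \<in> double_stolz \<alpha> \<beta> \<Longrightarrow> cauchy_remainder m ((1 + z * R_transform m z) / z) = z * R_transform m z"
    and "z \<in> double_stolz \<alpha> \<beta> \<Longrightarrow>
      norm (z * R_transform m z) \<le> (1 / stolz_const \<alpha>) * truncated_moment m (2 * norm z)"
proof -
  obtain f where f: "is_R_transform_on (double_stolz \<alpha> \<beta>) m f" and
    f': "\<forall>z\<in>double_stolz \<alpha> \<beta>. norm (z * f z) \<le> stolz_const \<alpha> / 2 \<and>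
      cauchy_remainder m ((1 + z * f z) / z) = z * f z \<and>
      norm (z * f z) \<le> (1 / stolz_const \<alpha>) * truncated_moment m (2 * norm z)"
    using R_transform_exists[OF assms] by blast
  show "R_transform_defined \<alpha> \<beta> m" using f by (auto simp: R_transform_defined_def)
  show "norm (z * R_transform m z) \<le> stolz_const \<alpha> / 2"
    "cauchy_remainder m ((1 + z * R_transform m z) / z) = z * R_transform m z"
    "norm (z * R_transform m z) \<le> (1 / stolz_const \<alpha>) * truncated_moment m (2 * norm z)"
    if "z \<in> double_stolz \<alpha> \<beta>"
    using f' that R_transform_eq[OF assms(1-3) f that] by auto
qed

subsection \<open>Marginals and the bi-free transform near the origin\<close>

lemma borel_prob_distr:
  assumes "borel_prob_measure M" "f \<in> borel_measurable borel"
  shows "borel_prob_measure (distr M borel f)"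
proof -
  interpret prob_space M by (rule borel_prob_measureD[OF assms(1)])
  have "f \<in> borel_measurable M"
    using assms borel_prob_measureD(2)[OF assms(1)] measurable_cong_sets by blast
  then show ?thesis
    unfolding borel_prob_measure_def using prob_space_distr by auto
qed

lemma borel_prob_marginal:
  assumes "borel_prob_measure M"
  shows "borel_prob_measure (marginal1 M)" "borel_prob_measure (marginal2 M)"
  unfolding marginal1_def marginal2_def
  by (intro borel_prob_distr assms borel_measurable_continuous_onI continuous_intros)+

lemma integral_marginal:
  fixes f :: "real \<Rightarrow> 'b::{banach, second_countable_topology}"
  assumes "borel_prob_measure M" "f \<in> borel_measurable borel"
  shows "integral\<^sup>L (marginal1 M) f = (LINT p|M. f (fst p))"
    "integral\<^sup>L (marginal2 M) f = (LINT p|M. f (snd p))"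
    "integrable (marginal1 M) f \<longleftrightarrow> integrable M (\<lambda>p. f (fst p))"
    "integrable (marginal2 M) f \<longleftrightarrow> integrable M (\<lambda>p. f (snd p))"
proof -
  have "fst \<in> borel_measurable M" "snd \<in> borel_measurable M"
    using borel_prob_measureD(2)[OF assms(1)] borel_measurable_continuous_onI[OF continuous_on_fst[OF continuous_on_id]]
      borel_measurable_continuous_onI[OF continuous_on_snd[OF continuous_on_id]] measurable_cong_sets
    by blast+
  then show "integral\<^sup>L (marginal1 M) f = (LINT p|M. f (fst p))"
    "integral\<^sup>L (marginal2 M) f = (LINT p|M. f (snd p))"
    "integrable (marginal1 M) f \<longleftrightarrow> integrable M (\<lambda>p. f (fst p))"
    "integrable (marginal2 M) f \<longleftrightarrow> integrable M (\<lambda>p. f (snd p))"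
    unfolding marginal1_def marginal2_def
    by (simp_all add: integral_distr integrable_distr_eq assms(2))
qed

section \<open>Exchange of the coordinates\<close>

text \<open>All bi-free quantities are symmetric under this exchange. Limits are therefore taken
  only in the second variable, and the statements about the second marginal are those about the
  first one for the swapped measure.\<close>

definition swap_measure :: "(real \<times> real) measure \<Rightarrow> (real \<times> real) measure" where
  "swap_measure M = distr M borel (\<lambda>p. (snd p, fst p))"

lemma measurable_swap: "(\<lambda>p. (snd p, fst p)) \<in> borel_measurable (borel :: (real \<times> real) measure)"
  by (intro borel_measurable_continuous_onI continuous_intros)

lemma borel_prob_swap: "borel_prob_measure M \<Longrightarrow> borel_prob_measure (swap_measure M)"
  unfolding swap_measure_def by (intro borel_prob_distr measurable_swap)

lemma swap_measure_props:
  assumes "borel_prob_measure M"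
  shows "marginal1 (swap_measure M) = marginal2 M" "marginal2 (swap_measure M) = marginal1 M"
    "cauchy_transform2 (swap_measure M) a b = cauchy_transform2 M b a"
proof -
  have s: "(\<lambda>p. (snd p, fst p)) \<in> measurable M borel"
    using borel_prob_measureD(2)[OF assms] measurable_swap measurable_cong_sets by blast
  show "marginal1 (swap_measure M) = marginal2 M" "marginal2 (swap_measure M) = marginal1 M"
    unfolding swap_measure_def marginal1_def marginal2_def
    by (subst distr_distr[OF borel_measurable_continuous_onI s], auto intro!: continuous_intros simp: o_def)+
  have "(\<lambda>p :: real \<times> real. 1 / ((a - of_real (fst p)) * (b - of_real (snd p)))) \<in> borel_measurable borel"
    by (simp add: borel_prod[symmetric])
  then show "cauchy_transform2 (swap_measure M) a b = cauchy_transform2 M b a"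
    unfolding swap_measure_def cauchy_transform2_def
    by (subst integral_distr[OF s]) (auto simp: mult.commute)
qed

lemma bifree_swap:
  assumes "borel_prob_measure M"
  shows "bifree_h (swap_measure M) z w = bifree_h M w z" "bifree_R (swap_measure M) z w = bifree_R M w z"
    "bifree_R_defined \<alpha> \<beta> (swap_measure M) \<longleftrightarrow> bifree_R_defined \<alpha> \<beta> M"
proof -
  show h: "bifree_h (swap_measure M) z w = bifree_h M w z" for z w
    unfolding bifree_h_def swap_measure_props[OF assms] by (simp add: mult.commute)
  show "bifree_R (swap_measure M) z w = bifree_R M w z"
    unfolding bifree_R_def h swap_measure_props[OF assms] by simp
  show "bifree_R_defined \<alpha> \<beta> (swap_measure M) \<longleftrightarrow> bifree_R_defined \<alpha> \<beta> M"
    unfolding bifree_R_defined_def h swap_measure_props[OF assms] by auto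
qed

section \<open>Estimates for h - 1\<close>

lemma bifree_h_eq: "bifree_h M z w =
    cauchy_transform2 M (R_inverse (marginal1 M) z) (R_inverse (marginal2 M) w) / (z * w)"
  by (simp add: bifree_h_def R_inverse_def)

lemma integrable_cauchy_kernel2:
  assumes "borel_prob_measure M" "Im a \<noteq> 0" "Im b \<noteq> 0"
  shows "integrable M (\<lambda>p. 1 / ((a - of_real (fst p)) * (b - of_real (snd p))))"
proof -
  interpret prob_space M by (rule borel_prob_measureD[OF assms(1)])
  have [measurable_cong]: "sets M = sets (borel \<Otimes>\<^sub>M borel)"
    by (simp only: borel_prod borel_prob_measureD(2)[OF assms(1)])
  have "integrable M (\<lambda>p. (1 / (b - of_real (snd p))) / (a - of_real (fst p)))"
    by (rule integrable_cauchy_kernel[where B = "1 / \<bar>Im b\<bar>"])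
       (use norm_cauchy_kernel_le assms in auto)
  then show ?thesis by (simp add: mult.commute)
qed

text \<open>With the rescaled kernels A(s) = 1/(z(a - s)) and B(t) = 1/(w(b - t)) the ratio is the
  integral of A B, and the integral of A alone is G(a)/z = 1. Hence the difference is the integral
  of A (B - 1). Bounding A uniformly leaves a function of t only, so the dependence between the
  coordinates plays no part.\<close>

lemma bifree_ratio_minus_1_le:
  assumes M: "borel_prob_measure M" and im: "Im a \<noteq> 0" "Im b \<noteq> 0"
    and z: "cauchy_transform (marginal1 M) a = z" "z \<noteq> 0" "w \<noteq> 0"
    and K: "\<And>s. norm (1 / (z * (a - of_real s))) \<le> K"
    and g: "\<And>t. norm (1 / (w * (b - of_real t)) - 1) \<le> g t" "integrable (marginal2 M) g"
  shows "norm (cauchy_transform2 M a b / (z * w) - 1) \<le> K * integral\<^sup>L (marginal2 M) g"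
proof -
  interpret prob_space M by (rule borel_prob_measureD[OF M])
  have [measurable_cong]: "sets M = sets (borel \<Otimes>\<^sub>M borel)"
    by (simp only: borel_prod borel_prob_measureD(2)[OF M])
  define A where "A s = 1 / (z * (a - complex_of_real s))" for s
  define B where "B t = 1 / (w * (b - complex_of_real t))" for t
  have [measurable]: "A \<in> borel_measurable borel" "B \<in> borel_measurable borel"
    unfolding A_def B_def by measurable
  have g_meas: "g \<in> borel_measurable borel"
    using borel_measurable_integrable[OF g(2)] borel_prob_measureD(2)[OF borel_prob_marginal(2)[OF M]]
      measurable_cong_sets by blast
  have A_eq: "A s = (1 / z) * (1 / (a - of_real s))" for s by (simp add: A_def)
  have intA: "integrable M (\<lambda>p. A (fst p))"
    unfolding A_eq using integrable_cauchy_kernel1[OF borel_prob_marginal(1)[OF M] im(1)]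
    by (intro integrable_mult_right) (subst (asm) integral_marginal(3)[OF M], auto)
  have "(LINT p|M. A (fst p)) = (1 / z) * (LINT p|M. 1 / (a - of_real (fst p)))"
    unfolding A_eq by (rule integral_mult_right_zero)
  also have "(LINT p|M. 1 / (a - of_real (fst p))) = z"
    using z(1) unfolding cauchy_transform_def by (subst (asm) integral_marginal(1)[OF M]) auto
  finally have A1: "(LINT p|M. A (fst p)) = 1" using z(2) by simp
  have AB: "A s * B t = (1 / (z * w)) * (1 / ((a - of_real s) * (b - of_real t)))" for s t
    by (simp add: A_def B_def)
  have intAB: "integrable M (\<lambda>p. A (fst p) * B (snd p))"
    unfolding AB by (intro integrable_mult_right integrable_cauchy_kernel2 M im)
  have "(LINT p|M. A (fst p) * B (snd p)) = cauchy_transform2 M a b / (z * w)"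
    unfolding AB cauchy_transform2_def by (subst integral_mult_right_zero) simp
  then have "cauchy_transform2 M a b / (z * w) - 1 = (LINT p|M. A (fst p) * B (snd p) - A (fst p))"
    using intA intAB A1 by simp
  also have "norm \<dots> \<le> (LINT p|M. K * g (snd p))"
  proof (rule norm_integral_le_integral)
    show "integrable M (\<lambda>p. K * g (snd p))"
      using g(2) integral_marginal(4)[OF M g_meas] by (intro integrable_mult_right) auto
    have "norm (A s * B t - A s) \<le> K * g t" for s t
    proof -
      have "A s * B t - A s = A s * (B t - 1)" by (simp add: algebra_simps)
      moreover have "norm (A s) \<le> K" using K by (simp add: A_def)
      moreover have "norm (B t - 1) \<le> g t" using g(1) by (simp add: B_def)
      ultimately show ?thesis
        using order.trans[OF norm_ge_zero] by (metis mult_mono norm_ge_zero norm_mult)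
    qed
    then show "norm (A (fst p) * B (snd p) - A (fst p)) \<le> K * g (snd p)" for p .
  qed (use intA intAB in auto)
  also have "\<dots> = K * integral\<^sup>L (marginal2 M) g"
    using integral_marginal(2)[OF M g_meas] by simp
  finally show ?thesis .
qed

text \<open>Since w b = 1 + u, the difference 1/(w(b - t)) - 1 splits into t/(b - t), controlled by
  \<open>kernel_ratio_le\<close>, and u times the rescaled kernel, controlled by the first
  claim.\<close>

lemma rescaled_kernel_bounds:
  assumes c: "0 < c" and w: "w \<noteq> 0" "2 * c * norm w \<le> \<bar>Im w\<bar>" "norm u \<le> c / 2" "w * b = 1 + u"
  shows "norm (1 / (w * (b - of_real t))) \<le> 2 / c"
    and "norm (1 / (w * (b - of_real t)) - 1) \<le> (1 / c) * min 1 (2 * norm w * \<bar>t\<bar>) + 2 / c * norm u"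
proof -
  have b: "b = (1 + u) / w" using w(1,4) by (simp add: field_simps)
  note p = perturbed_inverse_in_cone[OF c w(1-3), folded b]
  have nz: "b - of_real t \<noteq> 0" using diff_of_real_nonzero[OF cone_Im_nonzero[OF c p(2,3)]] .
  have "0 < c * norm b" using c p(2) by simp
  then have "1 / norm (b - of_real t) \<le> 1 / (c * norm b)"
    using diff_of_real_bounds_in_cone(2)[OF p(3,2), of t] by (intro frac_le) auto
  also have "\<dots> = (1 / norm b) / c" by simp
  also have "\<dots> \<le> 2 * norm w / c" using p(4) c by (intro divide_right_mono) auto
  finally have "1 / norm (b - of_real t) \<le> 2 * norm w / c" .
  then have "(1 / norm w) * (1 / norm (b - of_real t)) \<le> (1 / norm w) * (2 * norm w / c)"
    by (intro mult_left_mono) auto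
  then show B: "norm (1 / (w * (b - of_real t))) \<le> 2 / c"
    using w(1) by (simp add: norm_divide norm_mult)
  have "1 / (w * (b - of_real t)) - 1 = of_real t / (b - of_real t) - u * (1 / (w * (b - of_real t)))"
    using nz w(1,4) by (simp add: divide_simps) (simp add: algebra_simps)
  also have "norm \<dots> \<le> norm (of_real t / (b - of_real t)) + norm u * norm (1 / (w * (b - of_real t)))"
    using norm_triangle_ineq4 by (metis norm_mult)
  also have "\<dots> \<le> (1 / c) * min 1 (1 / norm b * \<bar>t\<bar>) + norm u * (2 / c)"
    by (intro add_mono kernel_ratio_le c p mult_left_mono B) auto
  also have "\<dots> \<le> (1 / c) * min 1 (2 * norm w * \<bar>t\<bar>) + norm u * (2 / c)"
    using p(4) c by (intro add_mono mult_left_mono min.mono mult_right_mono) auto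
  finally show "norm (1 / (w * (b - of_real t)) - 1) \<le> (1 / c) * min 1 (2 * norm w * \<bar>t\<bar>) + 2 / c * norm u"
    by (simp add: mult.commute)
qed

text \<open>The asymmetry is deliberate: closeness to 0 enters only through w, while for z a bound
  \<open>K\<close> on the rescaled kernel suffices. So the same estimate serves for w tending to 0
  with z fixed anywhere in the domain, and for small z and w with \<open>K\<close> = 2/c.\<close>

lemma bifree_h_minus_1_le:
  assumes M: "borel_prob_measure M" and c: "0 < c"
    and a: "Im a \<noteq> 0" "cauchy_transform (marginal1 M) a = z" "z \<noteq> 0"
    and K: "\<And>s. norm (1 / (z * (a - of_real s))) \<le> K"
    and w: "w \<noteq> 0" "2 * c * norm w \<le> \<bar>Im w\<bar>" "norm u \<le> c / 2" "w * b = 1 + u"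
  shows "norm (cauchy_transform2 M a b / (z * w) - 1) \<le>
    K * ((1 / c) * truncated_moment (marginal2 M) (2 * norm w) + 2 / c * norm u)"
proof -
  note M2 = borel_prob_marginal(2)[OF M]
  interpret m2: prob_space "marginal2 M" by (rule borel_prob_measureD[OF M2])
  have b: "b = (1 + u) / w" using w(1,4) by (simp add: field_simps)
  have imb: "Im b \<noteq> 0"
    using cone_Im_nonzero[OF c] perturbed_inverse_in_cone(2,3)[OF c w(1-3)] unfolding b by blast
  have int: "integrable (marginal2 M) (\<lambda>t. (1 / c) * min 1 (2 * norm w * \<bar>t\<bar>))"
    by (intro integrable_mult_right integrable_truncated M2) auto
  have "norm (cauchy_transform2 M a b / (z * w) - 1) \<le>
     K * (LINT t|marginal2 M. (1 / c) * min 1 (2 * norm w * \<bar>t\<bar>) + 2 / c * norm u)"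
    using int by (intro bifree_ratio_minus_1_le M a imb w K rescaled_kernel_bounds c) auto
  also have "(LINT t|marginal2 M. (1 / c) * min 1 (2 * norm w * \<bar>t\<bar>) + 2 / c * norm u) =
     (1 / c) * truncated_moment (marginal2 M) (2 * norm w) + 2 / c * norm u"
    unfolding truncated_moment_def using int m2.prob_space by (subst Bochner_Integration.integral_add) auto
  finally show ?thesis .
qed

lemma truncated_moment_tendsto_at_0:
  assumes "borel_prob_measure m"
  shows "((\<lambda>w::complex. truncated_moment m (2 * norm w)) \<longlongrightarrow> 0) (at 0 within D)"
proof (rule tendstoI)
  fix e :: real assume "0 < e"
  then obtain \<rho> where \<rho>: "0 < \<rho>" "\<And>r. 0 \<le> r \<Longrightarrow> r \<le> \<rho> \<Longrightarrow> truncated_moment m r < e"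
    using truncated_moment_small[OF assms] by metis
  have "dist (truncated_moment m (2 * norm w)) 0 < e" if "norm w < \<rho> / 2" for w :: complex
    using \<rho>(2)[of "2 * norm w"] truncated_moment_nonneg[of "2 * norm w" m] that by simp
  then show "\<forall>\<^sub>F w::complex in at 0 within D. dist (truncated_moment m (2 * norm w)) 0 < e"
    unfolding eventually_at using \<rho>(1) by (intro exI[of _ "\<rho> / 2"]) auto
qed

lemma bifree_R_tendsto_marginal:
  assumes M: "borel_prob_measure M" and pos: "0 < \<alpha>" "0 < \<beta>"
    and def: "bifree_R_defined \<alpha> \<beta> M" and z: "z \<in> double_stolz \<alpha> \<beta>"
  shows "(bifree_R M z \<longlongrightarrow> z * R_transform (marginal1 M) z) (at 0 within double_stolz \<alpha> \<beta>)"
proof -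
  let ?D = "double_stolz \<alpha> \<beta>"
  define c where "c = stolz_const \<alpha>"
  have c: "0 < c" using stolz_const_bounds[OF pos(1)] by (simp add: c_def)
  define u where "u w = w * R_transform (marginal2 M) w" for w
  have def1: "R_transform_defined \<alpha> \<beta> (marginal1 M)" and def2: "R_transform_defined \<alpha> \<beta> (marginal2 M)"
    using def by (auto simp: bifree_R_defined_def)
  note M1 = borel_prob_marginal(1)[OF M] and M2 = borel_prob_marginal(2)[OF M]
  note F1 = R_inverse_props[OF M1 pos def1 z]
  have z0: "z \<noteq> 0" using z by (auto simp: mem_double_stolz)
  \<comment> \<open>As z stays fixed, the crude bound by the distance to the real line is enough,
    although it deteriorates with z.\<close>
  define K where "K = 1 / norm z * (1 / \<bar>Im (R_inverse (marginal1 M) z)\<bar>)"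
  have K: "norm (1 / (z * (R_inverse (marginal1 M) z - of_real s))) \<le> K" for s
  proof -
    have "norm (1 / (z * (R_inverse (marginal1 M) z - of_real s))) =
       1 / norm z * norm (1 / (R_inverse (marginal1 M) z - of_real s))"
      by (simp add: norm_divide norm_mult)
    also have "\<dots> \<le> K" unfolding K_def by (intro mult_left_mono norm_cauchy_kernel_le F1) auto
    finally show ?thesis .
  qed
  have ulim: "(u \<longlongrightarrow> 0) (at 0 within ?D)"
    using is_R_transform_on_R_transform[OF M2 pos def2] by (simp add: is_R_transform_on_def u_def[abs_def])
  have "((\<lambda>w. bifree_h M z w - 1) \<longlongrightarrow> 0) (at 0 within ?D)"
  proof (rule Lim_null_comparison)
    have "\<forall>\<^sub>F w in at 0 within ?D. w \<in> ?D" by (auto simp: eventually_at_filter)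
    moreover have "\<forall>\<^sub>F w in at 0 within ?D. dist (u w) 0 < c / 2"
      using ulim c by (intro tendstoD) auto
    ultimately show "\<forall>\<^sub>F w in at 0 within ?D. norm (bifree_h M z w - 1) \<le>
        K * ((1 / c) * truncated_moment (marginal2 M) (2 * norm w) + 2 / c * norm (u w))"
    proof eventually_elim
      case (elim w)
      have "w * R_inverse (marginal2 M) w = 1 + u w"
        using R_inverse_props(4)[OF M2 pos def2 elim(1)] by (simp add: u_def)
      then show ?case
        unfolding bifree_h_eq using double_stolz_in_cone[OF pos(1) elim(1)] elim(2)
        by (intro bifree_h_minus_1_le M c F1 z0 K) (auto simp: c_def)
    qed
    have "((\<lambda>w. K * ((1 / c) * truncated_moment (marginal2 M) (2 * norm w) + 2 / c * norm (u w)))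
        \<longlongrightarrow> K * ((1 / c) * 0 + 2 / c * norm (0::complex))) (at 0 within ?D)"
      by (intro tendsto_intros truncated_moment_tendsto_at_0 M2 ulim)
    then show "((\<lambda>w. K * ((1 / c) * truncated_moment (marginal2 M) (2 * norm w) + 2 / c * norm (u w)))
        \<longlongrightarrow> 0) (at 0 within ?D)" by simp
  qed
  then have "((\<lambda>w. bifree_h M z w) \<longlongrightarrow> 1) (at 0 within ?D)"
    using LIM_zero_iff by blast
  then have "((\<lambda>w. z * R_transform (marginal1 M) z + u w + (1 - 1 / bifree_h M z w))
      \<longlongrightarrow> z * R_transform (marginal1 M) z + 0 + (1 - 1 / 1)) (at 0 within ?D)"
    by (intro tendsto_intros ulim) auto
  then show ?thesis by (simp add: bifree_R_def[abs_def] u_def)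
qed

text \<open>Write T1, T2 for the truncated moments of the marginals at 2|z|, 2|w|. With
  \<open>K\<close> = 2/c and |u| \<le> T2/c one gets |h - 1| \<le> (2/c^2 + 4/c^3) T2 \<le> 6
  T2/c^3. The threshold c^3/12 turns this into 1/2, so |h| \<ge> 1/2 and |1 - 1/h| \<le> 12 T2/c^3.
  The terms z R(z) and w R(w), of size T1/c and T2/c, raise 12 to 13.\<close>

lemma bifree_R_small_moments:
  assumes M: "borel_prob_measure M" and pos: "0 < \<alpha>" "0 < \<beta>"
    and s1: "truncated_moment (marginal1 M) (2 * ((1 + \<alpha>) * \<beta>)) \<le> stolz_const \<alpha> ^ 3 / 12"
    and s2: "truncated_moment (marginal2 M) (2 * ((1 + \<alpha>) * \<beta>)) \<le> stolz_const \<alpha> ^ 3 / 12"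
  shows "bifree_R_defined \<alpha> \<beta> M"
    and "z \<in> double_stolz \<alpha> \<beta> \<Longrightarrow> w \<in> double_stolz \<alpha> \<beta> \<Longrightarrow> norm (bifree_R M z w) \<le> 13 / stolz_const \<alpha> ^ 3 *
      (truncated_moment (marginal1 M) (2 * norm z) + truncated_moment (marginal2 M) (2 * norm w))"
proof -
  let ?D = "double_stolz \<alpha> \<beta>"
  define c where "c = stolz_const \<alpha>"
  have c: "0 < c" "c < 1 / 2" using stolz_const_bounds[OF pos(1)] by (auto simp: c_def)
  note M1 = borel_prob_marginal(1)[OF M] and M2 = borel_prob_marginal(2)[OF M]
  have c3: "c ^ 3 / 12 \<le> c\<^sup>2 / 4"
    using c by (simp add: power3_eq_cube power2_eq_square mult_le_cancel_right)
  note R1 = R_transform_small_moment[OF M1 pos order.trans[OF s1 c3[unfolded c_def]], folded c_def]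
  note R2 = R_transform_small_moment[OF M2 pos order.trans[OF s2 c3[unfolded c_def]], folded c_def]
  let ?T1 = "\<lambda>z::complex. truncated_moment (marginal1 M) (2 * norm z)"
  let ?T2 = "\<lambda>z::complex. truncated_moment (marginal2 M) (2 * norm z)"
  have inv: "1 / c \<le> 1 / c ^ 3"
    using c power_le_one[of c 2] by (auto simp: divide_simps power3_eq_cube power2_eq_square)
  have h: "norm (bifree_h M z w - 1) \<le> 6 / c ^ 3 * ?T2 w" "?T2 w \<le> c ^ 3 / 12"
    if z: "z \<in> ?D" and w: "w \<in> ?D" for z w
  proof -
    note F1 = R_inverse_props[OF M1 pos R1(1) z]
    note Dz = double_stolz_in_cone[OF pos(1) z, folded c_def]
    note Dw = double_stolz_in_cone[OF pos(1) w, folded c_def]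
    have "norm (bifree_h M z w - 1) \<le>
        2 / c * ((1 / c) * ?T2 w + 2 / c * norm (w * R_transform (marginal2 M) w))"
      unfolding bifree_h_eq
      by (intro bifree_h_minus_1_le M c F1 Dz(1) Dw R2(2) w R_inverse_props(4)[OF M2 pos R2(1) w]
          rescaled_kernel_bounds(1)[OF c(1) Dz(1,2) R1(2)[OF z] F1(4)])
    also have "\<dots> \<le> 2 / c * ((1 / c) * ?T2 w + 2 / c * ((1 / c) * ?T2 w))"
      using c R2(4)[OF w] by (intro mult_left_mono add_mono) auto
    also have "\<dots> \<le> 6 / c ^ 3 * ?T2 w"
    proof -
      have "c * ?T2 w \<le> 1 * ?T2 w" using c by (intro mult_right_mono truncated_moment_nonneg) auto
      then show ?thesis using c by (simp add: field_simps power3_eq_cube)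
    qed
    finally show "norm (bifree_h M z w - 1) \<le> 6 / c ^ 3 * ?T2 w" .
    have "?T2 w \<le> truncated_moment (marginal2 M) (2 * ((1 + \<alpha>) * \<beta>))"
      using Dw(3) by (intro truncated_moment_mono M2) auto
    then show "?T2 w \<le> c ^ 3 / 12" using s2 by (simp add: c_def)
  qed
  have h2: "norm (bifree_h M z w - 1) \<le> 1 / 2" if "z \<in> ?D" "w \<in> ?D" for z w
  proof -
    have "norm (bifree_h M z w - 1) \<le> 6 / c ^ 3 * (c ^ 3 / 12)"
      using c h[OF that] by (intro order.trans[OF h(1)[OF that] mult_left_mono]) auto
    then show ?thesis using c by simp
  qed
  have hn: "1 / 2 \<le> norm (bifree_h M z w)" if "z \<in> ?D" "w \<in> ?D" for z w
    using h2[OF that] norm_triangle_ineq2[of 1 "1 - bifree_h M z w"] by (simp add: norm_minus_commute)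
  then have nz: "bifree_h M z w \<noteq> 0" if "z \<in> ?D" "w \<in> ?D" for z w
    using that by fastforce
  then show "bifree_R_defined \<alpha> \<beta> M"
    using R1(1) R2(1) by (auto simp: bifree_R_defined_def)
  assume z: "z \<in> ?D" and w: "w \<in> ?D"
  have "1 - 1 / bifree_h M z w = (bifree_h M z w - 1) * (1 / bifree_h M z w)"
    using nz[OF z w] by (simp add: field_simps)
  also have "norm \<dots> \<le> (6 / c ^ 3 * ?T2 w) * 2"
    unfolding norm_mult using hn[OF z w] h(1)[OF z w]
    using c truncated_moment_nonneg[of "2 * norm w" "marginal2 M"]
    by (intro mult_mono) (auto simp: norm_divide divide_simps)
  finally have "norm (bifree_R M z w) \<le> (1 / c) * ?T1 z + (1 / c) * ?T2 w + 12 / c ^ 3 * ?T2 w"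
    unfolding bifree_R_def using R1(4)[OF z] R2(4)[OF w]
    by (intro norm_triangle_le add_mono) auto
  also have "\<dots> \<le> (1 / c ^ 3) * ?T1 z + (1 / c ^ 3) * ?T2 w + 12 / c ^ 3 * ?T2 w"
    using inv by (intro add_mono mult_right_mono truncated_moment_nonneg) auto
  also have "\<dots> \<le> 13 / c ^ 3 * (?T1 z + ?T2 w)"
  proof -
    have "0 \<le> 12 / c ^ 3 * ?T1 z" using c by (intro mult_nonneg_nonneg truncated_moment_nonneg) auto
    then show ?thesis by (simp add: algebra_simps add_divide_distrib)
  qed
  finally show "norm (bifree_R M z w) \<le> 13 / stolz_const \<alpha> ^ 3 * (?T1 z + ?T2 w)"
    by (simp add: c_def)
qed

subsection \<open>Weak convergence of measures and convergence of transforms\<close>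

lemma integrable_bounded_continuous:
  fixes f :: "'a::topological_space \<Rightarrow> 'b::{banach, second_countable_topology}"
  assumes "borel_prob_measure M" "continuous_on UNIV f" "bounded (range f)"
  shows "integrable M f"
proof -
  interpret prob_space M by (rule borel_prob_measureD[OF assms(1)])
  obtain B where "\<And>x. norm (f x) \<le> B" using assms(3) by (auto simp: bounded_iff)
  moreover have "f \<in> borel_measurable M"
    using borel_measurable_continuous_onI[OF assms(2)] borel_prob_measureD(2)[OF assms(1)]
      measurable_cong_sets by blast
  ultimately show ?thesis by (intro integrable_const_bound[where B = B]) auto
qed

lemma weakly_converges_complex:
  fixes f :: "'a::topological_space \<Rightarrow> complex"
  assumes "\<And>n. borel_prob_measure (M n)" "borel_prob_measure N" "weakly_converges M N"
    and f: "continuous_on UNIV f" "bounded (range f)"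
  shows "(\<lambda>n. integral\<^sup>L (M n) f) \<longlonglongrightarrow> integral\<^sup>L N f"
proof -
  note int = integrable_bounded_continuous[OF _ f]
  obtain B where B: "\<And>x. norm (f x) \<le> B" using f(2) by (auto simp: bounded_iff)
  have "bounded (range (\<lambda>x. Re (f x)))" "bounded (range (\<lambda>x. Im (f x)))"
    using order.trans[OF abs_Re_le_cmod B] order.trans[OF abs_Im_le_cmod B]
    by (auto simp: bounded_iff intro!: exI[of _ B])
  moreover have "continuous_on UNIV (\<lambda>x. Re (f x))" "continuous_on UNIV (\<lambda>x. Im (f x))"
    using f(1) by (auto intro: continuous_intros)
  ultimately have "(\<lambda>n. LINT x|M n. Re (f x)) \<longlonglongrightarrow> (LINT x|N. Re (f x))"
    "(\<lambda>n. LINT x|M n. Im (f x)) \<longlonglongrightarrow> (LINT x|N. Im (f x))"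
    using assms(3) unfolding weakly_converges_def by auto
  then show ?thesis
    using int assms(1,2) by (simp add: tendsto_complex_iff integral_Re integral_Im)
qed

lemma weakly_converges_marginal:
  assumes M: "\<And>n. borel_prob_measure (M n)" and N: "borel_prob_measure N" and "weakly_converges M N"
  shows "weakly_converges (\<lambda>n. marginal1 (M n)) (marginal1 N)"
    "weakly_converges (\<lambda>n. marginal2 (M n)) (marginal2 N)"
proof -
  have "(\<lambda>n. LINT p|M n. f (fst p)) \<longlonglongrightarrow> (LINT p|N. f (fst p))"
    "(\<lambda>n. LINT p|M n. f (snd p)) \<longlonglongrightarrow> (LINT p|N. f (snd p))"
    if f: "continuous_on UNIV f" "bounded (range f)" for f :: "real \<Rightarrow> real"
  proof -
    have "continuous_on UNIV (\<lambda>p :: real \<times> real. f (fst p))" "continuous_on UNIV (\<lambda>p :: real \<times> real. f (snd p))"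
      by (rule continuous_on_compose2[OF f(1)]; intro continuous_intros subset_UNIV)+
    moreover have "bounded (range (\<lambda>p :: real \<times> real. f (fst p)))" "bounded (range (\<lambda>p :: real \<times> real. f (snd p)))"
      using f(2) by (auto simp: bounded_iff)
    ultimately show "(\<lambda>n. LINT p|M n. f (fst p)) \<longlonglongrightarrow> (LINT p|N. f (fst p))"
      "(\<lambda>n. LINT p|M n. f (snd p)) \<longlonglongrightarrow> (LINT p|N. f (snd p))"
      using assms(3) unfolding weakly_converges_def by auto
  qed
  then show "weakly_converges (\<lambda>n. marginal1 (M n)) (marginal1 N)"
    "weakly_converges (\<lambda>n. marginal2 (M n)) (marginal2 N)"
    unfolding weakly_converges_def
    by (auto simp: integral_marginal(1,2)[OF M borel_measurable_continuous_onI]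
        integral_marginal(1,2)[OF N borel_measurable_continuous_onI])
qed

text \<open>Weak convergence is applied at a single radius and gives the bound for large n only.
  Monotonicity extends it to smaller radii, and the finitely many remaining measures are handled by
  taking a minimum, so that the result holds for all n.\<close>

lemma truncated_moment_uniformly_small:
  assumes m: "\<And>n. borel_prob_measure (m n)" and \<nu>: "borel_prob_measure \<nu>" and "weakly_converges m \<nu>"
    and "0 < e"
  obtains \<rho> where "0 < \<rho>" "\<And>r n. 0 \<le> r \<Longrightarrow> r \<le> \<rho> \<Longrightarrow> truncated_moment (m n) r < e"
proof -
  obtain \<rho>0 where \<rho>0: "0 < \<rho>0" "\<And>r. 0 \<le> r \<Longrightarrow> r \<le> \<rho>0 \<Longrightarrow> truncated_moment \<nu> r < e"
    using truncated_moment_small[OF \<nu> assms(4)] by metis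
  have "bounded (range (\<lambda>x. min 1 (\<rho>0 * \<bar>x\<bar>)))"
    using \<rho>0(1) unfolding bounded_iff by (intro exI[of _ 1]) auto
  moreover have "continuous_on UNIV (\<lambda>x. min 1 (\<rho>0 * \<bar>x\<bar>))"
    by (intro continuous_intros)
  ultimately have "(\<lambda>n. truncated_moment (m n) \<rho>0) \<longlonglongrightarrow> truncated_moment \<nu> \<rho>0"
    using assms(3) unfolding weakly_converges_def truncated_moment_def by blast
  then have "\<forall>\<^sub>F n in sequentially. truncated_moment (m n) \<rho>0 < e"
    using \<rho>0 by (intro order_tendstoD(2)) auto
  then obtain N where N: "\<And>n. N \<le> n \<Longrightarrow> truncated_moment (m n) \<rho>0 < e"
    by (auto simp: eventually_sequentially)
  have "\<exists>\<rho>>0. \<forall>r. 0 \<le> r \<and> r \<le> \<rho> \<longrightarrow> truncated_moment (m n) r < e" for n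
    using truncated_moment_small[OF m[of n] assms(4)] by metis
  then obtain \<rho>' where \<rho>': "\<And>n. 0 < \<rho>' n" "\<And>n r. 0 \<le> r \<Longrightarrow> r \<le> \<rho>' n \<Longrightarrow> truncated_moment (m n) r < e"
    by metis
  define \<rho> where "\<rho> = Min (insert \<rho>0 (\<rho>' ` {..<N}))"
  have "0 < \<rho>" using \<rho>0 \<rho>' by (auto simp: \<rho>_def)
  moreover have "truncated_moment (m n) r < e" if "0 \<le> r" "r \<le> \<rho>" for r n
  proof (cases "n < N")
    case True
    then have "\<rho> \<le> \<rho>' n" by (auto simp: \<rho>_def)
    then show ?thesis using \<rho>'(2) that by auto
  next
    case False
    have "\<rho> \<le> \<rho>0" by (auto simp: \<rho>_def)
    then show ?thesis
      using N[of n] False that truncated_moment_mono[OF m[of n] that(1), of \<rho>0] by auto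
  qed
  ultimately show thesis by (rule that)
qed

lemma continuous_cauchy_kernel:
  assumes "Im \<zeta> \<noteq> 0"
  shows "continuous_on UNIV (\<lambda>x. 1 / (\<zeta> - of_real x))"
    "bounded (range (\<lambda>x. 1 / (\<zeta> - of_real x)))"
  using diff_of_real_nonzero[OF assms] norm_cauchy_kernel_le[OF assms]
  by (auto intro!: continuous_intros simp: bounded_iff)

text \<open>The evaluation point moves with n, since in the applications it is 1/z + R(z) for the
  n-th measure. The kernel is Lipschitz in \<zeta> uniformly over real x, hence the displacement is
  negligible whatever the measures are.\<close>

lemma cauchy_transform_tendsto:
  assumes m: "\<And>n. borel_prob_measure (m n)" and \<nu>: "borel_prob_measure \<nu>" and w: "weakly_converges m \<nu>"
    and \<zeta>: "a \<longlonglongrightarrow> \<zeta>" "Im \<zeta> \<noteq> 0"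
  shows "(\<lambda>n. cauchy_transform (m n) (a n)) \<longlonglongrightarrow> cauchy_transform \<nu> \<zeta>"
proof -
  have lim: "(\<lambda>n. cauchy_transform (m n) \<zeta>) \<longlonglongrightarrow> cauchy_transform \<nu> \<zeta>"
    unfolding cauchy_transform_def
    by (intro weakly_converges_complex m \<nu> w continuous_cauchy_kernel \<zeta>)
  have ev: "\<forall>\<^sub>F n in sequentially. Im (a n) \<noteq> 0"
    by (rule tendsto_imp_eventually_ne[OF tendsto_Im[OF \<zeta>(1)] \<zeta>(2)])
  have "(\<lambda>n. cauchy_transform (m n) (a n) - cauchy_transform (m n) \<zeta>) \<longlonglongrightarrow> 0"
  proof (rule Lim_null_comparison)
    show "\<forall>\<^sub>F n in sequentially. norm (cauchy_transform (m n) (a n) - cauchy_transform (m n) \<zeta>)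
        \<le> norm (a n - \<zeta>) / (\<bar>Im (a n)\<bar> * \<bar>Im \<zeta>\<bar>)"
      using ev
    proof eventually_elim
      case (elim n)
      interpret prob_space "m n" by (rule borel_prob_measureD[OF m])
      have "cauchy_transform (m n) (a n) - cauchy_transform (m n) \<zeta> =
         (LINT x|m n. 1 / (a n - of_real x) - 1 / (\<zeta> - of_real x))"
        unfolding cauchy_transform_def
        by (intro Bochner_Integration.integral_diff[symmetric] integrable_cauchy_kernel1 m elim \<zeta>)
      also have "norm \<dots> \<le> (LINT x|m n. norm (a n - \<zeta>) / (\<bar>Im (a n)\<bar> * \<bar>Im \<zeta>\<bar>))"
        by (intro norm_integral_le_integral Bochner_Integration.integrable_diff integrable_cauchy_kernel1
            m elim \<zeta> cauchy_kernel_lipschitz) auto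
      finally show ?case using prob_space by simp
    qed
    have "(\<lambda>n. norm (a n - \<zeta>) / (\<bar>Im (a n)\<bar> * \<bar>Im \<zeta>\<bar>)) \<longlonglongrightarrow> norm (\<zeta> - \<zeta>) / (\<bar>Im \<zeta>\<bar> * \<bar>Im \<zeta>\<bar>)"
      using \<zeta> by (intro tendsto_intros) auto
    then show "(\<lambda>n. norm (a n - \<zeta>) / (\<bar>Im (a n)\<bar> * \<bar>Im \<zeta>\<bar>)) \<longlonglongrightarrow> 0" by simp
  qed
  from tendsto_add[OF this lim] show ?thesis by simp
qed

lemma cauchy_transform2_tendsto:
  assumes M: "\<And>n. borel_prob_measure (M n)" and \<nu>: "borel_prob_measure \<nu>" and w: "weakly_converges M \<nu>"
    and \<zeta>: "a \<longlonglongrightarrow> \<zeta>" "Im \<zeta> \<noteq> 0" and \<eta>: "b \<longlonglongrightarrow> \<eta>" "Im \<eta> \<noteq> 0"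
  shows "(\<lambda>n. cauchy_transform2 (M n) (a n) (b n)) \<longlonglongrightarrow> cauchy_transform2 \<nu> \<zeta> \<eta>"
proof -
  let ?k = "\<lambda>a b p :: real \<times> real. 1 / ((a - complex_of_real (fst p)) * (b - complex_of_real (snd p)))"
  have prod: "?k a b p = 1 / (a - of_real (fst p)) * (1 / (b - of_real (snd p)))" for a b p by simp
  have "continuous_on UNIV (?k \<zeta> \<eta>)"
    using diff_of_real_nonzero[OF \<zeta>(2)] diff_of_real_nonzero[OF \<eta>(2)] by (auto intro!: continuous_intros)
  moreover have "norm (?k \<zeta> \<eta> p) \<le> 1 / \<bar>Im \<zeta>\<bar> * (1 / \<bar>Im \<eta>\<bar>)" for p
    unfolding prod norm_mult by (intro mult_mono norm_cauchy_kernel_le \<zeta> \<eta>) auto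
  then have "bounded (range (?k \<zeta> \<eta>))" unfolding bounded_iff by blast
  ultimately have lim: "(\<lambda>n. cauchy_transform2 (M n) \<zeta> \<eta>) \<longlonglongrightarrow> cauchy_transform2 \<nu> \<zeta> \<eta>"
    unfolding cauchy_transform2_def by (intro weakly_converges_complex M \<nu> w)
  have ev: "\<forall>\<^sub>F n in sequentially. Im (a n) \<noteq> 0" "\<forall>\<^sub>F n in sequentially. Im (b n) \<noteq> 0"
    by (rule tendsto_imp_eventually_ne[OF tendsto_Im[OF \<zeta>(1)] \<zeta>(2)]
        tendsto_imp_eventually_ne[OF tendsto_Im[OF \<eta>(1)] \<eta>(2)])+
  define L where "L n = norm (a n - \<zeta>) / (\<bar>Im (a n)\<bar> * \<bar>Im \<zeta>\<bar>) * (1 / \<bar>Im (b n)\<bar>) +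
      1 / \<bar>Im \<zeta>\<bar> * (norm (b n - \<eta>) / (\<bar>Im (b n)\<bar> * \<bar>Im \<eta>\<bar>))" for n
  have "(\<lambda>n. cauchy_transform2 (M n) (a n) (b n) - cauchy_transform2 (M n) \<zeta> \<eta>) \<longlonglongrightarrow> 0"
  proof (rule Lim_null_comparison)
    show "\<forall>\<^sub>F n in sequentially. norm (cauchy_transform2 (M n) (a n) (b n) - cauchy_transform2 (M n) \<zeta> \<eta>) \<le> L n"
      using ev
    proof eventually_elim
      case (elim n)
      interpret prob_space "M n" by (rule borel_prob_measureD[OF M])
      have telescope: "A * B - C * D = (A - C) * B + C * (B - D)" for A B C D :: complex
        by (simp add: algebra_simps)
      have bd: "norm (?k (a n) (b n) p - ?k \<zeta> \<eta> p) \<le> L n" for p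
      proof -
        have "?k (a n) (b n) p - ?k \<zeta> \<eta> p =
          (1 / (a n - of_real (fst p)) - 1 / (\<zeta> - of_real (fst p))) * (1 / (b n - of_real (snd p))) +
          1 / (\<zeta> - of_real (fst p)) * (1 / (b n - of_real (snd p)) - 1 / (\<eta> - of_real (snd p)))"
          unfolding prod by (rule telescope)
        also have "norm \<dots> \<le>
            norm (1 / (a n - of_real (fst p)) - 1 / (\<zeta> - of_real (fst p))) * norm (1 / (b n - of_real (snd p))) +
            norm (1 / (\<zeta> - of_real (fst p))) * norm (1 / (b n - of_real (snd p)) - 1 / (\<eta> - of_real (snd p)))"
          unfolding norm_mult[symmetric] by (rule norm_triangle_ineq)
        also have "\<dots> \<le> L n"
          unfolding L_def
          by (intro add_mono mult_mono cauchy_kernel_lipschitz norm_cauchy_kernel_le elim \<zeta> \<eta>) auto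
        finally show ?thesis .
      qed
      have "cauchy_transform2 (M n) (a n) (b n) - cauchy_transform2 (M n) \<zeta> \<eta> =
         (LINT p|M n. ?k (a n) (b n) p - ?k \<zeta> \<eta> p)"
        unfolding cauchy_transform2_def
        by (intro Bochner_Integration.integral_diff[symmetric] integrable_cauchy_kernel2 M elim \<zeta> \<eta>)
      also have "norm \<dots> \<le> (LINT p|M n. L n)"
        by (intro norm_integral_le_integral Bochner_Integration.integrable_diff integrable_cauchy_kernel2
            M elim \<zeta> \<eta> bd) auto
      finally show ?case using prob_space by simp
    qed
    have "L \<longlonglongrightarrow> norm (\<zeta> - \<zeta>) / (\<bar>Im \<zeta>\<bar> * \<bar>Im \<zeta>\<bar>) * (1 / \<bar>Im \<eta>\<bar>) +
      1 / \<bar>Im \<zeta>\<bar> * (norm (\<eta> - \<eta>) / (\<bar>Im \<eta>\<bar> * \<bar>Im \<eta>\<bar>))"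
      unfolding L_def[abs_def] using \<zeta> \<eta> by (intro tendsto_intros) auto
    then show "L \<longlonglongrightarrow> 0" by simp
  qed
  from tendsto_add[OF this lim] show ?thesis by simp
qed

text \<open>This is stability of fixed points. Comparing the n-th fixed point u with the limiting
  one v under the n-th map, which contracts by 1/2, gives |u - v| \<le> 2 |e_n(\<zeta>) - v| with
  \<zeta> = (1 + v)/z independent of n. Only convergence of the Cauchy transforms at this one point
  is then required.\<close>

lemma R_transform_tendsto:
  assumes m: "\<And>n. borel_prob_measure (m n)" and \<nu>: "borel_prob_measure \<nu>" and w: "weakly_converges m \<nu>"
    and pos: "0 < \<alpha>" "0 < \<beta>"
    and small: "\<And>n. truncated_moment (m n) (2 * ((1 + \<alpha>) * \<beta>)) \<le> (stolz_const \<alpha>)\<^sup>2 / 4"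
      "truncated_moment \<nu> (2 * ((1 + \<alpha>) * \<beta>)) \<le> (stolz_const \<alpha>)\<^sup>2 / 4"
    and z: "z \<in> double_stolz \<alpha> \<beta>"
  shows "(\<lambda>n. R_transform (m n) z) \<longlonglongrightarrow> R_transform \<nu> z"
proof -
  define c where "c = stolz_const \<alpha>"
  have c: "0 < c" using stolz_const_bounds[OF pos(1)] by (simp add: c_def)
  note D = double_stolz_in_cone[OF pos(1) z, folded c_def]
  note Rn = R_transform_small_moment(2,3)[OF m pos small(1) z, folded c_def]
  note R = R_transform_small_moment(2,3)[OF \<nu> pos small(2) z, folded c_def]
  define u where "u n = z * R_transform (m n) z" for n
  define v where "v = z * R_transform \<nu> z"
  define \<zeta> where "\<zeta> = (1 + v) / z"
  have im: "Im \<zeta> \<noteq> 0"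
    using cone_Im_nonzero[OF c] perturbed_inverse_in_cone(2,3)[OF c D(1,2) R(1)]
    unfolding \<zeta>_def v_def by blast
  have bound: "norm (u n - v) \<le> 2 * norm (cauchy_remainder (m n) \<zeta> - cauchy_remainder \<nu> \<zeta>)" for n
  proof -
    have tm: "truncated_moment (m n) (2 * norm z) \<le> c\<^sup>2 / 4"
      using small(1)[of n] truncated_moment_mono[OF m, of "2 * norm z" "2 * ((1 + \<alpha>) * \<beta>)" n] D(3)
      by (simp add: c_def)
    have "norm (cauchy_remainder (m n) ((1 + u n) / z) - cauchy_remainder (m n) ((1 + v) / z)) \<le> norm (u n - v) / 2"
      unfolding u_def v_def by (rule fixed_point_map_contraction[OF m c D(1,2) Rn(1) R(1) tm])
    then have "norm (u n - cauchy_remainder (m n) \<zeta>) \<le> norm (u n - v) / 2"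
      using Rn(2)[of n] by (simp add: u_def \<zeta>_def)
    moreover have "cauchy_remainder \<nu> \<zeta> = v" using R(2) by (simp add: v_def \<zeta>_def)
    moreover have "norm (u n - v) \<le> norm (u n - cauchy_remainder (m n) \<zeta>) + norm (cauchy_remainder (m n) \<zeta> - v)"
      using norm_triangle_ineq[of "u n - cauchy_remainder (m n) \<zeta>" "cauchy_remainder (m n) \<zeta> - v"] by simp
    ultimately show ?thesis by simp
  qed
  have lim: "(\<lambda>n. 2 * norm (cauchy_remainder (m n) \<zeta> - cauchy_remainder \<nu> \<zeta>)) \<longlonglongrightarrow>
      2 * norm (cauchy_remainder \<nu> \<zeta> - cauchy_remainder \<nu> \<zeta>)"
    unfolding cauchy_remainder_def
    by (intro tendsto_intros cauchy_transform_tendsto m \<nu> w im)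
  have "(\<lambda>n. u n - v) \<longlonglongrightarrow> 0"
    by (rule Lim_null_comparison[OF always_eventually[OF allI[OF bound]]]) (use lim in simp)
  then have "u \<longlonglongrightarrow> v" using LIM_zero_iff by blast
  then have "(\<lambda>n. (1 / z) * u n) \<longlonglongrightarrow> (1 / z) * v" by (intro tendsto_intros)
  then show ?thesis using D(1) by (simp add: u_def[abs_def] v_def)
qed

lemma bifree_R_tendsto:
  assumes M: "\<And>n. borel_prob_measure (M n)" and \<nu>: "borel_prob_measure \<nu>" and wc: "weakly_converges M \<nu>"
    and R1: "(\<lambda>n. R_transform (marginal1 (M n)) z) \<longlonglongrightarrow> R_transform (marginal1 \<nu>) z"
    and R2: "(\<lambda>n. R_transform (marginal2 (M n)) w) \<longlonglongrightarrow> R_transform (marginal2 \<nu>) w"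
    and im: "Im (R_inverse (marginal1 \<nu>) z) \<noteq> 0" "Im (R_inverse (marginal2 \<nu>) w) \<noteq> 0"
    and nz: "z \<noteq> 0" "w \<noteq> 0"
  shows "(\<lambda>n. bifree_h (M n) z w) \<longlonglongrightarrow> bifree_h \<nu> z w"
    and "bifree_h \<nu> z w \<noteq> 0 \<Longrightarrow> (\<lambda>n. bifree_R (M n) z w) \<longlonglongrightarrow> bifree_R \<nu> z w"
proof -
  have F: "(\<lambda>n. R_inverse (marginal1 (M n)) z) \<longlonglongrightarrow> R_inverse (marginal1 \<nu>) z"
    "(\<lambda>n. R_inverse (marginal2 (M n)) w) \<longlonglongrightarrow> R_inverse (marginal2 \<nu>) w"
    unfolding R_inverse_def by (intro tendsto_add tendsto_const R1 R2)+
  show h: "(\<lambda>n. bifree_h (M n) z w) \<longlonglongrightarrow> bifree_h \<nu> z w"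
    unfolding bifree_h_eq using nz
    by (intro tendsto_divide tendsto_const cauchy_transform2_tendsto[OF M \<nu> wc F(1) im(1) F(2) im(2)]) auto
  show "(\<lambda>n. bifree_R (M n) z w) \<longlonglongrightarrow> bifree_R \<nu> z w" if "bifree_h \<nu> z w \<noteq> 0"
    unfolding bifree_R_def by (intro tendsto_intros R1 R2 h that)
qed

text \<open>The aperture is prescribed so that the result can later be compared with an angle given
  in advance; only the height is at the lemma's disposal. Convergence of the marginal R-transforms
  is exported because it is the seed for the continuation to a taller angle.\<close>

lemma weakly_converges_imp_bifree_R:
  fixes \<mu> :: "nat \<Rightarrow> (real \<times> real) measure"
  assumes \<mu>: "\<And>n. borel_prob_measure (\<mu> n)" and \<nu>: "borel_prob_measure \<nu>" and wc: "weakly_converges \<mu> \<nu>"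
    and \<alpha>: "0 < \<alpha>"
  obtains \<beta> where "0 < \<beta>" "\<And>n. bifree_R_defined \<alpha> \<beta> (\<mu> n)" "bifree_R_defined \<alpha> \<beta> \<nu>"
    "\<And>z w. z \<in> double_stolz \<alpha> \<beta> \<Longrightarrow> w \<in> double_stolz \<alpha> \<beta> \<Longrightarrow> (\<lambda>n. bifree_R (\<mu> n) z w) \<longlonglongrightarrow> bifree_R \<nu> z w"
    "\<And>z. z \<in> double_stolz \<alpha> \<beta> \<Longrightarrow> (\<lambda>n. R_transform (marginal1 (\<mu> n)) z) \<longlonglongrightarrow> R_transform (marginal1 \<nu>) z"
    "\<And>z. z \<in> double_stolz \<alpha> \<beta> \<Longrightarrow> (\<lambda>n. R_transform (marginal2 (\<mu> n)) z) \<longlonglongrightarrow> R_transform (marginal2 \<nu>) z"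
    "uniform_limit UNIV
          (\<lambda>(y, v) n. bifree_R (\<mu> n) (- \<i> * complex_of_real y) (- \<i> * complex_of_real v))
          (\<lambda>n. 0) (at_right 0 \<times>\<^sub>F at_right 0)"
proof -
  define c where "c = stolz_const \<alpha>"
  have c: "0 < c" "c < 1 / 2" using stolz_const_bounds[OF \<alpha>] by (auto simp: c_def)
  note m1 = borel_prob_marginal(1)[OF \<mu>] and m2 = borel_prob_marginal(2)[OF \<mu>]
  note n1 = borel_prob_marginal(1)[OF \<nu>] and n2 = borel_prob_marginal(2)[OF \<nu>]
  note w1 = weakly_converges_marginal(1)[OF \<mu> \<nu> wc] and w2 = weakly_converges_marginal(2)[OF \<mu> \<nu> wc]
  have small: "\<exists>\<rho>>0. \<forall>r. 0 \<le> r \<and> r \<le> \<rho> \<longrightarrow>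
      (\<forall>n. truncated_moment (marginal1 (\<mu> n)) r < e \<and> truncated_moment (marginal2 (\<mu> n)) r < e) \<and>
      truncated_moment (marginal1 \<nu>) r < e \<and> truncated_moment (marginal2 \<nu>) r < e" if e: "0 < e" for e
  proof -
    obtain \<rho>1 where 1: "0 < \<rho>1" "\<And>r n. 0 \<le> r \<Longrightarrow> r \<le> \<rho>1 \<Longrightarrow> truncated_moment (marginal1 (\<mu> n)) r < e"
      using truncated_moment_uniformly_small[OF m1 n1 w1 e] by blast
    obtain \<rho>2 where 2: "0 < \<rho>2" "\<And>r n. 0 \<le> r \<Longrightarrow> r \<le> \<rho>2 \<Longrightarrow> truncated_moment (marginal2 (\<mu> n)) r < e"
      using truncated_moment_uniformly_small[OF m2 n2 w2 e] by blast
    obtain \<rho>3 where 3: "0 < \<rho>3" "\<And>r. 0 \<le> r \<Longrightarrow> r \<le> \<rho>3 \<Longrightarrow> truncated_moment (marginal1 \<nu>) r < e"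
      using truncated_moment_small[OF n1 e] by blast
    obtain \<rho>4 where 4: "0 < \<rho>4" "\<And>r. 0 \<le> r \<Longrightarrow> r \<le> \<rho>4 \<Longrightarrow> truncated_moment (marginal2 \<nu>) r < e"
      using truncated_moment_small[OF n2 e] by blast
    show ?thesis
      by (rule exI[of _ "min (min \<rho>1 \<rho>2) (min \<rho>3 \<rho>4)"]) (use 1 2 3 4 in auto)
  qed
  have "0 < c ^ 3 / 12" using c by simp
  from small[OF this] obtain \<rho> where \<rho>: "0 < \<rho>" "\<And>r n. 0 \<le> r \<Longrightarrow> r \<le> \<rho> \<Longrightarrow>
      truncated_moment (marginal1 (\<mu> n)) r < c ^ 3 / 12 \<and> truncated_moment (marginal2 (\<mu> n)) r < c ^ 3 / 12 \<and>
      truncated_moment (marginal1 \<nu>) r < c ^ 3 / 12 \<and> truncated_moment (marginal2 \<nu>) r < c ^ 3 / 12"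
    by blast
  \<comment> \<open>Chosen so that the largest radius occurring on the angle, 2(1 +
    \<alpha>)\<beta>, is exactly \<rho>.\<close>
  define \<beta> where "\<beta> = \<rho> / (2 * (1 + \<alpha>))"
  have \<beta>: "0 < \<beta>" "2 * ((1 + \<alpha>) * \<beta>) = \<rho>" using \<rho>(1) \<alpha> by (auto simp: \<beta>_def field_simps)
  have tm: "truncated_moment (marginal1 (\<mu> n)) (2 * ((1 + \<alpha>) * \<beta>)) \<le> stolz_const \<alpha> ^ 3 / 12"
    "truncated_moment (marginal2 (\<mu> n)) (2 * ((1 + \<alpha>) * \<beta>)) \<le> stolz_const \<alpha> ^ 3 / 12"
    "truncated_moment (marginal1 \<nu>) (2 * ((1 + \<alpha>) * \<beta>)) \<le> stolz_const \<alpha> ^ 3 / 12"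
    "truncated_moment (marginal2 \<nu>) (2 * ((1 + \<alpha>) * \<beta>)) \<le> stolz_const \<alpha> ^ 3 / 12" for n
    using \<rho>(2)[of \<rho> n] \<rho>(1) unfolding \<beta>(2) c_def by auto
  have c3: "stolz_const \<alpha> ^ 3 / 12 \<le> (stolz_const \<alpha>)\<^sup>2 / 4"
    using c by (simp add: c_def power3_eq_cube power2_eq_square mult_le_cancel_right)
  note tm' = tm[THEN order.trans, OF c3]
  have def\<mu>: "bifree_R_defined \<alpha> \<beta> (\<mu> n)" for n
    by (intro bifree_R_small_moments \<mu> \<alpha> \<beta> tm)
  have def\<nu>: "bifree_R_defined \<alpha> \<beta> \<nu>"
    by (intro bifree_R_small_moments \<nu> \<alpha> \<beta> tm)
  have R1: "(\<lambda>n. R_transform (marginal1 (\<mu> n)) z) \<longlonglongrightarrow> R_transform (marginal1 \<nu>) z" if "z \<in> double_stolz \<alpha> \<beta>" for z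
    by (rule R_transform_tendsto[OF m1 n1 w1 \<alpha> \<beta>(1) tm'(1,3) that])
  have R2: "(\<lambda>n. R_transform (marginal2 (\<mu> n)) z) \<longlonglongrightarrow> R_transform (marginal2 \<nu>) z" if "z \<in> double_stolz \<alpha> \<beta>" for z
    by (rule R_transform_tendsto[OF m2 n2 w2 \<alpha> \<beta>(1) tm'(2,4) that])
  have lim: "(\<lambda>n. bifree_R (\<mu> n) z w) \<longlonglongrightarrow> bifree_R \<nu> z w"
    if z: "z \<in> double_stolz \<alpha> \<beta>" and w: "w \<in> double_stolz \<alpha> \<beta>" for z w
    using def\<nu> z w
    by (intro bifree_R_tendsto(2) \<mu> \<nu> wc R1 R2 R_inverse_props(1)[OF n1 \<alpha> \<beta>(1)] R_inverse_props(1)[OF n2 \<alpha> \<beta>(1)])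
       (auto simp: bifree_R_defined_def mem_double_stolz)
  have unif: "uniform_limit UNIV
          (\<lambda>(y, v) n. bifree_R (\<mu> n) (- \<i> * complex_of_real y) (- \<i> * complex_of_real v))
          (\<lambda>n. 0) (at_right 0 \<times>\<^sub>F at_right 0)"
  proof (rule uniform_limitI)
    fix e :: real assume "0 < e"
    \<comment> \<open>The bound is 13/c^3 times a sum of two truncated moments, whence 26.\<close>
    define e' where "e' = e * c ^ 3 / 26"
    have "0 < e'" using \<open>0 < e\<close> c by (simp add: e'_def)
    from small[OF this] obtain d where d: "0 < d" "\<And>r n. 0 \<le> r \<Longrightarrow> r \<le> d \<Longrightarrow>
      truncated_moment (marginal1 (\<mu> n)) r < e' \<and> truncated_moment (marginal2 (\<mu> n)) r < e'"
      by blast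
    define b where "b = min \<beta> (d / 2)"
    have b: "0 < b" "b \<le> \<beta>" "2 * b \<le> d" using \<beta> d by (auto simp: b_def)
    have "\<forall>n. dist (bifree_R (\<mu> n) (- \<i> * complex_of_real y) (- \<i> * complex_of_real v)) 0 < e"
      if yv: "0 < y" "y < b" "0 < v" "v < b" for y v
    proof
      fix n
      have "norm (bifree_R (\<mu> n) (- \<i> * complex_of_real y) (- \<i> * complex_of_real v)) \<le>
        13 / c ^ 3 * (truncated_moment (marginal1 (\<mu> n)) (2 * norm (- \<i> * complex_of_real y)) +
          truncated_moment (marginal2 (\<mu> n)) (2 * norm (- \<i> * complex_of_real v)))"
        unfolding c_def using yv b
        by (intro bifree_R_small_moments(2)[OF \<mu> \<alpha> \<beta>(1) tm(1,2)] imaginary_mem_double_stolz \<alpha>) auto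
      also have "\<dots> < 13 / c ^ 3 * (e' + e')"
        using d(2)[of "2 * norm (- \<i> * complex_of_real y)" n] d(2)[of "2 * norm (- \<i> * complex_of_real v)" n] yv b c
        by (intro mult_strict_left_mono add_strict_mono) (auto simp: norm_mult)
      also have "\<dots> = e" using c by (simp add: e'_def)
      finally show "dist (bifree_R (\<mu> n) (- \<i> * complex_of_real y) (- \<i> * complex_of_real v)) 0 < e" by simp
    qed
    moreover have "\<forall>\<^sub>F y in at_right 0. 0 < y \<and> y < b"
      using b(1) by (auto simp: eventually_at_right_field)
    ultimately show "\<forall>\<^sub>F p in at_right 0 \<times>\<^sub>F at_right 0. \<forall>n\<in>UNIV.
        dist ((case p of (y, v) \<Rightarrow> \<lambda>n. bifree_R (\<mu> n) (- \<i> * complex_of_real y) (- \<i> * complex_of_real v)) n) 0 < e"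
      unfolding eventually_prod_filter
      by (intro exI[of _ "\<lambda>y. 0 < y \<and> y < b"]) auto
  qed
  show thesis by (rule that[OF \<beta>(1) def\<mu> def\<nu> lim R1 R2 unif])
qed

subsection \<open>Normal families and limits of R-transforms\<close>

lemma tendsto_if_subsubseq:
  fixes X :: "nat \<Rightarrow> 'a::metric_space"
  assumes "\<And>s :: nat \<Rightarrow> nat. strict_mono s \<Longrightarrow> \<exists>r :: nat \<Rightarrow> nat. strict_mono r \<and> (\<lambda>n. X (s (r n))) \<longlonglongrightarrow> L"
  shows "X \<longlonglongrightarrow> L"
proof (rule ccontr)
  assume "\<not> X \<longlonglongrightarrow> L"
  then obtain e where "e > 0" and "infinite {n. \<not> dist (X n) L < e}"
    by (auto simp: tendsto_iff not_eventually INFM_iff_infinite cofinite_eq_sequentially[symmetric])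
  then obtain s :: "nat \<Rightarrow> nat" where s: "\<And>n. \<not> dist (X (s n)) L < e" and "strict_mono s"
    using enumerate_in_set enumerate_mono by (fastforce simp: strict_mono_def)
  then obtain r :: "nat \<Rightarrow> nat" where "strict_mono r" "(\<lambda>n. X (s (r n))) \<longlonglongrightarrow> L"
    using assms by blast
  then show False using s \<open>e > 0\<close> by (auto dest!: tendstoD[of _ _ _ e])
qed

text \<open>Montel's theorem supplies a convergent further subsequence of every subsequence. All
  limits so obtained agree with \<open>F0\<close> on the open set U, hence with each other on S by
  the identity theorem, and this forces the whole sequence to converge.\<close>

lemma Vitali_convergence:
  fixes F :: "nat \<Rightarrow> complex \<Rightarrow> complex"
  assumes S: "open S" "connected S" and U: "open U" "U \<noteq> {}" "U \<subseteq> S"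
    and hol: "\<And>n. F n holomorphic_on S" and bd: "\<And>n z. z \<in> S \<Longrightarrow> norm (F n z) \<le> B"
    and lim: "\<And>z. z \<in> U \<Longrightarrow> (\<lambda>n. F n z) \<longlonglongrightarrow> F0 z"
  obtains g where "g holomorphic_on S" "\<And>z. z \<in> S \<Longrightarrow> (\<lambda>n. F n z) \<longlonglongrightarrow> g z"
proof -
  have sub: "\<exists>g r. g holomorphic_on S \<and> strict_mono (r :: nat \<Rightarrow> nat) \<and>
      (\<forall>z\<in>S. (\<lambda>n. F (s (r n)) z) \<longlonglongrightarrow> g z) \<and> (\<forall>z\<in>U. g z = F0 z)"
    if s: "strict_mono (s :: nat \<Rightarrow> nat)" for s
  proof -
    obtain g r where g: "g holomorphic_on S" "strict_mono (r :: nat \<Rightarrow> nat)"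
      "\<And>x. x \<in> S \<Longrightarrow> (\<lambda>n. F (s (r n)) x) \<longlonglongrightarrow> g x"
    proof (rule Montel[OF S(1), of "range F" "\<lambda>n. F (s n)"])
      show "h holomorphic_on S" if "h \<in> range F" for h using that hol by auto
      show "\<exists>B. \<forall>h\<in>range F. \<forall>z\<in>K. norm (h z) \<le> B" if "K \<subseteq> S" for K
        using that bd by (intro exI[of _ B]) auto
    qed auto
    have "g z = F0 z" if "z \<in> U" for z
    proof (rule LIMSEQ_unique[OF g(3)])
      show "(\<lambda>n. F (s (r n)) z) \<longlonglongrightarrow> F0 z"
        using LIMSEQ_subseq_LIMSEQ[OF lim[OF that] strict_mono_o[OF s g(2)]] by (simp add: o_def)
    qed (use that U in auto)
    then show ?thesis using g by blast
  qed
  obtain g where g: "g holomorphic_on S" "\<And>z. z \<in> U \<Longrightarrow> g z = F0 z"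
    using sub[of "\<lambda>n. n"] by (auto simp: strict_mono_def)
  have "(\<lambda>n. F n z) \<longlonglongrightarrow> g z" if z: "z \<in> S" for z
  proof (rule tendsto_if_subsubseq)
    fix s :: "nat \<Rightarrow> nat" assume "strict_mono s"
    then obtain g' r where g': "g' holomorphic_on S" "strict_mono (r :: nat \<Rightarrow> nat)"
      "\<And>z. z \<in> S \<Longrightarrow> (\<lambda>n. F (s (r n)) z) \<longlonglongrightarrow> g' z" "\<And>z. z \<in> U \<Longrightarrow> g' z = F0 z"
      using sub by meson
    have "g' z = g z"
      by (rule analytic_continuation_open[where s = U and s' = S and f = g' and g = g])
         (use S U g g' z in auto)
    then show "\<exists>r :: nat \<Rightarrow> nat. strict_mono r \<and> (\<lambda>n. F (s (r n)) z) \<longlonglongrightarrow> g z"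
      using g'(2) g'(3)[OF z] by auto
  qed
  then show thesis using that[OF g(1)] by blast
qed

text \<open>Put k = 1/\<zeta>. Expanding the square, |k - \<i>\<sigma>/2| < 1/2 becomes |k|^2 <
  \<sigma> Im k, and multiplication by |\<zeta>|^2 yields 1 < -\<sigma> Im \<zeta>. The lemma trades
  an unbounded half-plane for a disc, so that Montel's theorem applies.\<close>

lemma half_plane_inverse:
  assumes "\<sigma> \<in> {1, -1::real}" "\<zeta> \<noteq> 0"
  shows "1 / \<zeta> \<in> ball (\<i> * of_real (\<sigma> / 2)) (1 / 2) \<longleftrightarrow> \<sigma> * Im \<zeta> < - 1"
proof -
  have n: "0 < (norm \<zeta>)\<^sup>2" using assms(2) by simp
  have k: "(norm (k - \<i> * of_real (\<sigma> / 2)))\<^sup>2 = (norm k)\<^sup>2 - \<sigma> * Im k + 1 / 4" for k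
    using assms(1) unfolding cmod_power2 by (auto simp: power2_eq_square algebra_simps)
  have "1 / \<zeta> \<in> ball (\<i> * of_real (\<sigma> / 2)) (1 / 2) \<longleftrightarrow> norm (1 / \<zeta> - \<i> * of_real (\<sigma> / 2)) < 1 / 2"
    by (simp add: dist_norm norm_minus_commute)
  also have "\<dots> \<longleftrightarrow> (norm (1 / \<zeta> - \<i> * of_real (\<sigma> / 2)))\<^sup>2 < (1 / 2)\<^sup>2"
    unfolding not_le[symmetric] by (subst power_mono_iff) auto
  also have "\<dots> \<longleftrightarrow> (norm (1 / \<zeta>))\<^sup>2 < \<sigma> * Im (1 / \<zeta>)"
    unfolding k by (simp add: power2_eq_square)
  also have "\<dots> \<longleftrightarrow> 1 / (norm \<zeta>)\<^sup>2 < - \<sigma> * Im \<zeta> / (norm \<zeta>)\<^sup>2"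
    by (simp add: norm_divide power_divide Im_divide cmod_power2)
  also have "\<dots> \<longleftrightarrow> 1 < - \<sigma> * Im \<zeta>"
    using n by (simp only: divide_less_cancel) auto
  finally show ?thesis by auto
qed

text \<open>Since G exchanges the half-planes, the functions \<open>R_inverse (m n)\<close> take
  values in one half-plane. The Moebius map \<zeta> -> 1/(\<zeta> - \<i>\<sigma>) sends it to a disc
  whose boundary circle corresponds to the real line together with infinity (the point 0). Thus the
  two ways in which the limit could degenerate are both boundary values, and a non-constant
  holomorphic limit avoids the boundary by the open mapping theorem.\<close>

lemma R_inverse_limit_half:
  assumes m: "\<And>n. borel_prob_measure (m n)" and \<nu>: "borel_prob_measure \<nu>" and wc: "weakly_converges m \<nu>"
    and pos: "0 < \<alpha>" "0 < \<beta>" "0 < \<beta>0" and def: "\<And>n. R_transform_defined \<alpha> \<beta> (m n)"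
    and def\<nu>: "R_transform_defined \<alpha> \<beta>0 \<nu>"
    and lim: "\<And>z. z \<in> double_stolz \<alpha> \<beta>0 \<Longrightarrow> (\<lambda>n. R_transform (m n) z) \<longlonglongrightarrow> R_transform \<nu> z"
    and \<sigma>: "\<sigma> \<in> {1, -1}"
  shows "\<exists>F. F holomorphic_on half_stolz \<sigma> \<alpha> \<beta> \<and> (\<forall>z\<in>half_stolz \<sigma> \<alpha> \<beta>.
    (\<lambda>n. R_inverse (m n) z) \<longlonglongrightarrow> F z \<and> Im (F z) \<noteq> 0 \<and> cauchy_transform \<nu> (F z) = z)"
proof -
  define S where "S = half_stolz \<sigma> \<alpha> \<beta>"
  define b where "b = min \<beta> \<beta>0"
  have b: "0 < b" "b \<le> \<beta>" "b \<le> \<beta>0" using pos by (auto simp: b_def)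
  define U where "U = half_stolz \<sigma> \<alpha> b"
  have S: "open S" "connected S" "S \<subseteq> double_stolz \<alpha> \<beta>"
    unfolding S_def using open_half_stolz connected_half_stolz[OF \<sigma>] by (auto simp: half_stolz_def)
  have U: "open U" "U \<subseteq> S" "U \<subseteq> double_stolz \<alpha> \<beta>0"
    using double_stolz_mono[OF b(2), of \<alpha>] double_stolz_mono[OF b(3), of \<alpha>] open_half_stolz
    unfolding U_def S_def by (auto simp: half_stolz_def)
  have points: "\<i> * of_real (\<sigma> * (b / 2)) \<in> U" "\<i> * of_real (\<sigma> * (b / 3)) \<in> U"
    using \<sigma> b pos by (auto simp: U_def half_stolz_def mem_double_stolz abs_mult)
  define k where "k n z = 1 / (R_inverse (m n) z - \<i> * of_real \<sigma>)" for n z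
  have k: "R_inverse (m n) z - \<i> * of_real \<sigma> \<noteq> 0" "k n z \<in> ball (\<i> * of_real (\<sigma> / 2)) (1 / 2)" if "z \<in> S" for n z
  proof -
    have "Im z * Im (R_inverse (m n) z) < 0"
      using R_inverse_props(3)[OF m pos(1,2) def] that S by blast
    moreover have "0 < \<sigma> * Im z" using that by (auto simp: S_def half_stolz_def)
    ultimately have neg: "\<sigma> * Im (R_inverse (m n) z) < 0"
      using \<sigma> by (auto simp: mult_less_0_iff)
    then have "\<sigma> * Im (R_inverse (m n) z - \<i> * of_real \<sigma>) < - 1"
      using \<sigma> by (auto simp: algebra_simps)
    moreover show "R_inverse (m n) z - \<i> * of_real \<sigma> \<noteq> 0"
      using neg \<sigma> by (auto simp: complex_eq_iff)
    ultimately show "k n z \<in> ball (\<i> * of_real (\<sigma> / 2)) (1 / 2)"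
      unfolding k_def using half_plane_inverse[OF \<sigma>] by blast
  qed
  have hol: "k n holomorphic_on S" for n
    unfolding k_def[abs_def] using k(1) S
    by (intro holomorphic_intros holomorphic_on_subset[OF holomorphic_R_inverse[OF m pos(1,2) def]]) auto
  have bd: "norm (k n z) \<le> 1" if "z \<in> S" for n z
    using k(2)[OF that, of n] norm_triangle_ineq2[of "k n z" "\<i> * of_real (\<sigma> / 2)"] \<sigma>
    by (auto simp: dist_norm norm_minus_commute norm_mult)
  have limk: "(\<lambda>n. k n z) \<longlonglongrightarrow> 1 / (R_inverse \<nu> z - \<i> * of_real \<sigma>)" 
      and nz: "R_inverse \<nu> z - \<i> * of_real \<sigma> \<noteq> 0" if "z \<in> U" for z
  proof -
    have z: "z \<in> double_stolz \<alpha> \<beta>0" using that U by auto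
    have "Im z * Im (R_inverse \<nu> z) < 0"
      using R_inverse_props(3)[OF \<nu> pos(1,3) def\<nu> z] .
    moreover have "0 < \<sigma> * Im z" using that by (auto simp: U_def half_stolz_def)
    ultimately show nz: "R_inverse \<nu> z - \<i> * of_real \<sigma> \<noteq> 0"
      using \<sigma> by (auto simp: mult_less_0_iff complex_eq_iff)
    show "(\<lambda>n. k n z) \<longlonglongrightarrow> 1 / (R_inverse \<nu> z - \<i> * of_real \<sigma>)"
      unfolding k_def R_inverse_def
      by (intro tendsto_intros lim[OF z]) (use nz in \<open>simp add: R_inverse_def\<close>)
  qed
  have "U \<noteq> {}" using points by auto
  obtain g where g: "g holomorphic_on S" "\<And>z. z \<in> S \<Longrightarrow> (\<lambda>n. k n z) \<longlonglongrightarrow> g z"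
    using Vitali_convergence[OF S(1,2) U(1) \<open>U \<noteq> {}\<close> U(2) hol bd limk] by metis
  have gU: "g z = 1 / (R_inverse \<nu> z - \<i> * of_real \<sigma>)" if "z \<in> U" for z
    using LIMSEQ_unique[OF g(2) limk[OF that]] that U by auto
  \<comment> \<open>On the smaller set U the limit is known and is undone by the Cauchy transform of
    \<nu>; a constant would identify two distinct points of U.\<close>
  have "\<not> g constant_on S"
  proof
    assume "g constant_on S"
    then obtain c where c: "\<And>z. z \<in> S \<Longrightarrow> g z = c" by (auto simp: constant_on_def)
    have inv: "R_inverse \<nu> z = 1 / c + \<i> * of_real \<sigma>" if "z \<in> U" for z
    proof -
      have "c = 1 / (R_inverse \<nu> z - \<i> * of_real \<sigma>)" using gU[OF that] c[of z] that U by auto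
      then show ?thesis by simp
    qed
    have "z = cauchy_transform \<nu> (1 / c + \<i> * of_real \<sigma>)" if "z \<in> U" for z
      using R_inverse_props(2)[OF \<nu> pos(1,3) def\<nu>, of z] inv[OF that] that U(3) by (metis subsetD)
    from this[OF points(1)] this[OF points(2)] have "\<i> * of_real (\<sigma> * (b / 2)) = \<i> * of_real (\<sigma> * (b / 3))"
      by (rule trans[OF _ sym])
    then have "\<sigma> * (b / 2) = \<sigma> * (b / 3)" by (simp only: mult_cancel_left of_real_eq_iff) simp
    then show False using b \<sigma> by auto
  qed
  \<comment> \<open>Pointwise limits stay only in the closed disc; an open set contained in it lies
    in its interior.\<close>
  then have "open (g ` S)" using open_mapping_thm[OF g(1) S(1,2) S(1)] by auto
  moreover have "g ` S \<subseteq> cball (\<i> * of_real (\<sigma> / 2)) (1 / 2)"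
  proof clarify
    fix z assume z: "z \<in> S"
    show "g z \<in> cball (\<i> * of_real (\<sigma> / 2)) (1 / 2)"
      by (rule Lim_in_closed_set[OF closed_cball _ _ g(2)[OF z]])
         (use k(2)[OF z] in \<open>auto intro!: always_eventually simp: less_imp_le\<close>)
  qed
  ultimately have "g ` S \<subseteq> ball (\<i> * of_real (\<sigma> / 2)) (1 / 2)"
    using interior_maximal by (metis interior_cball)
  then have gb: "g z \<in> ball (\<i> * of_real (\<sigma> / 2)) (1 / 2)" if "z \<in> S" for z using that by auto
  have g0: "g z \<noteq> 0" if "z \<in> S" for z
    using gb[OF that] \<sigma> by (auto simp: dist_norm norm_mult)
  define F where "F z = 1 / g z + \<i> * of_real \<sigma>" for z
  have "F holomorphic_on S" unfolding F_def[abs_def] using g0 by (intro holomorphic_intros g(1)) auto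
  moreover have "(\<lambda>n. R_inverse (m n) z) \<longlonglongrightarrow> F z \<and> Im (F z) \<noteq> 0 \<and> cauchy_transform \<nu> (F z) = z"
    if z: "z \<in> S" for z
  proof -
    have "(\<lambda>n. 1 / k n z + \<i> * of_real \<sigma>) \<longlonglongrightarrow> F z"
      unfolding F_def by (intro tendsto_intros g(2) z g0)
    moreover have "1 / k n z + \<i> * of_real \<sigma> = R_inverse (m n) z" for n
      using k(1)[OF z, of n] by (simp add: k_def)
    ultimately have lim: "(\<lambda>n. R_inverse (m n) z) \<longlonglongrightarrow> F z" by simp
    have "\<sigma> * Im (1 / g z) < - 1"
      using half_plane_inverse[OF \<sigma>, of "1 / g z"] gb[OF z] g0[OF z] by simp
    then have im: "Im (F z) \<noteq> 0" using \<sigma> by (auto simp: F_def)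
    have "(\<lambda>n. cauchy_transform (m n) (R_inverse (m n) z)) \<longlonglongrightarrow> cauchy_transform \<nu> (F z)"
      by (rule cauchy_transform_tendsto[OF m \<nu> wc lim im])
    moreover have "cauchy_transform (m n) (R_inverse (m n) z) = z" for n
      using R_inverse_props(2)[OF m pos(1,2) def] z S by blast
    ultimately have "cauchy_transform \<nu> (F z) = z" by (simp add: LIMSEQ_const_iff)
    with lim im show ?thesis by blast
  qed
  ultimately show ?thesis unfolding S_def by blast
qed

lemma R_transform_limit:
  assumes m: "\<And>n. borel_prob_measure (m n)" and \<nu>: "borel_prob_measure \<nu>" and wc: "weakly_converges m \<nu>"
    and pos: "0 < \<alpha>" "0 < \<beta>" "0 < \<beta>0" and def: "\<And>n. R_transform_defined \<alpha> \<beta> (m n)"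
    and def\<nu>: "R_transform_defined \<alpha> \<beta>0 \<nu>"
    and lim: "\<And>z. z \<in> double_stolz \<alpha> \<beta>0 \<Longrightarrow> (\<lambda>n. R_transform (m n) z) \<longlonglongrightarrow> R_transform \<nu> z"
  shows "R_transform_defined \<alpha> \<beta> \<nu>"
    and "z \<in> double_stolz \<alpha> \<beta> \<Longrightarrow> (\<lambda>n. R_transform (m n) z) \<longlonglongrightarrow> R_transform \<nu> z"
proof -
  let ?D = "double_stolz \<alpha> \<beta>"
  note half = R_inverse_limit_half[OF m \<nu> wc pos def def\<nu> lim]
  obtain F where F: "\<And>\<sigma>. \<sigma> \<in> {1, -1} \<Longrightarrow> F \<sigma> holomorphic_on half_stolz \<sigma> \<alpha> \<beta>"
    "\<And>\<sigma> z. \<sigma> \<in> {1, -1} \<Longrightarrow> z \<in> half_stolz \<sigma> \<alpha> \<beta> \<Longrightarrow> (\<lambda>n. R_inverse (m n) z) \<longlonglongrightarrow> F \<sigma> z"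
    "\<And>\<sigma> z. \<sigma> \<in> {1, -1} \<Longrightarrow> z \<in> half_stolz \<sigma> \<alpha> \<beta> \<Longrightarrow> Im (F \<sigma> z) \<noteq> 0 \<and> cauchy_transform \<nu> (F \<sigma> z) = z"
    using half by metis
  \<comment> \<open>The pointwise limit glues the holomorphic functions found on the two
    components.\<close>
  define f where "f z = lim (\<lambda>n. R_transform (m n) z)" for z
  have f: "(\<lambda>n. R_transform (m n) z) \<longlonglongrightarrow> F \<sigma> z - 1 / z" "f z = F \<sigma> z - 1 / z"
    if "\<sigma> \<in> {1, -1}" "z \<in> half_stolz \<sigma> \<alpha> \<beta>" for \<sigma> z
  proof -
    have "(\<lambda>n. R_inverse (m n) z - 1 / z) \<longlonglongrightarrow> F \<sigma> z - 1 / z"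
      by (intro tendsto_intros F that)
    then show "(\<lambda>n. R_transform (m n) z) \<longlonglongrightarrow> F \<sigma> z - 1 / z" by (simp add: R_inverse_def)
    then show "f z = F \<sigma> z - 1 / z" unfolding f_def by (rule limI)
  qed
  have flim: "(\<lambda>n. R_transform (m n) z) \<longlonglongrightarrow> f z" if "z \<in> ?D" for z
    using half_stolz_cases[OF that] f by metis
  have hol: "f holomorphic_on ?D"
  proof -
    have "f holomorphic_on half_stolz \<sigma> \<alpha> \<beta>" if \<sigma>: "\<sigma> \<in> {1, -1}" for \<sigma>
    proof -
      have "(\<lambda>z. F \<sigma> z - 1 / z) holomorphic_on half_stolz \<sigma> \<alpha> \<beta>"
        by (intro holomorphic_intros F \<sigma>) (auto simp: half_stolz_def)
      then show ?thesis using f(2)[OF \<sigma>] by (simp cong: holomorphic_cong)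
    qed
    then show ?thesis
      unfolding double_stolz_eq_Un by (intro holomorphic_on_Un open_half_stolz) auto
  qed
  \<comment> \<open>The half-plane argument says nothing about the normalisation at 0. It is
    inherited from \<open>R_transform \<nu>\<close> on the angle of height \<beta>0, with which f
    agrees near 0 by uniqueness of limits.\<close>
  have near: "((\<lambda>z. z * f z) \<longlongrightarrow> 0) (at 0 within ?D)"
  proof -
    define b where "b = min \<beta> \<beta>0"
    have b: "0 < b" "b \<le> \<beta>" "b \<le> \<beta>0" using pos by (auto simp: b_def)
    have "((\<lambda>z. z * R_transform \<nu> z) \<longlongrightarrow> 0) (at 0 within double_stolz \<alpha> \<beta>0)"
      using is_R_transform_on_R_transform[OF \<nu> pos(1,3) def\<nu>] by (simp add: is_R_transform_on_def)
    then have "((\<lambda>z. z * R_transform \<nu> z) \<longlongrightarrow> 0) (at 0 within double_stolz \<alpha> b)"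
      by (rule tendsto_within_subset) (use double_stolz_mono[OF b(3)] in auto)
    moreover have "at 0 within double_stolz \<alpha> b = at 0 within ?D"
      by (rule at_within_nhd[where S = "{z. \<bar>Im z\<bar> < b}"])
         (use b in \<open>auto intro!: open_Collect_less continuous_intros simp: mem_double_stolz\<close>)
    ultimately have "((\<lambda>z. z * R_transform \<nu> z) \<longlongrightarrow> 0) (at 0 within ?D)" by simp
    moreover have "\<forall>\<^sub>F z in at 0 within ?D. z * R_transform \<nu> z = z * f z"
    proof -
      have "R_transform \<nu> z = f z" if z: "z \<in> ?D" "norm z < b" for z
      proof -
        have "\<bar>Im z\<bar> < b" using abs_Im_le_cmod[of z] z(2) by linarith
        then have "z \<in> double_stolz \<alpha> \<beta>0" using z(1) b by (auto simp: mem_double_stolz)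
        then show ?thesis using LIMSEQ_unique[OF lim flim[OF z(1)]] by simp
      qed
      then show ?thesis unfolding eventually_at using b(1) by (intro exI[of _ b]) auto
    qed
    ultimately show ?thesis by (rule Lim_transform_eventually)
  qed
  have "is_R_transform_on ?D \<nu> f"
    unfolding is_R_transform_on_def
  proof (intro conjI ballI hol near)
    fix z assume "z \<in> ?D"
    then obtain \<sigma> where \<sigma>: "\<sigma> \<in> {1, -1}" "z \<in> half_stolz \<sigma> \<alpha> \<beta>" by (rule half_stolz_cases)
    have "1 / z + f z = F \<sigma> z" using f(2)[OF \<sigma>] by simp
    then show "1 / z + f z \<notin> \<real>" "cauchy_transform \<nu> (1 / z + f z) = z"
      using F(3)[OF \<sigma>] by (auto simp: complex_is_Real_iff)
  qed
  then show "R_transform_defined \<alpha> \<beta> \<nu>"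
    and "z \<in> ?D \<Longrightarrow> (\<lambda>n. R_transform (m n) z) \<longlonglongrightarrow> R_transform \<nu> z"
    using R_transform_eq[OF \<nu> pos(1,2)] flim by (auto simp: R_transform_defined_def)
qed

lemma bifree_R_limit:
  fixes \<mu> :: "nat \<Rightarrow> (real \<times> real) measure"
  assumes \<mu>: "\<And>n. borel_prob_measure (\<mu> n)" and \<nu>: "borel_prob_measure \<nu>" and wc: "weakly_converges \<mu> \<nu>"
    and pos: "0 < \<alpha>" "0 < \<beta>" and def: "\<And>n. bifree_R_defined \<alpha> \<beta> (\<mu> n)"
    and lim: "\<And>z w. z \<in> double_stolz \<alpha> \<beta> \<Longrightarrow> w \<in> double_stolz \<alpha> \<beta> \<Longrightarrow> (\<lambda>n. bifree_R (\<mu> n) z w) \<longlonglongrightarrow> R z w"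
  shows "bifree_R_defined \<alpha> \<beta> \<nu>"
    and "z \<in> double_stolz \<alpha> \<beta> \<Longrightarrow> w \<in> double_stolz \<alpha> \<beta> \<Longrightarrow> R z w = bifree_R \<nu> z w"
proof -
  let ?D = "double_stolz \<alpha> \<beta>"
  obtain \<beta>0 where \<beta>0: "0 < \<beta>0" "bifree_R_defined \<alpha> \<beta>0 \<nu>"
    "\<And>z. z \<in> double_stolz \<alpha> \<beta>0 \<Longrightarrow> (\<lambda>n. R_transform (marginal1 (\<mu> n)) z) \<longlonglongrightarrow> R_transform (marginal1 \<nu>) z"
    "\<And>z. z \<in> double_stolz \<alpha> \<beta>0 \<Longrightarrow> (\<lambda>n. R_transform (marginal2 (\<mu> n)) z) \<longlonglongrightarrow> R_transform (marginal2 \<nu>) z"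
    using weakly_converges_imp_bifree_R[OF \<mu> \<nu> wc pos(1)] by metis
  note m1 = borel_prob_marginal(1)[OF \<mu>] and m2 = borel_prob_marginal(2)[OF \<mu>]
  note n1 = borel_prob_marginal(1)[OF \<nu>] and n2 = borel_prob_marginal(2)[OF \<nu>]
  note w1 = weakly_converges_marginal(1)[OF \<mu> \<nu> wc] and w2 = weakly_converges_marginal(2)[OF \<mu> \<nu> wc]
  have d: "R_transform_defined \<alpha> \<beta> (marginal1 (\<mu> n))" "R_transform_defined \<alpha> \<beta> (marginal2 (\<mu> n))"
    "\<And>z w. z \<in> ?D \<Longrightarrow> w \<in> ?D \<Longrightarrow> bifree_h (\<mu> n) z w \<noteq> 0" for n
    using def[of n] by (auto simp: bifree_R_defined_def)
  have d0: "R_transform_defined \<alpha> \<beta>0 (marginal1 \<nu>)" "R_transform_defined \<alpha> \<beta>0 (marginal2 \<nu>)"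
    using \<beta>0(2) by (auto simp: bifree_R_defined_def)
  note R1 = R_transform_limit[OF m1 n1 w1 pos \<beta>0(1) d(1) d0(1) \<beta>0(3)]
  note R2 = R_transform_limit[OF m2 n2 w2 pos \<beta>0(1) d(2) d0(2) \<beta>0(4)]
  have h: "(\<lambda>n. bifree_h (\<mu> n) z w) \<longlonglongrightarrow> bifree_h \<nu> z w"
    "bifree_h \<nu> z w \<noteq> 0 \<Longrightarrow> (\<lambda>n. bifree_R (\<mu> n) z w) \<longlonglongrightarrow> bifree_R \<nu> z w"
    if "z \<in> ?D" "w \<in> ?D" for z w
    using that
    by (intro bifree_R_tendsto[OF \<mu> \<nu> wc R1(2) R2(2) R_inverse_props(1)[OF n1 pos R1(1)]
          R_inverse_props(1)[OF n2 pos R2(1)]]; auto simp: mem_double_stolz)+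
  \<comment> \<open>Solving the formula of \<open>bifree_R\<close> for 1/h shows that 1/h converges
    along the sequence, to some L. Since h converges as well, the product of the two limits is 1,
    which excludes a zero.\<close>
  have nz: "bifree_h \<nu> z w \<noteq> 0" if zw: "z \<in> ?D" "w \<in> ?D" for z w
  proof -
    define L where "L = z * R_transform (marginal1 \<nu>) z + w * R_transform (marginal2 \<nu>) w + 1 - R z w"
    have "(\<lambda>n. z * R_transform (marginal1 (\<mu> n)) z + w * R_transform (marginal2 (\<mu> n)) w + 1 - bifree_R (\<mu> n) z w) \<longlonglongrightarrow> L"
      unfolding L_def by (intro tendsto_intros R1(2) R2(2) lim zw)
    then have "(\<lambda>n. 1 / bifree_h (\<mu> n) z w) \<longlonglongrightarrow> L" by (simp add: bifree_R_def)
    from tendsto_mult[OF this h(1)[OF zw]] have "(\<lambda>n. 1 :: complex) \<longlonglongrightarrow> L * bifree_h \<nu> z w"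
      using d(3)[OF zw] by simp
    then have "L * bifree_h \<nu> z w = 1" by (simp add: LIMSEQ_const_iff)
    then show ?thesis by auto
  qed
  show "bifree_R_defined \<alpha> \<beta> \<nu>"
    using R1(1) R2(1) nz by (auto simp: bifree_R_defined_def)
  show "R z w = bifree_R \<nu> z w" if "z \<in> ?D" "w \<in> ?D"
    using LIMSEQ_unique[OF lim[OF that] h(2)[OF that nz[OF that]]] .
qed

subsection \<open>Tightness implies relative compactness\<close>

text \<open>Base 3 separates binary sequences, since no carries occur.\<close>

lemma ternary_separation:
  fixes a b :: "nat \<Rightarrow> real"
  assumes a: "\<And>i. a i \<in> {0, 1}" and b: "\<And>i. b i \<in> {0, 1}"
    and close: "\<bar>(\<Sum>i. a i * (1 / 3) ^ i) - (\<Sum>i. b i * (1 / 3) ^ i)\<bar> < (1 / 3) ^ N / 2"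
    and "i \<le> N"
  shows "a i = b i"
proof (rule ccontr)
  assume ne: "a i \<noteq> b i"
  define k where "k = (LEAST k. a k \<noteq> b k)"
  have k: "a k \<noteq> b k" "\<And>j. j < k \<Longrightarrow> a j = b j" "k \<le> i"
    unfolding k_def using LeastI[of "\<lambda>k. a k \<noteq> b k", OF ne] not_less_Least Least_le[of "\<lambda>k. a k \<noteq> b k", OF ne]
    by blast+
  define d where "d j = (a j - b j) * (1 / 3) ^ j" for j
  have dle: "\<bar>d j\<bar> \<le> (1 / 3) ^ j" for j
    using a[of j] b[of j] by (auto simp: d_def)
  have summ: "summable (\<lambda>j. c j * (1 / 3) ^ j)" if c: "\<And>i. c i \<in> {0, 1}" for c :: "nat \<Rightarrow> real"
  proof (rule summable_comparison_test'[of "\<lambda>j. (1 / 3 :: real) ^ j" 0])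
    show "summable (\<lambda>j. (1 / 3 :: real) ^ j)" by (rule summable_geometric) simp
    show "norm (c j * (1 / 3) ^ j) \<le> (1 / 3) ^ j" for j using c[of j] by auto
  qed
  have sd: "summable d" unfolding d_def[abs_def] left_diff_distrib by (intro summable_diff summ a b)
  \<comment> \<open>The digits after the first discrepancy k contribute at most the sum of 3^(-j)
    over j > k, which is half of the leading term 3^(-k).\<close>
  have tail: "\<bar>\<Sum>j. d (j + Suc k)\<bar> \<le> (1 / 3) ^ k / 2"
  proof -
    have geo: "(\<lambda>j. (1 / 3 :: real) ^ (j + Suc k)) sums ((1 / 3) ^ Suc k * (1 / (1 - 1 / 3)))"
      unfolding power_add by (subst mult.commute) (intro sums_mult geometric_sums, simp)
    have "\<bar>\<Sum>j. d (j + Suc k)\<bar> \<le> (\<Sum>j. (1 / 3) ^ (j + Suc k))"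
      unfolding real_norm_def[symmetric]
      by (rule norm_suminf_le[OF _ sums_summable[OF geo]]) (use dle in \<open>simp only: real_norm_def\<close>)
    also have "\<dots> = (1 / 3) ^ k / 2" using sums_unique[OF geo] by simp
    finally show ?thesis .
  qed
  have "(\<Sum>i. a i * (1 / 3) ^ i) - (\<Sum>i. b i * (1 / 3) ^ i) = suminf d"
    unfolding d_def[abs_def] left_diff_distrib by (intro suminf_diff summ a b)
  also have "\<dots> = (\<Sum>j. d (j + Suc k)) + sum d {..<Suc k}"
    by (rule suminf_split_initial_segment[OF sd])
  also have "sum d {..<Suc k} = d k"
    using k(2) by (simp add: d_def)
  finally have "\<bar>d k\<bar> - \<bar>\<Sum>j. d (j + Suc k)\<bar> \<le> \<bar>(\<Sum>i. a i * (1 / 3) ^ i) - (\<Sum>i. b i * (1 / 3) ^ i)\<bar>"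
    by linarith
  moreover have "\<bar>d k\<bar> = (1 / 3) ^ k"
    using a[of k] b[of k] k(1) by (auto simp: d_def)
  moreover have "(1 / 3 :: real) ^ N \<le> (1 / 3) ^ k"
    using k(3) assms(4) by (intro power_decreasing) auto
  ultimately show False using close tail by linarith
qed

text \<open>The digits of \<open>s p\<close> record which balls of radius 1/(k + 1) around the
  points of a countable dense set contain p. If \<open>s q\<close> is close to \<open>s p\<close>,
  the first digits agree, in particular one belonging to a small ball around p, so q lies in that
  ball too. Compactness of K is what bounds the number of digits needed. The code itself is only
  Borel; it is its inverse that has to be continuous.\<close>

lemma real_encoding_ex:
  obtains s :: "'a::{second_countable_topology, metric_space} \<Rightarrow> real" where
    "s \<in> borel_measurable borel" "\<And>x. 0 \<le> s x" "\<And>x. s x \<le> 3 / 2"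
    "\<And>K e. compact K \<Longrightarrow> 0 < e \<Longrightarrow> \<exists>\<delta>>0. \<forall>p\<in>K. \<forall>q. \<bar>s p - s q\<bar> < \<delta> \<longrightarrow> dist p q < e"
proof -
  obtain D :: "'a set" where D: "countable D" "\<And>X. open X \<Longrightarrow> X \<noteq> {} \<Longrightarrow> \<exists>d\<in>D. d \<in> X"
    by (rule countable_dense_setE) blast
  define U where "U i = ball (from_nat_into D (fst (prod_decode i))) (1 / real (Suc (snd (prod_decode i))))" for i
  define s where "s p = (\<Sum>i. indicator (U i) p * (1 / 3 :: real) ^ i)" for p
  have geo: "(\<lambda>i. (1 / 3 :: real) ^ i) sums (3 / 2)"
    using geometric_sums[of "1 / 3 :: real"] by simp
  have summ: "summable (\<lambda>i. indicator (U i) p * (1 / 3 :: real) ^ i)" for p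
    by (rule summable_comparison_test'[OF sums_summable[OF geo], of 0]) (auto simp: indicator_def)
  show thesis
  proof (rule that[of s])
    have [measurable]: "U i \<in> sets borel" for i by (simp add: U_def)
    show "s \<in> borel_measurable borel" unfolding s_def[abs_def] by measurable
    show "0 \<le> s x" for x unfolding s_def by (intro suminf_nonneg summ) auto
    show "s x \<le> 3 / 2" for x
      unfolding s_def sums_unique[OF geo]
      by (intro suminf_le summ sums_summable[OF geo]) (auto simp: indicator_def)
  next
    fix K :: "'a set" and e :: real assume K: "compact K" "0 < e"
    obtain k :: nat where k: "2 / real (Suc k) < e"
      using reals_Archimedean[of "e / 2"] K(2) by (auto simp: field_simps)
    have "K \<subseteq> (\<Union>j. U (prod_encode (j, k)))"
    proof
      fix p assume "p \<in> K"
      obtain d where d: "d \<in> D" "d \<in> ball p (1 / real (Suc k))" using D(2)[of "ball p (1 / real (Suc k))"] by auto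
      obtain j where "d = from_nat_into D j" using from_nat_into_surj[OF D(1) d(1)] by metis
      then have "p \<in> U (prod_encode (j, k))" using d(2) by (simp add: U_def dist_commute)
      then show "p \<in> (\<Union>j. U (prod_encode (j, k)))" by blast
    qed
    then obtain J where J: "finite J" "K \<subseteq> (\<Union>j\<in>J. U (prod_encode (j, k)))"
      using compactE_image[OF K(1), of UNIV "\<lambda>j. U (prod_encode (j, k))"] by (auto simp: U_def)
    define N where "N = Max (insert 0 ((\<lambda>j. prod_encode (j, k)) ` J))"
    have "dist p q < e" if p: "p \<in> K" and close: "\<bar>s p - s q\<bar> < (1 / 3) ^ N / 2" for p q
    proof -
      obtain j where j: "j \<in> J" "p \<in> U (prod_encode (j, k))" using J(2) p by blast
      have "prod_encode (j, k) \<le> N" using J(1) j(1) by (auto simp: N_def)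
      then have "indicator (U (prod_encode (j, k))) p = (indicator (U (prod_encode (j, k))) q :: real)"
        by (intro ternary_separation[where N = N, OF _ _ close[unfolded s_def]]) (auto simp: indicator_def)
      then have "q \<in> U (prod_encode (j, k))" using j(2) by (auto simp: indicator_def split: if_splits)
      with j(2) have "dist (from_nat_into D j) p < 1 / real (Suc k)" "dist (from_nat_into D j) q < 1 / real (Suc k)"
        by (auto simp: U_def)
      then have "dist p q < 2 / real (Suc k)"
        using dist_triangle3[of p q "from_nat_into D j"] unfolding one_add_one[symmetric] add_divide_distrib
        by linarith
      then show ?thesis using k by simp
    qed
    then show "\<exists>\<delta>>0. \<forall>p\<in>K. \<forall>q. \<bar>s p - s q\<bar> < \<delta> \<longrightarrow> dist p q < e"
      by (intro exI[of _ "(1 / 3) ^ N / 2"]) auto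
  qed
qed

lemma real_encoding_compact_ex:
  fixes K :: "'a::euclidean_space set"
  assumes "compact K"
  obtains s :: "'a \<Rightarrow> real" and D :: "real \<Rightarrow> 'a" where
    "s \<in> borel_measurable borel" "\<And>x. 0 \<le> s x" "\<And>x. s x \<le> 3 / 2"
    "continuous_on UNIV D" "\<And>p. p \<in> K \<Longrightarrow> D (s p) = p"
proof -
  obtain s :: "'a \<Rightarrow> real" where s: "s \<in> borel_measurable borel" "\<And>x. 0 \<le> s x" "\<And>x. s x \<le> 3 / 2"
    "\<And>e. 0 < e \<Longrightarrow> \<exists>\<delta>>0. \<forall>p\<in>K. \<forall>q. \<bar>s p - s q\<bar> < \<delta> \<longrightarrow> dist p q < e"
    using real_encoding_ex assms by metis
  have inj: "inj_on s K"
  proof (rule inj_onI)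
    fix p q assume pq: "p \<in> K" "q \<in> K" "s p = s q"
    have "dist p q < e" if "0 < e" for e using s(4)[OF that] pq by force
    then show "p = q" by (metis dist_pos_lt less_irrefl)
  qed
  define t where "t = inv_into K s"
  have t: "t (s p) = p" if "p \<in> K" for p using inj that by (simp add: t_def)
  have "uniformly_continuous_on (s ` K) t"
    unfolding uniformly_continuous_on_def
  proof (intro allI impI)
    fix e :: real assume "0 < e"
    then obtain \<delta> where \<delta>: "\<delta> > 0" "\<And>p q. p \<in> K \<Longrightarrow> \<bar>s p - s q\<bar> < \<delta> \<Longrightarrow> dist p q < e"
      using s(4) by blast
    have "dist (t y) (t x) < e" if xy: "x \<in> s ` K" "y \<in> s ` K" "dist y x < \<delta>" for x y
    proof -
      obtain p q where "x = s p" "y = s q" "p \<in> K" "q \<in> K" using xy by blast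
      then show ?thesis using \<delta>(2)[of q p] xy(3) t by (simp add: dist_real_def)
    qed
    then show "\<exists>d>0. \<forall>x\<in>s ` K. \<forall>x'\<in>s ` K. dist x' x < d \<longrightarrow> dist (t x') (t x) < e"
      using \<delta>(1) by blast
  qed
  then obtain g where g: "uniformly_continuous_on (closure (s ` K)) g" "\<And>x. x \<in> s ` K \<Longrightarrow> t x = g x"
    using uniformly_continuous_on_extension_on_closure by metis
  have "closedin (top_of_set UNIV) (closure (s ` K))" by simp
  from Tietze_unbounded[OF uniformly_continuous_imp_continuous[OF g(1)] this]
  obtain D where D: "continuous_on UNIV D" "\<And>x. x \<in> closure (s ` K) \<Longrightarrow> D x = g x"
    by blast
  have "D (s p) = p" if "p \<in> K" for p
    using D(2)[of "s p"] g(2)[of "s p"] t[OF that] that closure_subset[of "s ` K"] by auto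
  then show thesis using that s D(1) by blast
qed

text \<open>Helly's theorem on the real line is transported through a Borel encoding of the unit ball, which
  compactifies the space; the decoding is continuous, and tightness keeps the limit off the sphere.\<close>

lemma tight_imp_weakly_convergent_subseq:
  fixes \<mu> :: "nat \<Rightarrow> 'a::euclidean_space measure"
  assumes \<mu>: "\<And>n. borel_prob_measure (\<mu> n)"
    and tight: "\<And>e. 0 < e \<Longrightarrow> \<exists>B. \<forall>n. measure (\<mu> n) {p. B < norm p} \<le> e"
  obtains r \<nu> where "strict_mono (r :: nat \<Rightarrow> nat)" "borel_prob_measure \<nu>" "weakly_converges (\<lambda>n. \<mu> (r n)) \<nu>"
proof -
  \<comment> \<open>\<phi> contracts the space onto the open unit ball and \<psi> inverts it. On the
    unit sphere \<psi> has the value 0 of a division by zero, harmless once the limit law is shown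
    to give no mass to \<open>N\<close>.\<close>
  define \<phi> :: "'a \<Rightarrow> 'a" where "\<phi> p = (1 / (1 + norm p)) *\<^sub>R p" for p
  define \<psi> :: "'a \<Rightarrow> 'a" where "\<psi> q = (1 / (1 - norm q)) *\<^sub>R q" for q
  have pos: "0 < 1 + norm p" for p :: 'a using norm_ge_zero[of p] by linarith
  have n\<phi>: "norm (\<phi> p) = norm p / (1 + norm p)" for p using pos[of p] by (simp add: \<phi>_def)
  have \<psi>\<phi>: "\<psi> (\<phi> p) = p" for p
  proof -
    have "1 - norm (\<phi> p) = 1 / (1 + norm p)" using pos[of p] by (simp add: n\<phi> field_simps)
    then show ?thesis using pos[of p] by (simp add: \<psi>_def \<phi>_def)
  qed
  have \<phi>1: "norm (\<phi> p) \<le> 1" for p using pos[of p] by (simp add: n\<phi> divide_le_eq)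
  obtain s :: "'a \<Rightarrow> real" and D :: "real \<Rightarrow> 'a" where s: "s \<in> borel_measurable borel" "\<And>x. 0 \<le> s x" "\<And>x. s x \<le> 3 / 2"
    and D: "continuous_on UNIV D" and Ds: "\<And>p. p \<in> cball 0 1 \<Longrightarrow> D (s p) = p"
    using real_encoding_compact_ex[OF compact_cball[of "0::'a" 1]] by metis
  have D\<phi>: "D (s (\<phi> p)) = \<phi> p" for p using Ds \<phi>1 by simp
  have [measurable]: "D \<in> borel_measurable borel" "s \<in> borel_measurable borel"
    using D s(1) by (auto intro: borel_measurable_continuous_onI)
  have [measurable]: "\<phi> \<in> borel_measurable borel" "\<psi> \<in> borel_measurable borel"
    unfolding \<phi>_def[abs_def] \<psi>_def[abs_def] by measurable
  have [measurable_cong]: "sets (\<mu> n) = sets borel" for n using borel_prob_measureD(2)[OF \<mu>] .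
  define m where "m n = distr (\<mu> n) borel (\<lambda>p. s (\<phi> p))" for n
  have m: "real_distribution (m n)" for n
  proof -
    interpret prob_space "\<mu> n" by (rule borel_prob_measureD[OF \<mu>])
    interpret d: prob_space "m n" unfolding m_def by (rule prob_space_distr) measurable
    show ?thesis by standard (simp add: m_def)
  qed
  \<comment> \<open>All codes lie between 0 and 3/2, so tightness on the line is automatic. The
    tightness assumption on \<mu> enters only in showing that \<open>N\<close> is a null
    set.\<close>
  have "tight m"
    unfolding tight_def
  proof (intro conjI allI impI m)
    fix e :: real assume "0 < e"
    have "measure (m n) {-1<..2} = 1" for n
    proof -
      interpret prob_space "\<mu> n" by (rule borel_prob_measureD[OF \<mu>])
      have "measure (m n) {-1<..2} = measure (\<mu> n) ((\<lambda>p. s (\<phi> p)) -` {-1<..2} \<inter> space (\<mu> n))"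
        unfolding m_def by (rule measure_distr) auto
      also have "(\<lambda>p. s (\<phi> p)) -` {-1<..2} \<inter> space (\<mu> n) = space (\<mu> n)"
      proof -
        have "- 1 < s x" "s x \<le> 2" for x using s(2,3)[of x] by linarith+
        then show ?thesis by auto
      qed
      finally show ?thesis using prob_space by simp
    qed
    then show "\<exists>a b. a < b \<and> (\<forall>n. 1 - e < measure (m n) {a<..b})"
      using \<open>0 < e\<close> by (intro exI[of _ "-1"] exI[of _ 2]) auto
  qed
  then obtain r M where r: "strict_mono (r :: nat \<Rightarrow> nat)" and M: "real_distribution M"
    and "weak_conv_m (m \<circ> id \<circ> r) M"
    using tight_imp_convergent_subsubsequence[of m id] by (auto simp: strict_mono_def)
  then have wc: "weak_conv_m (\<lambda>n. m (r n)) M" by (simp add: o_def)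
  interpret M: real_distribution M by (rule M)
  have transfer: "integral\<^sup>L (m n) f = (LINT p|\<mu> n. f (s (\<phi> p)))" if "f \<in> borel_measurable borel"
    for n and f :: "real \<Rightarrow> real"
    unfolding m_def using that by (intro integral_distr) auto
  \<comment> \<open>Decoding may leave the open ball here: on the sphere, or beyond it, since D is
    unconstrained away from the code set. Outside \<open>N\<close> the map \<psi> after D is
    continuous.\<close>
  define N where "N = {x. 1 \<le> norm (D x)}"
  have N: "N \<in> sets M" unfolding N_def by simp
  have le_e: "measure M N \<le> e" if e: "0 < e" for e
  proof -
    obtain B0 where B0: "\<And>n. measure (\<mu> n) {p. B0 < norm p} \<le> e" using tight[OF e] by blast
    define B where "B = max 0 B0"
    define b where "b = B / (1 + B)"
    have B: "0 \<le> B" "B0 \<le> B" by (auto simp: B_def)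
    have b: "b < 1" using B by (simp add: b_def divide_less_eq)
    \<comment> \<open>A continuous cutoff, equal to 1 on \<open>N\<close> and to 0 on codes of
      points of norm at most B, since b = B/(1 + B) is the norm of \<phi>(p) when |p| = B. Its
      integrals are at most e along the sequence and pass to the limit, unlike those of the
      indicator of \<open>N\<close>.\<close>
    define \<eta> where "\<eta> x = max 0 (min 1 ((norm (D x) - b) / (1 - b)))" for x
    have \<eta>cont: "continuous_on UNIV \<eta>"
      unfolding \<eta>_def[abs_def] using b by (intro continuous_intros D) auto
    have \<eta>01: "0 \<le> \<eta> x" "\<eta> x \<le> 1" for x by (auto simp: \<eta>_def)
    have [measurable]: "\<eta> \<in> borel_measurable borel" by (rule borel_measurable_continuous_onI[OF \<eta>cont])
    have "integral\<^sup>L (m n) \<eta> \<le> e" for n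
    proof -
      interpret prob_space "\<mu> n" by (rule borel_prob_measureD[OF \<mu>])
      have set: "{p. B0 < norm p} \<in> sets (\<mu> n)" using borel_prob_measureD(2)[OF \<mu>] by simp
      have "(LINT p|\<mu> n. \<eta> (s (\<phi> p))) \<le> (LINT p|\<mu> n. indicator {p. B0 < norm p} p)"
      proof (rule integral_mono)
        show "integrable (\<mu> n) (\<lambda>p. \<eta> (s (\<phi> p)))"
          by (rule integrable_const_bound[where B = 1]) (use \<eta>01 in auto)
        show "integrable (\<mu> n) (indicator {p. B0 < norm p} :: 'a \<Rightarrow> real)"
          using set by (intro integrable_const_bound[where B = 1]) auto
        fix p show "\<eta> (s (\<phi> p)) \<le> indicator {p. B0 < norm p} p"
        proof (cases "B0 < norm p")
          case False
          then have "norm p \<le> B" using B by simp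
          then have "norm (\<phi> p) \<le> b" unfolding n\<phi> b_def using B by (simp add: field_simps add_pos_nonneg)
          then show ?thesis using b by (simp add: \<eta>_def D\<phi> divide_nonpos_pos)
        qed (use \<eta>01 in simp)
      qed
      also have "\<dots> = measure (\<mu> n) {p. B0 < norm p}" using set by simp
      finally show ?thesis using B0[of n] transfer[of \<eta>] by simp
    qed
    moreover have "(\<lambda>n. integral\<^sup>L (m (r n)) \<eta>) \<longlonglongrightarrow> integral\<^sup>L M \<eta>"
      by (rule weak_conv_imp_integral_bdd_continuous_conv[OF m M wc, where B = 1])
         (use \<eta>cont \<eta>01 in \<open>auto simp: continuous_on_eq_continuous_at\<close>)
    ultimately have "integral\<^sup>L M \<eta> \<le> e" by (intro LIMSEQ_le_const2) auto
    moreover have "(LINT x|M. indicator N x) \<le> integral\<^sup>L M \<eta>"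
    proof (rule integral_mono)
      show "integrable M (indicator N :: real \<Rightarrow> real)" using N by (intro M.integrable_const_bound[where B = 1]) auto
      show "integrable M \<eta>" by (rule M.integrable_const_bound[where B = 1]) (use \<eta>01 in auto)
      show "indicator N x \<le> \<eta> x" for x
        using b by (auto simp: N_def \<eta>_def indicator_def)
    qed
    ultimately show ?thesis using N by simp
  qed
  have "measure M N \<le> 0" by (rule field_le_epsilon) (simp add: le_e)
  then have N0: "emeasure M N = 0" using measure_nonneg[of M N] by (simp add: M.emeasure_eq_measure)
  define \<nu> where "\<nu> = distr M borel (\<lambda>x. \<psi> (D x))"
  have "borel_prob_measure \<nu>"
    unfolding \<nu>_def borel_prob_measure_def by (auto intro!: M.prob_space_distr)
  moreover have "weakly_converges (\<lambda>n. \<mu> (r n)) \<nu>"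
    unfolding weakly_converges_def
  proof (intro allI impI)
    fix f :: "'a \<Rightarrow> real" assume f: "continuous_on UNIV f \<and> bounded (range f)"
    then obtain B where B: "\<And>x. norm (f x) \<le> B" by (auto simp: bounded_iff)
    have [measurable]: "f \<in> borel_measurable borel" using f by (auto intro: borel_measurable_continuous_onI)
    define F where "F x = f (\<psi> (D x))" for x
    have [measurable]: "F \<in> borel_measurable borel" unfolding F_def[abs_def] by measurable
    have "isCont F x" if "x \<notin> N" for x
    proof -
      have nz: "1 - norm (D x) \<noteq> 0" using that by (auto simp: N_def)
      have Dx: "isCont D x" using D by (auto simp: continuous_on_eq_continuous_at)
      then have "isCont (\<lambda>x. \<psi> (D x)) x" unfolding \<psi>_def by (intro continuous_intros nz)
      moreover have "isCont f (\<psi> (D x))" using f by (auto simp: continuous_on_eq_continuous_at)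
      ultimately show ?thesis unfolding F_def by (rule isCont_o2)
    qed
    then have "{x. \<not> isCont F x} \<subseteq> N" by auto
    then have disc: "emeasure M {x. \<not> isCont F x} = 0" using emeasure_eq_0[OF N N0] by blast
    have "(\<lambda>n. integral\<^sup>L (m (r n)) F) \<longlonglongrightarrow> integral\<^sup>L M F"
      by (rule weak_conv_imp_bdd_ae_continuous_conv[OF m M wc disc]) (auto simp: F_def intro: B[unfolded real_norm_def])
    moreover have "integral\<^sup>L (m (r n)) F = integral\<^sup>L (\<mu> (r n)) f" for n
      by (simp add: transfer F_def D\<phi> \<psi>\<phi>)
    moreover have "integral\<^sup>L M F = integral\<^sup>L \<nu> f"
      unfolding \<nu>_def F_def by (rule integral_distr[symmetric]) auto
    ultimately show "(\<lambda>n. integral\<^sup>L (\<mu> (r n)) f) \<longlonglongrightarrow> integral\<^sup>L \<nu> f" by simp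
  qed
  ultimately show thesis by (rule that[OF r])
qed

subsection \<open>Inversion: the two-variable Cauchy transform determines the measure\<close>

text \<open>Taken without the usual factor 1/pi, which reappears as the factor pi in
  \<open>arctan_limit_indicator\<close>.\<close>

definition poisson_kernel :: "real \<Rightarrow> real \<Rightarrow> real" where
  "poisson_kernel y x = y / (x\<^sup>2 + y\<^sup>2)"

lemma poisson_kernel_nonneg: "0 < y \<Longrightarrow> 0 \<le> poisson_kernel y x"
  by (simp add: poisson_kernel_def)

lemma poisson_kernel_le:
  assumes "0 < y"
  shows "poisson_kernel y x \<le> 1 / y"
proof -
  have "poisson_kernel y x \<le> y / y\<^sup>2"
    unfolding poisson_kernel_def using assms by (intro divide_left_mono mult_pos_pos add_nonneg_pos) auto
  then show ?thesis using assms by (simp add: power2_eq_square)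
qed

lemma measurable_poisson_kernel [measurable]: "poisson_kernel y \<in> borel_measurable borel"
  unfolding poisson_kernel_def[abs_def] by measurable

lemma nn_integral_poisson_kernel:
  assumes "0 < y" "a1 \<le> a2"
  shows "(\<integral>\<^sup>+a. ennreal (poisson_kernel y (x - a)) * indicator {a1..a2} a \<partial>lborel) =
    ennreal (arctan ((a2 - x) / y) - arctan ((a1 - x) / y))"
proof (rule nn_integral_FTC_Icc)
  fix a assume "a \<in> {a1..a2}"
  have "((\<lambda>a. arctan ((a - x) / y)) has_field_derivative (1 / y) * inverse (1 + ((a - x) / y)\<^sup>2)) (at a)"
    by (rule derivative_eq_intros refl | use assms(1) in simp)+
  also have "(1 / y) * inverse (1 + ((a - x) / y)\<^sup>2) = poisson_kernel y (x - a)"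
  proof -
    have nz: "y * y + (a - x) * (a - x) \<noteq> 0"
      using assms(1) by (metis add_pos_nonneg less_irrefl mult_pos_pos zero_le_square)
    have "1 + ((a - x) / y)\<^sup>2 = ((x - a)\<^sup>2 + y\<^sup>2) / y\<^sup>2"
      using assms(1) by (simp add: power_divide add_divide_distrib power2_commute)
    then show ?thesis using assms(1) by (simp add: poisson_kernel_def power2_eq_square)
  qed
  finally show "((\<lambda>a. arctan ((a - x) / y)) has_field_derivative poisson_kernel y (x - a)) (at a)" .
qed (use assms poisson_kernel_nonneg in auto)

text \<open>The height 1/n^2 tends to 0 faster than the shift 1/n of the right endpoint. At x = a
  the argument of arctan is therefore n, tending to infinity, so a possible atom at a is counted in
  full; with the endpoint kept at a it would count by half. The left endpoint -n removes the lower
  bound of the interval.\<close>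

lemma arctan_limit_indicator:
  "(\<lambda>k. arctan ((a + 1 / real (Suc k) - x) / (1 / (real (Suc k))\<^sup>2)) - arctan ((- real (Suc k) - x) / (1 / (real (Suc k))\<^sup>2)))
    \<longlonglongrightarrow> pi * indicator {..a} x"
proof -
  let ?n = "\<lambda>k. real (Suc k)"
  have n: "filterlim ?n at_top sequentially"
    using filterlim_real_sequentially by (rule filterlim_compose[OF _ filterlim_Suc])
  have inv: "(\<lambda>k. 1 / ?n k) \<longlonglongrightarrow> 0" by (rule LIMSEQ_Suc[OF lim_1_over_n])
  have n2: "filterlim (\<lambda>k. (?n k)\<^sup>2) at_top sequentially" and n3: "filterlim (\<lambda>k. (?n k) ^ 3) at_top sequentially"
    by (rule filterlim_pow_at_top[OF _ n]; simp)+
  have "filterlim (\<lambda>k. (- 1 - x * (1 / ?n k)) * (?n k) ^ 3) at_bot sequentially"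
  proof (rule filterlim_tendsto_neg_mult_at_bot[OF _ _ n3])
    show "(\<lambda>k. - 1 - x * (1 / ?n k)) \<longlonglongrightarrow> - 1 - x * 0" by (intro tendsto_intros inv)
  qed simp
  moreover have "(- 1 - x * (1 / ?n k)) * (?n k) ^ 3 = (- ?n k - x) / (1 / (?n k)\<^sup>2)" for k
    by (simp add: power2_eq_square power3_eq_cube field_simps)
  ultimately have "filterlim (\<lambda>k. (- ?n k - x) / (1 / (?n k)\<^sup>2)) at_bot sequentially" by simp
  then have lower: "(\<lambda>k. arctan ((- ?n k - x) / (1 / (?n k)\<^sup>2))) \<longlonglongrightarrow> - (pi / 2)"
    by (rule filterlim_compose[OF tendsto_arctan_at_bot])
  have upper: "(\<lambda>k. arctan ((a + 1 / ?n k - x) / (1 / (?n k)\<^sup>2))) \<longlonglongrightarrow> (if x \<le> a then pi / 2 else - (pi / 2))"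
  proof (cases "x \<le> a")
    case True
    have "filterlim (\<lambda>k. (a + 1 / ?n k - x) / (1 / (?n k)\<^sup>2)) at_top sequentially"
    proof (rule filterlim_at_top_mono[OF n])
      have "?n k \<le> (a + 1 / ?n k - x) / (1 / (?n k)\<^sup>2)" for k
      proof -
        have "(a + 1 / ?n k - x) / (1 / (?n k)\<^sup>2) = (a - x) * (?n k)\<^sup>2 + ?n k"
          by (simp add: power2_eq_square field_simps)
        then show ?thesis using True by simp
      qed
      then show "\<forall>\<^sub>F k in sequentially. ?n k \<le> (a + 1 / ?n k - x) / (1 / (?n k)\<^sup>2)" by simp
    qed
    then show ?thesis using True by (simp add: filterlim_compose[OF tendsto_arctan_at_top])
  next
    case False
    have "filterlim (\<lambda>k. (a + 1 / ?n k - x) * (?n k)\<^sup>2) at_bot sequentially"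
    proof (rule filterlim_tendsto_neg_mult_at_bot[OF _ _ n2])
      show "(\<lambda>k. a + 1 / ?n k - x) \<longlonglongrightarrow> a + 0 - x" by (intro tendsto_intros inv)
    qed (use False in simp)
    then show ?thesis using False by (simp add: filterlim_compose[OF tendsto_arctan_at_bot])
  qed
  from tendsto_diff[OF upper lower] show ?thesis by (auto simp: indicator_def)
qed

text \<open>Integrating the Poisson integral over a in an interval and exchanging the order by
  Tonelli produces increments of arctan in closed form. Their limit is an indicator, so dominated
  convergence recovers the distribution function. Finite measures are allowed because the lemma is
  applied to weighted laws.\<close>

lemma poisson_integral_inject:
  fixes M N :: "real measure"
  assumes M: "finite_borel_measure M" and N: "finite_borel_measure N"
    and eq: "\<And>a y. 0 < y \<Longrightarrow> (\<integral>\<^sup>+x. ennreal (poisson_kernel y (x - a)) \<partial>M) = (\<integral>\<^sup>+x. ennreal (poisson_kernel y (x - a)) \<partial>N)"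
  shows "M = N"
proof -
  let ?A = "\<lambda>y a1 a2 x. arctan ((a2 - x) / y) - arctan ((a1 - x) / y) :: real"
  have A_bd: "\<bar>?A y a1 a2 x\<bar> \<le> 2 * pi" for y a1 a2 x
    using arctan_bounded[of "(a2 - x) / y"] arctan_bounded[of "(a1 - x) / y"] by auto
  have A_nonneg: "0 \<le> ?A y a1 a2 x" if "0 < y" "a1 \<le> a2" for y a1 a2 x
    using that by (simp add: arctan_le_iff divide_right_mono)
  have int: "integrable L (?A y a1 a2)" if "finite_borel_measure L" for L y a1 a2
  proof -
    interpret finite_borel_measure L by fact
    have [measurable_cong]: "sets L = sets borel" by (rule M_is_borel)
    show ?thesis by (rule integrable_const_bound[where B = "2 * pi"]) (use A_bd in auto)
  qed
  have tonelli: "ennreal (LINT x|L. ?A y a1 a2 x) =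
      (\<integral>\<^sup>+a. (\<integral>\<^sup>+x. ennreal (poisson_kernel y (x - a)) \<partial>L) * indicator {a1..a2} a \<partial>lborel)"
    if L: "finite_borel_measure L" and y: "0 < y" "a1 \<le> a2" for L y a1 a2
  proof -
    interpret finite_borel_measure L by fact
    have [measurable_cong]: "sets L = sets borel" by (rule M_is_borel)
    interpret P: pair_sigma_finite L lborel ..
    have "ennreal (LINT x|L. ?A y a1 a2 x) = (\<integral>\<^sup>+x. ennreal (?A y a1 a2 x) \<partial>L)"
      by (rule nn_integral_eq_integral[symmetric]) (use int[OF L] A_nonneg[OF y] in auto)
    also have "\<dots> = (\<integral>\<^sup>+x. (\<integral>\<^sup>+a. ennreal (poisson_kernel y (x - a)) * indicator {a1..a2} a \<partial>lborel) \<partial>L)"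
      by (simp add: nn_integral_poisson_kernel[OF y])
    also have "\<dots> = (\<integral>\<^sup>+a. (\<integral>\<^sup>+x. ennreal (poisson_kernel y (x - a)) * indicator {a1..a2} a \<partial>L) \<partial>lborel)"
      by (rule P.Fubini'[symmetric]) measurable
    also have "\<dots> = (\<integral>\<^sup>+a. (\<integral>\<^sup>+x. ennreal (poisson_kernel y (x - a)) \<partial>L) * indicator {a1..a2} a \<partial>lborel)"
      by (intro nn_integral_cong nn_integral_multc) measurable
    finally show ?thesis .
  qed
  have eqA: "(LINT x|M. ?A y a1 a2 x) = (LINT x|N. ?A y a1 a2 x)" if y: "0 < y" "a1 \<le> a2" for y a1 a2
  proof -
    have "ennreal (LINT x|M. ?A y a1 a2 x) = ennreal (LINT x|N. ?A y a1 a2 x)"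
      unfolding tonelli[OF M y] tonelli[OF N y] by (simp add: eq[OF y(1)])
    moreover have "0 \<le> (LINT x|M. ?A y a1 a2 x)" "0 \<le> (LINT x|N. ?A y a1 a2 x)"
      using A_nonneg[OF y] by (auto intro: integral_nonneg_AE)
    ultimately show ?thesis by simp
  qed
  have lim: "(\<lambda>k. LINT x|L. ?A (1 / (real (Suc k))\<^sup>2) (- real (Suc k)) (a + 1 / real (Suc k)) x) \<longlonglongrightarrow> pi * measure L {..a}"
    if L: "finite_borel_measure L" for L a
  proof -
    interpret finite_borel_measure L by fact
    have [measurable_cong]: "sets L = sets borel" by (rule M_is_borel)
    have "(\<lambda>k. LINT x|L. ?A (1 / (real (Suc k))\<^sup>2) (- real (Suc k)) (a + 1 / real (Suc k)) x) \<longlonglongrightarrow>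
       (LINT x|L. pi * indicator {..a} x)"
    proof (rule integral_dominated_convergence[where w = "\<lambda>_. 2 * pi"])
      show "AE x in L. norm (?A (1 / (real (Suc k))\<^sup>2) (- real (Suc k)) (a + 1 / real (Suc k)) x) \<le> 2 * pi" for k
        by (intro AE_I2) (simp only: real_norm_def A_bd)
      show "AE x in L. (\<lambda>k. ?A (1 / (real (Suc k))\<^sup>2) (- real (Suc k)) (a + 1 / real (Suc k)) x) \<longlonglongrightarrow> pi * indicator {..a} x"
        by (intro AE_I2 arctan_limit_indicator)
    qed auto
    also have "(LINT x|L. pi * indicator {..a} x) = pi * measure L {..a}" by simp
    finally show ?thesis .
  qed
  have "measure M {..a} = measure N {..a}" for a
  proof -
    \<comment> \<open>For negative a the endpoints may be in the wrong order for small k, and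
      \<open>eqA\<close> needs them ordered.\<close>
    have "\<forall>\<^sub>F k in sequentially. - real (Suc k) \<le> a + 1 / real (Suc k)"
    proof -
      obtain k0 :: nat where "- a \<le> real k0" using real_arch_simple by blast
      then have "- real (Suc k) \<le> a + 1 / real (Suc k)" if "k0 \<le> k" for k
        using that by (smt (verit) of_nat_le_iff of_nat_Suc zero_less_divide_1_iff of_nat_0_le_iff)
      then show ?thesis by (auto simp: eventually_sequentially)
    qed
    then have "\<forall>\<^sub>F k in sequentially.
       (LINT x|M. ?A (1 / (real (Suc k))\<^sup>2) (- real (Suc k)) (a + 1 / real (Suc k)) x) =
       (LINT x|N. ?A (1 / (real (Suc k))\<^sup>2) (- real (Suc k)) (a + 1 / real (Suc k)) x)"
      by eventually_elim (intro eqA, auto)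
    with lim[OF M, of a] have "(\<lambda>k. LINT x|N. ?A (1 / (real (Suc k))\<^sup>2) (- real (Suc k)) (a + 1 / real (Suc k)) x)
        \<longlonglongrightarrow> pi * measure M {..a}"
      by (rule Lim_transform_eventually)
    from LIMSEQ_unique[OF this lim[OF N]] show ?thesis by simp
  qed
  then have "cdf M = cdf N" by (simp add: cdf_def fun_eq_iff)
  then show ?thesis by (rule cdf_unique'[OF M N])
qed

section \<open>From one variable to two\<close>

text \<open>A function of one coordinate is absorbed into the measure as a density, and the result
  is viewed as a measure on the line in the other coordinate. This lets the one-variable inversion
  be applied to each coordinate in turn.\<close>

definition weighted_distr :: "'a measure \<Rightarrow> ('a \<Rightarrow> real) \<Rightarrow> ('a \<Rightarrow> real) \<Rightarrow> real measure" where
  "weighted_distr M g X = distr (density M (\<lambda>p. ennreal (g p))) borel X"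

lemma (in finite_measure) weighted_distr:
  assumes [measurable]: "g \<in> borel_measurable M" "X \<in> borel_measurable M"
    and g: "\<And>p. g p \<le> B"
  shows "finite_borel_measure (weighted_distr M g X)"
    and "f \<in> borel_measurable borel \<Longrightarrow>
      (\<integral>\<^sup>+x. f x \<partial>weighted_distr M g X) = (\<integral>\<^sup>+p. ennreal (g p) * f (X p) \<partial>M)"
proof -
  show nn: "(\<integral>\<^sup>+x. f x \<partial>weighted_distr M g X) = (\<integral>\<^sup>+p. ennreal (g p) * f (X p) \<partial>M)"
    if [measurable]: "f \<in> borel_measurable borel" for f
    unfolding weighted_distr_def by (subst nn_integral_distr; (subst nn_integral_density)?; measurable)
  have "emeasure (weighted_distr M g X) (space (weighted_distr M g X)) = (\<integral>\<^sup>+x. 1 \<partial>weighted_distr M g X)"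
    by simp
  also have "\<dots> = (\<integral>\<^sup>+p. ennreal (g p) \<partial>M)" by (subst nn) auto
  also have "\<dots> \<le> (\<integral>\<^sup>+p. ennreal B \<partial>M)" by (intro nn_integral_mono ennreal_leI g)
  also have "\<dots> < \<infinity>" by (simp add: ennreal_mult_less_top less_top[symmetric] ennreal_mult_eq_top_iff emeasure_finite)
  finally have "emeasure (weighted_distr M g X) (space (weighted_distr M g X)) \<noteq> \<infinity>" by simp
  then interpret F: finite_measure "weighted_distr M g X" by (rule finite_measureI)
  show "finite_borel_measure (weighted_distr M g X)"
    by standard (simp add: weighted_distr_def)
qed

text \<open>The Poisson kernel is the difference of the Cauchy kernels at two conjugate points
  divided by 2\<i>. A product of two such kernels thus involves the transform at all four sign
  combinations of the imaginary parts, and (2\<i>)^2 accounts for the factor -1/4.\<close>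

lemma cauchy_transform2_inject:
  assumes M: "borel_prob_measure M" and N: "borel_prob_measure N"
    and eq: "\<And>z w. Im z \<noteq> 0 \<Longrightarrow> Im w \<noteq> 0 \<Longrightarrow> cauchy_transform2 M z w = cauchy_transform2 N z w"
  shows "M = N"
proof -
  have sets: "sets L = sets (borel \<Otimes>\<^sub>M borel)" if "borel_prob_measure L" for L :: "(real \<times> real) measure"
    by (simp only: borel_prod borel_prob_measureD(2)[OF that])
  let ?P = "\<lambda>y a v b p. poisson_kernel y (fst p - a) * poisson_kernel v (snd p - b)"
  let ?k = "\<lambda>z w p. 1 / ((z - complex_of_real (fst p)) * (w - complex_of_real (snd p)))"
  let ?Q = "\<lambda>L y a v b. cauchy_transform2 L (Complex a (- y)) (Complex b (- v)) -
      cauchy_transform2 L (Complex a (- y)) (Complex b v) -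
      cauchy_transform2 L (Complex a y) (Complex b (- v)) + cauchy_transform2 L (Complex a y) (Complex b v)"
  have poisson: "complex_of_real (poisson_kernel y (s - a)) =
      (1 / (Complex a (- y) - of_real s) - 1 / (Complex a y - of_real s)) / (2 * \<i>)" if "0 < y" for y s a
  proof -
    have nz: "Complex a (- y) - of_real s \<noteq> 0" "Complex a y - of_real s \<noteq> 0"
      using that by (auto simp: complex_eq_iff)
    define q where "q = (s - a)\<^sup>2 + y\<^sup>2"
    have prod: "(Complex a (- y) - of_real s) * (Complex a y - of_real s) = of_real q"
      by (simp add: q_def complex_eq_iff power2_eq_square algebra_simps)
    have "1 / (Complex a (- y) - of_real s) - 1 / (Complex a y - of_real s) =
        (Complex a y - Complex a (- y)) / ((Complex a (- y) - of_real s) * (Complex a y - of_real s))"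
      using nz by (simp add: field_simps)
    also have "Complex a y - Complex a (- y) = 2 * \<i> * of_real y" by (simp add: complex_eq_iff)
    finally show ?thesis unfolding prod by (simp add: poisson_kernel_def q_def[symmetric])
  qed
  have P_int: "integrable L (?P y a v b)" and P_eq: "complex_of_real (LINT p|L. ?P y a v b p) = - (1 / 4) *
      ?Q L y a v b"
    if L: "borel_prob_measure L" and pos: "0 < y" "0 < v" for L y a v b
  proof -
    interpret prob_space L by (rule borel_prob_measureD[OF L])
    have [measurable_cong]: "sets L = sets (borel \<Otimes>\<^sub>M borel)" by (rule sets[OF L])
    have "?P y a v b p \<le> (1 / y) * (1 / v)" for p :: "real \<times> real"
      by (intro mult_mono poisson_kernel_le poisson_kernel_nonneg pos) (use pos in auto)
    then show "integrable L (?P y a v b)"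
      by (intro integrable_const_bound[where B = "(1 / y) * (1 / v)"])
         (auto simp: poisson_kernel_nonneg pos)
    have k: "integrable L (?k z w)" if "Im z \<noteq> 0" "Im w \<noteq> 0" for z w
      using integrable_cauchy_kernel2[OF L that] .
    have "complex_of_real (?P y a v b p) = - (1 / 4) *
        (?k (Complex a (- y)) (Complex b (- v)) p - ?k (Complex a (- y)) (Complex b v) p
         - ?k (Complex a y) (Complex b (- v)) p + ?k (Complex a y) (Complex b v) p)" for p
    proof -
      have alg: "(A - B) / (2 * \<i>) * ((C - D) / (2 * \<i>)) = - (1 / 4) * (A * C - A * D - B * C + B * D)"
        for A B C D :: complex
        by (simp add: field_simps)
      show ?thesis
        unfolding of_real_mult poisson[OF pos(1)] poisson[OF pos(2)] alg by simp
    qed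
    then have "(LINT p|L. complex_of_real (?P y a v b p)) = (LINT p|L. - (1 / 4) *
        (?k (Complex a (- y)) (Complex b (- v)) p - ?k (Complex a (- y)) (Complex b v) p
         - ?k (Complex a y) (Complex b (- v)) p + ?k (Complex a y) (Complex b v) p))"
      by simp
    also have "\<dots> = - (1 / 4) *
      ?Q L y a v b"
      unfolding cauchy_transform2_def using pos
      by (subst integral_mult_right_zero)
         (subst Bochner_Integration.integral_add Bochner_Integration.integral_diff;
          (intro Bochner_Integration.integrable_diff k)?; simp)+
    finally show "complex_of_real (LINT p|L. ?P y a v b p) = - (1 / 4) *
      ?Q L y a v b"
      unfolding integral_complex_of_real .
  qed
  have P: "(\<integral>\<^sup>+p. ennreal (?P y a v b p) \<partial>M) = (\<integral>\<^sup>+p. ennreal (?P y a v b p) \<partial>N)" if "0 < y" "0 < v" for y a v b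
  proof -
    have "complex_of_real (LINT p|M. ?P y a v b p) = complex_of_real (LINT p|N. ?P y a v b p)"
      unfolding P_eq[OF M that] P_eq[OF N that] using that by (simp add: eq)
    moreover have "(\<integral>\<^sup>+p. ennreal (?P y a v b p) \<partial>L) = ennreal (LINT p|L. ?P y a v b p)"
      if "borel_prob_measure L" for L
      by (rule nn_integral_eq_integral[OF P_int[OF that \<open>0 < y\<close> \<open>0 < v\<close>]])
         (simp add: poisson_kernel_nonneg \<open>0 < y\<close> \<open>0 < v\<close>)
    ultimately show ?thesis using M N by simp
  qed
  interpret M: prob_space M by (rule borel_prob_measureD[OF M])
  interpret N: prob_space N by (rule borel_prob_measureD[OF N])
  note [measurable_cong] = sets[OF M] sets[OF N]
  \<comment> \<open>With the kernel in the second coordinate frozen as a density, inversion in the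
    first coordinate replaces its kernel by an indicator; \<open>step2\<close> then does the same
    with the roles exchanged.\<close>
  have step1: "(\<integral>\<^sup>+p. ennreal (poisson_kernel v (snd p - b)) * indicator A (fst p) \<partial>M) =
      (\<integral>\<^sup>+p. ennreal (poisson_kernel v (snd p - b)) * indicator A (fst p) \<partial>N)"
    if v: "0 < v" and [measurable]: "A \<in> sets borel" for v b A
  proof -
    let ?g = "\<lambda>p::real \<times> real. poisson_kernel v (snd p - b)"
    have wM: "finite_borel_measure (weighted_distr M ?g fst)"
      "f \<in> borel_measurable borel \<Longrightarrow>
        (\<integral>\<^sup>+x. f x \<partial>weighted_distr M ?g fst) = (\<integral>\<^sup>+p. ennreal (?g p) * f (fst p) \<partial>M)" for f
      by (rule M.weighted_distr[where B = "1 / v"]; simp add: poisson_kernel_le v)+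
    have wN: "finite_borel_measure (weighted_distr N ?g fst)"
      "f \<in> borel_measurable borel \<Longrightarrow>
        (\<integral>\<^sup>+x. f x \<partial>weighted_distr N ?g fst) = (\<integral>\<^sup>+p. ennreal (?g p) * f (fst p) \<partial>N)" for f
      by (rule N.weighted_distr[where B = "1 / v"]; simp add: poisson_kernel_le v)+
    have "weighted_distr M ?g fst = weighted_distr N ?g fst"
    proof (rule poisson_integral_inject[OF wM(1) wN(1)])
      fix a y :: real assume y: "0 < y"
      have "ennreal (?g p) * ennreal (poisson_kernel y (fst p - a)) = ennreal (?P y a v b p)" for p
        using v y by (simp add: ennreal_mult'[symmetric] poisson_kernel_nonneg mult.commute)
      then show "(\<integral>\<^sup>+x. ennreal (poisson_kernel y (x - a)) \<partial>weighted_distr M ?g fst) =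
          (\<integral>\<^sup>+x. ennreal (poisson_kernel y (x - a)) \<partial>weighted_distr N ?g fst)"
        using P[OF y v, of a b] by (simp add: wM(2) wN(2))
    qed
    then have "(\<integral>\<^sup>+x. indicator A x \<partial>weighted_distr M ?g fst) = (\<integral>\<^sup>+x. indicator A x \<partial>weighted_distr N ?g fst)"
      by (rule arg_cong)
    then show ?thesis
      unfolding wM(2)[OF borel_measurable_indicator[OF that(2)]] wN(2)[OF borel_measurable_indicator[OF that(2)]] .
  qed
  have step2: "emeasure M (A \<times> B) = emeasure N (A \<times> B)"
    if [measurable]: "A \<in> sets borel" "B \<in> sets borel" for A B
  proof -
    let ?g = "\<lambda>p::real \<times> real. indicator A (fst p) :: real"
    have ind: "ennreal (indicator A x) = indicator A x" for x by (simp add: indicator_def)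
    have le1: "?g p \<le> 1" for p by (simp add: indicator_def)
    have wM: "finite_borel_measure (weighted_distr M ?g snd)"
      "f \<in> borel_measurable borel \<Longrightarrow>
        (\<integral>\<^sup>+x. f x \<partial>weighted_distr M ?g snd) = (\<integral>\<^sup>+p. ennreal (?g p) * f (snd p) \<partial>M)" for f
      by (rule M.weighted_distr[where B = 1]; simp add: le1)+
    have wN: "finite_borel_measure (weighted_distr N ?g snd)"
      "f \<in> borel_measurable borel \<Longrightarrow>
        (\<integral>\<^sup>+x. f x \<partial>weighted_distr N ?g snd) = (\<integral>\<^sup>+p. ennreal (?g p) * f (snd p) \<partial>N)" for f
      by (rule N.weighted_distr[where B = 1]; simp add: le1)+
    have "weighted_distr M ?g snd = weighted_distr N ?g snd"
    proof (rule poisson_integral_inject[OF wM(1) wN(1)])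
      fix b v :: real assume v: "0 < v"
      show "(\<integral>\<^sup>+x. ennreal (poisson_kernel v (x - b)) \<partial>weighted_distr M ?g snd) =
          (\<integral>\<^sup>+x. ennreal (poisson_kernel v (x - b)) \<partial>weighted_distr N ?g snd)"
        using step1[OF v, of A b] by (simp add: wM(2) wN(2) ind mult.commute)
    qed
    then have "(\<integral>\<^sup>+x. indicator B x \<partial>weighted_distr M ?g snd) = (\<integral>\<^sup>+x. indicator B x \<partial>weighted_distr N ?g snd)"
      by (rule arg_cong)
    moreover have "ennreal (?g p) * indicator B (snd p) = indicator (A \<times> B) p" for p
      by (simp add: indicator_def mem_Times_iff)
    ultimately have "(\<integral>\<^sup>+p. indicator (A \<times> B) p \<partial>M) = (\<integral>\<^sup>+p. indicator (A \<times> B) p \<partial>N)"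
      by (simp add: wM(2) wN(2))
    then show ?thesis by simp
  qed
  let ?E = "{A \<times> B | A B. A \<in> sets (borel :: real measure) \<and> B \<in> sets (borel :: real measure)}"
  show ?thesis
  proof (rule measure_eqI_generator_eq[where \<Omega> = UNIV and A = "\<lambda>_. UNIV" and
        E = "?E"])
    show "Int_stable ?E"
      by (rule Int_stable_pair_measure_generator)
    show "sets M = sigma_sets UNIV ?E"
      "sets N = sigma_sets UNIV ?E"
      unfolding sets[OF M] sets[OF N] sets_pair_measure by simp_all
    show "range (\<lambda>_. UNIV) \<subseteq> ?E"
      by (auto intro!: exI[of _ UNIV])
  qed (use step2 in auto)
qed

subsection \<open>The bi-free R-transform determines the measure\<close>

text \<open>\<open>R_inverse m\<close> is non-constant on each component, being undone by the Cauchy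
  transform. Its image there is open in a half-plane, so equality on the image spreads to the entire
  half-plane.\<close>

lemma R_inverse_continuation:
  assumes m: "borel_prob_measure m" and pos: "0 < \<alpha>" "0 < \<beta>" and def: "R_transform_defined \<alpha> \<beta> m"
    and f: "f holomorphic_on {\<zeta>. Im \<zeta> \<noteq> 0}" and g: "g holomorphic_on {\<zeta>. Im \<zeta> \<noteq> 0}"
    and eq: "\<And>z. z \<in> double_stolz \<alpha> \<beta> \<Longrightarrow> f (R_inverse m z) = g (R_inverse m z)"
    and \<zeta>: "Im \<zeta> \<noteq> 0"
  shows "f \<zeta> = g \<zeta>"
proof -
  \<comment> \<open>The sign is opposite to that of Im \<zeta>, because \<open>R_inverse m\<close>
    exchanges the half-planes.\<close>
  define \<sigma> :: real where "\<sigma> = (if Im \<zeta> < 0 then 1 else - 1)"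
  have \<sigma>: "\<sigma> \<in> {1, -1}" "\<sigma> * Im \<zeta> < 0" using \<zeta> by (auto simp: \<sigma>_def)
  let ?S = "half_stolz \<sigma> \<alpha> \<beta>" and ?H = "{\<eta>. \<sigma> * Im \<eta> < 0}"
  have sub: "?S \<subseteq> double_stolz \<alpha> \<beta>" by (auto simp: half_stolz_def)
  have points: "\<i> * of_real (\<sigma> * (\<beta> / 2)) \<in> ?S" "\<i> * of_real (\<sigma> * (\<beta> / 3)) \<in> ?S"
    using \<sigma> pos by (auto simp: half_stolz_def mem_double_stolz abs_mult)
  have hol: "R_inverse m holomorphic_on ?S"
    by (rule holomorphic_on_subset[OF holomorphic_R_inverse[OF m pos def] sub])
  have G: "cauchy_transform m (R_inverse m z) = z" if "z \<in> ?S" for z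
    using R_inverse_props(2)[OF m pos def] that sub by blast
  have "\<not> R_inverse m constant_on ?S"
  proof
    assume "R_inverse m constant_on ?S"
    then obtain c where "\<And>z. z \<in> ?S \<Longrightarrow> R_inverse m z = c" by (auto simp: constant_on_def)
    with G points have "\<i> * of_real (\<sigma> * (\<beta> / 2)) = \<i> * of_real (\<sigma> * (\<beta> / 3))" by metis
    then have "\<sigma> * (\<beta> / 2) = \<sigma> * (\<beta> / 3)" by (simp only: mult_cancel_left of_real_eq_iff) simp
    then show False using pos \<sigma> by auto
  qed
  then have op: "open (R_inverse m ` ?S)"
    using open_mapping_thm[OF hol open_half_stolz connected_half_stolz[OF \<sigma>(1)] open_half_stolz] by auto
  have im: "R_inverse m ` ?S \<subseteq> ?H"
  proof clarify
    fix z assume z: "z \<in> ?S"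
    have "Im z * Im (R_inverse m z) < 0" using R_inverse_props(3)[OF m pos def] z sub by blast
    moreover have "0 < \<sigma> * Im z" using z by (auto simp: half_stolz_def)
    ultimately show "\<sigma> * Im (R_inverse m z) < 0" using \<sigma>(1) by (auto simp: mult_less_0_iff)
  qed
  have H: "open ?H" "connected ?H"
  proof -
    show "open ?H" by (intro open_Collect_less continuous_intros)
    have "?H = (\<lambda>\<eta>. \<sigma> * Im \<eta>) -` {..<0}" by auto
    moreover have "linear (\<lambda>\<eta>. \<sigma> * Im \<eta>)" by (auto intro!: linearI simp: algebra_simps)
    ultimately show "connected ?H" by (simp add: convex_connected convex_linear_vimage)
  qed
  show ?thesis
  proof (rule analytic_continuation_open[where s = "R_inverse m ` ?S" and s' = ?H and f = f and g = g])
    show "R_inverse m ` ?S \<noteq> {}" using points by auto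
    show "f holomorphic_on ?H" "g holomorphic_on ?H"
      using f g by (auto elim!: holomorphic_on_subset)
    show "f \<eta> = g \<eta>" if "\<eta> \<in> R_inverse m ` ?S" for \<eta> using that eq sub by auto
  qed (use op H im \<sigma> in auto)
qed

lemma holomorphic_cauchy_transform2:
  assumes M: "borel_prob_measure M"
  shows "Im b \<noteq> 0 \<Longrightarrow> (\<lambda>a. cauchy_transform2 M a b) holomorphic_on {\<zeta>. Im \<zeta> \<noteq> 0}"
    and "Im a \<noteq> 0 \<Longrightarrow> (\<lambda>b. cauchy_transform2 M a b) holomorphic_on {\<zeta>. Im \<zeta> \<noteq> 0}"
proof -
  interpret prob_space M by (rule borel_prob_measureD[OF M])
  have [measurable_cong]: "sets M = sets (borel \<Otimes>\<^sub>M borel)"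
    by (simp only: borel_prod borel_prob_measureD(2)[OF M])
  show "(\<lambda>a. cauchy_transform2 M a b) holomorphic_on {\<zeta>. Im \<zeta> \<noteq> 0}" if "Im b \<noteq> 0"
    using holomorphic_cauchy_integral[of fst "\<lambda>p. 1 / (b - of_real (snd p))", OF _ _ norm_cauchy_kernel_le[OF that]]
    by (simp add: cauchy_transform2_def mult.commute)
  show "(\<lambda>b. cauchy_transform2 M a b) holomorphic_on {\<zeta>. Im \<zeta> \<noteq> 0}" if "Im a \<noteq> 0"
    using holomorphic_cauchy_integral[of snd "\<lambda>p. 1 / (a - of_real (fst p))", OF _ _ norm_cauchy_kernel_le[OF that]]
    by (simp add: cauchy_transform2_def)
qed

lemma at_0_within_double_stolz:
  assumes "0 < \<alpha>" "0 < \<beta>"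
  shows "filterlim (\<lambda>v. - \<i> * complex_of_real v) (at 0 within double_stolz \<alpha> \<beta>) (at_right 0)"
    "at 0 within double_stolz \<alpha> \<beta> \<noteq> bot"
proof -
  show lim: "filterlim (\<lambda>v. - \<i> * complex_of_real v) (at 0 within double_stolz \<alpha> \<beta>) (at_right 0)"
    unfolding filterlim_at
  proof
    show "\<forall>\<^sub>F v in at_right 0. - \<i> * complex_of_real v \<in> double_stolz \<alpha> \<beta> \<and> - \<i> * complex_of_real v \<noteq> 0"
      using imaginary_mem_double_stolz[OF assms(1)] assms(2)
      unfolding eventually_at_right_field by (intro exI[of _ \<beta>]) auto
    have "((\<lambda>v. - \<i> * complex_of_real v) \<longlongrightarrow> - \<i> * complex_of_real 0) (at_right 0)"
      by (intro tendsto_intros)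
    then show "((\<lambda>v. - \<i> * complex_of_real v) \<longlongrightarrow> 0) (at_right 0)" by simp
  qed
  show "at 0 within double_stolz \<alpha> \<beta> \<noteq> bot"
  proof
    assume "at 0 within double_stolz \<alpha> \<beta> = bot"
    with lim have "\<forall>P. \<forall>\<^sub>F v in at_right 0. P (- \<i> * complex_of_real v)"
      by (simp only: filterlim_iff eventually_bot simp_thms)
    then have "\<forall>\<^sub>F v in at_right (0::real). False" by (rule spec[where x = "\<lambda>_. False"])
    then show False by (simp add: eventually_False)
  qed
qed

lemma bifree_R_eq_imp_marginal1_eq:
  assumes M: "borel_prob_measure M" and N: "borel_prob_measure N" and pos: "0 < \<alpha>" "0 < \<beta>"
    and defM: "bifree_R_defined \<alpha> \<beta> M" and defN: "bifree_R_defined \<alpha> \<beta> N"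
    and eq: "\<And>z w. z \<in> double_stolz \<alpha> \<beta> \<Longrightarrow> w \<in> double_stolz \<alpha> \<beta> \<Longrightarrow> bifree_R M z w = bifree_R N z w"
    and z: "z \<in> double_stolz \<alpha> \<beta>"
  shows "R_transform (marginal1 M) z = R_transform (marginal1 N) z"
proof -
  have "(bifree_R N z \<longlongrightarrow> z * R_transform (marginal1 M) z) (at 0 within double_stolz \<alpha> \<beta>)"
    by (rule Lim_transform_eventually[OF bifree_R_tendsto_marginal[OF M pos defM z]])
       (use eq z in \<open>auto simp: eventually_at_filter\<close>)
  from tendsto_unique[OF at_0_within_double_stolz(2)[OF pos] this bifree_R_tendsto_marginal[OF N pos defN z]]
  show ?thesis using z by (auto simp: mem_double_stolz)
qed

lemma bifree_R_inject:
  assumes M: "borel_prob_measure M" and N: "borel_prob_measure N" and pos: "0 < \<alpha>" "0 < \<beta>"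
    and defM: "bifree_R_defined \<alpha> \<beta> M" and defN: "bifree_R_defined \<alpha> \<beta> N"
    and eq: "\<And>z w. z \<in> double_stolz \<alpha> \<beta> \<Longrightarrow> w \<in> double_stolz \<alpha> \<beta> \<Longrightarrow> bifree_R M z w = bifree_R N z w"
  shows "M = N"
proof (rule cauchy_transform2_inject[OF M N])
  let ?D = "double_stolz \<alpha> \<beta>"
  note M1 = borel_prob_marginal(1)[OF M] and M2 = borel_prob_marginal(2)[OF M]
  have d: "R_transform_defined \<alpha> \<beta> (marginal1 M)" "R_transform_defined \<alpha> \<beta> (marginal2 M)"
    and hM: "\<And>z w. z \<in> ?D \<Longrightarrow> w \<in> ?D \<Longrightarrow> bifree_h M z w \<noteq> 0"
    using defM by (auto simp: bifree_R_defined_def)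
  have hN: "\<And>z w. z \<in> ?D \<Longrightarrow> w \<in> ?D \<Longrightarrow> bifree_h N z w \<noteq> 0"
    using defN by (auto simp: bifree_R_defined_def)
  have R1: "R_transform (marginal1 M) z = R_transform (marginal1 N) z" if "z \<in> ?D" for z
    by (rule bifree_R_eq_imp_marginal1_eq[OF M N pos defM defN eq that])
  have R2: "R_transform (marginal2 M) z = R_transform (marginal2 N) z" if "z \<in> ?D" for z
    using bifree_R_eq_imp_marginal1_eq[OF borel_prob_swap[OF M] borel_prob_swap[OF N] pos _ _ _ that]
      defM defN eq
    by (simp add: bifree_swap[OF M] bifree_swap[OF N] swap_measure_props[OF M] swap_measure_props[OF N])
  let ?F1 = "R_inverse (marginal1 M)" and ?F2 = "R_inverse (marginal2 M)"
  have base: "cauchy_transform2 M (?F1 z) (?F2 w) = cauchy_transform2 N (?F1 z) (?F2 w)" if zw: "z \<in> ?D" "w \<in> ?D" for z w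
  proof -
    have "1 / bifree_h M z w = 1 / bifree_h N z w"
      using eq[OF zw] R1[OF zw(1)] R2[OF zw(2)] by (simp add: bifree_R_def)
    then have "bifree_h M z w = bifree_h N z w" using hM[OF zw] hN[OF zw] by simp
    then show ?thesis
      using R1[OF zw(1)] R2[OF zw(2)] zw by (auto simp: bifree_h_eq R_inverse_def mem_double_stolz)
  qed
  fix a b assume im: "Im a \<noteq> 0" "Im b \<noteq> 0"
  \<comment> \<open>Continuation is done one variable at a time: first in a, with the second
    argument still a value of \<open>?F2\<close>, and only then in b, for arbitrary non-real
    a.\<close>
  have "cauchy_transform2 M a (?F2 w) = cauchy_transform2 N a (?F2 w)" if w: "w \<in> ?D" for w
  proof (rule R_inverse_continuation[OF M1 pos d(1), where f = "\<lambda>a. cauchy_transform2 M a (?F2 w)"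
        and g = "\<lambda>a. cauchy_transform2 N a (?F2 w)"])
    note im2 = R_inverse_props(1)[OF M2 pos d(2) w]
    show "(\<lambda>a. cauchy_transform2 M a (?F2 w)) holomorphic_on {\<zeta>. Im \<zeta> \<noteq> 0}"
      "(\<lambda>a. cauchy_transform2 N a (?F2 w)) holomorphic_on {\<zeta>. Im \<zeta> \<noteq> 0}"
      by (rule holomorphic_cauchy_transform2(1)[OF M im2] holomorphic_cauchy_transform2(1)[OF N im2])+
  qed (use base w im in auto)
  then show "cauchy_transform2 M a b = cauchy_transform2 N a b"
    by (rule R_inverse_continuation[OF M2 pos d(2), where f = "cauchy_transform2 M a" and g = "cauchy_transform2 N a",
          OF holomorphic_cauchy_transform2(2)[OF M im(1)] holomorphic_cauchy_transform2(2)[OF N im(1)] _ im(2)])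
qed

subsection \<open>Tightness from the behaviour at the origin\<close>

text \<open>At z = -\<i>y the equation z \<zeta> = 1 + u gives |Re \<zeta>| \<le> 1/y and Im \<zeta>
  \<le> 2/y, so |x| \<ge> 3/y puts x at horizontal distance at least Im \<zeta> from \<zeta>. There
  (Im \<zeta>)^2/|\<zeta> - x|^2 is at most 1/2, whereas its integral is y Im \<zeta> \<ge> 1 - e.
  Half of the tail mass is therefore at most e.\<close>

lemma tail_le_R_transform:
  assumes m: "borel_prob_measure m" and pos: "0 < \<alpha>" "0 < \<beta>" and def: "R_transform_defined \<alpha> \<beta> m"
    and y: "0 < y" "y < \<beta>" and e: "norm (- \<i> * complex_of_real y * R_transform m (- \<i> * complex_of_real y)) \<le> e" "e \<le> 1"
  shows "measure m {x. 3 / y \<le> \<bar>x\<bar>} \<le> 2 * e"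
proof -
  interpret prob_space m by (rule borel_prob_measureD[OF m])
  have [measurable_cong]: "sets m = sets borel" by (rule borel_prob_measureD(2)[OF m])
  define z where "z = - \<i> * complex_of_real y"
  define u where "u = z * R_transform m z"
  define \<zeta> where "\<zeta> = R_inverse m z"
  have z: "z \<in> double_stolz \<alpha> \<beta>" unfolding z_def by (rule imaginary_mem_double_stolz[OF pos(1) y])
  note F = R_inverse_props[OF m pos def z, folded \<zeta>_def u_def]
  have "z * \<zeta> = 1 + u" by (rule F(4))
  then have "y * Im \<zeta> = 1 + Re u" "- (y * Re \<zeta>) = Im u"
    by (auto simp: complex_eq_iff z_def)
  moreover have "\<bar>Re u\<bar> \<le> e" "\<bar>Im u\<bar> \<le> e"
    using e(1) abs_Re_le_cmod[of u] abs_Im_le_cmod[of u] by (auto simp: u_def z_def)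
  ultimately have q: "1 - e \<le> y * Im \<zeta>" "y * Im \<zeta> \<le> 2" and p: "y * \<bar>Re \<zeta>\<bar> \<le> 1"
    using e(2) y(1) by (auto simp: abs_if split: if_splits)
  have "0 < y * Im \<zeta>" using F(3) by (simp add: z_def)
  then have im: "0 < Im \<zeta>" using y(1) by (rule zero_less_mult_pos)
  let ?k = "\<lambda>x. (Im \<zeta>)\<^sup>2 * (1 / (norm (\<zeta> - of_real x))\<^sup>2)"
  have "- y = - Im \<zeta> * (LINT x|m. 1 / (norm (\<zeta> - of_real x))\<^sup>2)"
    using Im_cauchy_transform(1)[OF m F(1)] F(2) by (simp add: z_def)
  moreover have "(LINT x|m. ?k x) = (Im \<zeta>)\<^sup>2 * (LINT x|m. 1 / (norm (\<zeta> - of_real x))\<^sup>2)"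
    by (rule integral_mult_right_zero)
  ultimately have int: "(LINT x|m. ?k x) = y * Im \<zeta>"
    by (simp only: power2_eq_square mult_minus_left neg_equal_iff_equal) (simp only: ac_simps)
  have ki: "integrable m ?k" by (intro integrable_mult_right Im_cauchy_transform(2)[OF m F(1)])
  have pw: "1 / 2 * indicator {x. 3 / y \<le> \<bar>x\<bar>} x \<le> 1 - ?k x" for x
  proof -
    have n2: "(norm (\<zeta> - of_real x))\<^sup>2 = (Re \<zeta> - x)\<^sup>2 + (Im \<zeta>)\<^sup>2" by (simp add: cmod_power2)
    have pos2: "0 < (Re \<zeta> - x)\<^sup>2 + (Im \<zeta>)\<^sup>2" using im by (simp add: add_nonneg_pos)
    show ?thesis
    proof (cases "3 / y \<le> \<bar>x\<bar>")
      case True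
      then have "3 \<le> y * \<bar>x\<bar>" using y(1) by (simp add: field_simps)
      then have "y * Im \<zeta> \<le> y * \<bar>x\<bar> - y * \<bar>Re \<zeta>\<bar>" using p q by linarith
      also have "\<dots> = y * (\<bar>x\<bar> - \<bar>Re \<zeta>\<bar>)" by (simp add: right_diff_distrib)
      finally have "Im \<zeta> \<le> \<bar>x\<bar> - \<bar>Re \<zeta>\<bar>" using y(1) by simp
      then have "Im \<zeta> \<le> \<bar>Re \<zeta> - x\<bar>" by linarith
      then have "(Im \<zeta>)\<^sup>2 \<le> (Re \<zeta> - x)\<^sup>2" using im abs_le_square_iff[of "Im \<zeta>" "Re \<zeta> - x"] by simp
      then show ?thesis using True pos2 unfolding n2 by (simp add: field_simps)
    next
      case False
      then show ?thesis using pos2 unfolding n2 by (simp add: field_simps)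
    qed
  qed
  have set: "{x. 3 / y \<le> \<bar>x\<bar>} \<in> sets m" by measurable
  have "(LINT x|m. 1 / 2 * indicator {x. 3 / y \<le> \<bar>x\<bar>} x) \<le> (LINT x|m. 1 - ?k x)"
  proof (rule integral_mono[OF _ _ pw])
    show "integrable m (\<lambda>x. 1 / 2 * indicator {x. 3 / y \<le> \<bar>x\<bar>} x :: real)"
      using set by (intro integrable_mult_right integrable_const_bound[where B = 1]) auto
  qed (use ki in auto)
  also have "\<dots> = 1 - y * Im \<zeta>" using ki int prob_space by simp
  also have "\<dots> \<le> e" using q by simp
  finally show ?thesis using set by simp
qed

lemma R_transform_le_bifree_R:
  assumes M: "borel_prob_measure M" and pos: "0 < \<alpha>" "0 < \<beta>" and def: "bifree_R_defined \<alpha> \<beta> M"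
    and z: "z \<in> double_stolz \<alpha> \<beta>" and d: "0 < d"
    and bd: "\<And>v. 0 < v \<Longrightarrow> v < d \<Longrightarrow> norm (bifree_R M z (- \<i> * complex_of_real v)) \<le> e"
  shows "norm (z * R_transform (marginal1 M) z) \<le> e"
proof (rule tendsto_upperbound)
  show "((\<lambda>v. norm (bifree_R M z (- \<i> * complex_of_real v))) \<longlongrightarrow> norm (z * R_transform (marginal1 M) z)) (at_right 0)"
    by (intro tendsto_norm filterlim_compose[OF bifree_R_tendsto_marginal[OF M pos def z] at_0_within_double_stolz(1)[OF pos]])
  show "\<forall>\<^sub>F v in at_right 0. norm (bifree_R M z (- \<i> * complex_of_real v)) \<le> e"
    unfolding eventually_at_right_field using d bd by blast
qed simp

lemma bifree_R_uniform_imp_tight: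
  fixes \<mu> :: "nat \<Rightarrow> (real \<times> real) measure"
  assumes \<mu>: "\<And>n. borel_prob_measure (\<mu> n)" and pos: "0 < \<alpha>" "0 < \<beta>"
    and def: "\<And>n. bifree_R_defined \<alpha> \<beta> (\<mu> n)"
    and unif: "uniform_limit UNIV
          (\<lambda>(y, v) n. bifree_R (\<mu> n) (- \<i> * complex_of_real y) (- \<i> * complex_of_real v))
          (\<lambda>n. 0) (at_right 0 \<times>\<^sub>F at_right 0)"
    and e: "0 < e"
  shows "\<exists>B. \<forall>n. measure (\<mu> n) {p. B < norm p} \<le> e"
proof -
  \<comment> \<open>Each marginal contributes a tail of mass 2e', and
    \<open>tail_le_R_transform\<close> asks for e' \<le> 1.\<close>
  define e' where "e' = min 1 (e / 4)"
  have e': "0 < e'" "e' \<le> 1" "4 * e' \<le> e" using e by (auto simp: e'_def)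
  obtain P Q where PQ: "eventually P (at_right (0::real))" "eventually Q (at_right (0::real))"
    and bd: "\<And>y v n. P y \<Longrightarrow> Q v \<Longrightarrow> norm (bifree_R (\<mu> n) (- \<i> * complex_of_real y) (- \<i> * complex_of_real v)) < e'"
    using uniform_limitD[OF unif e'(1)] unfolding eventually_prod_filter by auto
  obtain d1 where d1: "0 < d1" "\<And>y. 0 < y \<Longrightarrow> y < d1 \<Longrightarrow> P y" using PQ(1) by (auto simp: eventually_at_right_field)
  obtain d2 where d2: "0 < d2" "\<And>y. 0 < y \<Longrightarrow> y < d2 \<Longrightarrow> Q y" using PQ(2) by (auto simp: eventually_at_right_field)
  define y where "y = min (min d1 d2) \<beta> / 2"
  have y: "0 < y" "y < d1" "y < d2" "y < \<beta>" using d1(1) d2(1) pos by (auto simp: y_def)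
  let ?z = "- \<i> * complex_of_real y"
  have z: "?z \<in> double_stolz \<alpha> \<beta>" by (rule imaginary_mem_double_stolz[OF pos(1) y(1,4)])
  have R1: "norm (?z * R_transform (marginal1 (\<mu> n)) ?z) \<le> e'" for n
    by (rule R_transform_le_bifree_R[OF \<mu> pos def z d2(1)]) (use bd d1 d2 y in \<open>auto intro: less_imp_le\<close>)
  have R2: "norm (?z * R_transform (marginal2 (\<mu> n)) ?z) \<le> e'" for n
  proof -
    have "norm (?z * R_transform (marginal1 (swap_measure (\<mu> n))) ?z) \<le> e'"
      by (rule R_transform_le_bifree_R[OF borel_prob_swap[OF \<mu>] pos _ z d1(1)])
         (use bd d1 d2 y def in \<open>auto simp: bifree_swap[OF \<mu>] intro: less_imp_le\<close>)
    then show ?thesis by (simp only: swap_measure_props[OF \<mu>])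
  qed
  \<comment> \<open>The norm of a pair is at most the sum of the absolute values, so beyond 6/y one
    coordinate is beyond 3/y. The same y serves every n, by uniformity in n.\<close>
  have "measure (\<mu> n) {p. 6 / y < norm p} \<le> e" for n
  proof -
    interpret prob_space "\<mu> n" by (rule borel_prob_measureD[OF \<mu>])
    have d: "R_transform_defined \<alpha> \<beta> (marginal1 (\<mu> n))" "R_transform_defined \<alpha> \<beta> (marginal2 (\<mu> n))"
      using def by (auto simp: bifree_R_defined_def)
    have [measurable_cong]: "sets (\<mu> n) = sets (borel \<Otimes>\<^sub>M borel)"
      by (simp only: borel_prod borel_prob_measureD(2)[OF \<mu>])
    have sp: "space (\<mu> n) = UNIV" by (rule borel_prob_measureD(3)[OF \<mu>])
    have t1: "measure (\<mu> n) {p. 3 / y \<le> \<bar>fst p\<bar>} \<le> 2 * e'"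
    proof -
      have "measure (marginal1 (\<mu> n)) {x. 3 / y \<le> \<bar>x\<bar>} = measure (\<mu> n) {p. 3 / y \<le> \<bar>fst p\<bar>}"
        unfolding marginal1_def by (subst measure_distr) (auto simp: sp vimage_def)
      then show ?thesis
        using tail_le_R_transform[OF borel_prob_marginal(1)[OF \<mu>] pos d(1) y(1,4) R1 e'(2)] by simp
    qed
    have t2: "measure (\<mu> n) {p. 3 / y \<le> \<bar>snd p\<bar>} \<le> 2 * e'"
    proof -
      have "measure (marginal2 (\<mu> n)) {x. 3 / y \<le> \<bar>x\<bar>} = measure (\<mu> n) {p. 3 / y \<le> \<bar>snd p\<bar>}"
        unfolding marginal2_def by (subst measure_distr) (auto simp: sp vimage_def)
      then show ?thesis
        using tail_le_R_transform[OF borel_prob_marginal(2)[OF \<mu>] pos d(2) y(1,4) R2 e'(2)] by simp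
    qed
    have sets: "{p. 3 / y \<le> \<bar>fst p\<bar>} \<in> sets (\<mu> n)" "{p. 3 / y \<le> \<bar>snd p\<bar>} \<in> sets (\<mu> n)"
      unfolding borel_prob_measureD(2)[OF \<mu>]
      by (auto intro!: borel_closed closed_Collect_le continuous_intros)
    have "{p :: real \<times> real. 6 / y < norm p} \<subseteq> {p. 3 / y \<le> \<bar>fst p\<bar>} \<union> {p. 3 / y \<le> \<bar>snd p\<bar>}"
    proof
      fix p :: "real \<times> real" assume "p \<in> {p. 6 / y < norm p}"
      then have "6 / y < \<bar>fst p\<bar> + \<bar>snd p\<bar>"
        using norm_Pair_le[of "fst p" "snd p"] by simp
      then have "3 / y + 3 / y < \<bar>fst p\<bar> + \<bar>snd p\<bar>" by (simp add: add_divide_distrib[symmetric])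
      then show "p \<in> {p. 3 / y \<le> \<bar>fst p\<bar>} \<union> {p. 3 / y \<le> \<bar>snd p\<bar>}" by auto
    qed
    then have "measure (\<mu> n) {p. 6 / y < norm p} \<le> measure (\<mu> n) ({p. 3 / y \<le> \<bar>fst p\<bar>} \<union> {p. 3 / y \<le> \<bar>snd p\<bar>})"
      using sets by (intro finite_measure_mono) auto
    also have "\<dots> \<le> measure (\<mu> n) {p. 3 / y \<le> \<bar>fst p\<bar>} + measure (\<mu> n) {p. 3 / y \<le> \<bar>snd p\<bar>}"
      using sets by (rule measure_Un_le)
    finally show ?thesis using t1 t2 e'(3) by linarith
  qed
  then show ?thesis by blast
qed

lemma bifree_R_imp_weakly_converges:
  fixes \<mu> :: "nat \<Rightarrow> (real \<times> real) measure"
  assumes \<mu>: "\<And>n. borel_prob_measure (\<mu> n)" and pos: "0 < \<alpha>" "0 < \<beta>"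
    and def: "\<And>n. bifree_R_defined \<alpha> \<beta> (\<mu> n)"
    and lim: "\<And>z w. z \<in> double_stolz \<alpha> \<beta> \<Longrightarrow> w \<in> double_stolz \<alpha> \<beta> \<Longrightarrow> (\<lambda>n. bifree_R (\<mu> n) z w) \<longlonglongrightarrow> R z w"
    and unif: "uniform_limit UNIV
          (\<lambda>(y, v) n. bifree_R (\<mu> n) (- \<i> * complex_of_real y) (- \<i> * complex_of_real v))
          (\<lambda>n. 0) (at_right 0 \<times>\<^sub>F at_right 0)"
  shows "\<exists>\<nu>. borel_prob_measure \<nu> \<and> weakly_converges \<mu> \<nu>"
proof -
  have sub: "\<exists>r \<nu>. strict_mono (r :: nat \<Rightarrow> nat) \<and> borel_prob_measure \<nu> \<and> weakly_converges (\<lambda>n. \<mu> (s (r n))) \<nu> \<and>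
      bifree_R_defined \<alpha> \<beta> \<nu> \<and> (\<forall>z\<in>double_stolz \<alpha> \<beta>. \<forall>w\<in>double_stolz \<alpha> \<beta>. bifree_R \<nu> z w = R z w)"
    if s: "strict_mono (s :: nat \<Rightarrow> nat)" for s
  proof -
    have "\<exists>B. \<forall>n. measure (\<mu> (s n)) {p. B < norm p} \<le> e" if "0 < e" for e
      using bifree_R_uniform_imp_tight[OF \<mu> pos def unif that] by auto
    then obtain r \<nu> where r: "strict_mono (r :: nat \<Rightarrow> nat)" and \<nu>: "borel_prob_measure \<nu>"
      and wc: "weakly_converges (\<lambda>n. \<mu> (s (r n))) \<nu>"
      using tight_imp_weakly_convergent_subseq[of "\<lambda>n. \<mu> (s n)", OF \<mu>] by metis
    have lim': "(\<lambda>n. bifree_R (\<mu> (s (r n))) z w) \<longlonglongrightarrow> R z w"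
      if "z \<in> double_stolz \<alpha> \<beta>" "w \<in> double_stolz \<alpha> \<beta>" for z w
      using LIMSEQ_subseq_LIMSEQ[OF lim[OF that] strict_mono_o[OF s r]] by (simp add: o_def)
    note L = bifree_R_limit[OF \<mu> \<nu> wc pos def lim']
    show ?thesis using r \<nu> wc L by metis
  qed
  obtain \<nu> where \<nu>: "borel_prob_measure \<nu>" "bifree_R_defined \<alpha> \<beta> \<nu>"
    "\<And>z w. z \<in> double_stolz \<alpha> \<beta> \<Longrightarrow> w \<in> double_stolz \<alpha> \<beta> \<Longrightarrow> bifree_R \<nu> z w = R z w"
    using sub[of "\<lambda>n. n"] by (auto simp: strict_mono_def)
  have "(\<lambda>n. integral\<^sup>L (\<mu> n) f) \<longlonglongrightarrow> integral\<^sup>L \<nu> f"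
    if f: "continuous_on UNIV f" "bounded (range f)" for f :: "real \<times> real \<Rightarrow> real"
  proof (rule tendsto_if_subsubseq)
    fix s :: "nat \<Rightarrow> nat" assume "strict_mono s"
    then obtain r \<nu>' where r: "strict_mono (r :: nat \<Rightarrow> nat)" and \<nu>': "borel_prob_measure \<nu>'" "bifree_R_defined \<alpha> \<beta> \<nu>'"
      "\<And>z w. z \<in> double_stolz \<alpha> \<beta> \<Longrightarrow> w \<in> double_stolz \<alpha> \<beta> \<Longrightarrow> bifree_R \<nu>' z w = R z w"
      and wc: "weakly_converges (\<lambda>n. \<mu> (s (r n))) \<nu>'"
      using sub by blast
    have "\<nu>' = \<nu>" by (rule bifree_R_inject[OF \<nu>'(1) \<nu>(1) pos \<nu>'(2) \<nu>(2)]) (simp add: \<nu> \<nu>')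
    then show "\<exists>r :: nat \<Rightarrow> nat. strict_mono r \<and> (\<lambda>n. integral\<^sup>L (\<mu> (s (r n))) f) \<longlonglongrightarrow> integral\<^sup>L \<nu> f"
      using r wc f unfolding weakly_converges_def by blast
  qed
  then show ?thesis using \<nu>(1) unfolding weakly_converges_def by blast
qed

text \<open>Condition (3) is a joint limit along the product of two right neighbourhood filters at
  0, with n as the parameter of uniformity. The last conjunct ranges over every angle on which the
  terms are defined and converge, however large, so it cannot be read off from the angle constructed
  for the first part; this is what the continuation in \<open>bifree_R_limit\<close> is for.\<close>

theorem proposition2p6:
  fixes \<mu> :: "nat \<Rightarrow> (real \<times> real) measure"
  assumes "\<And>n. borel_prob_measure (\<mu> n)"
  shows "((\<exists>\<nu>. borel_prob_measure \<nu> \<and> weakly_converges \<mu> \<nu>) \<longleftrightarrow>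
      (\<exists>\<alpha>>0. \<exists>\<beta>>0.
        (\<forall>n. bifree_R_defined \<alpha> \<beta> (\<mu> n)) \<and>
        (\<exists>R. \<forall>z\<in>double_stolz \<alpha> \<beta>. \<forall>w\<in>double_stolz \<alpha> \<beta>.
           (\<lambda>n. bifree_R (\<mu> n) z w) \<longlonglongrightarrow> R z w) \<and>
        uniform_limit UNIV
          (\<lambda>(y, v) n. bifree_R (\<mu> n) (- \<i> * complex_of_real y) (- \<i> * complex_of_real v))
          (\<lambda>n. 0) (at_right 0 \<times>\<^sub>F at_right 0)))
    \<and> (\<forall>\<nu> \<alpha> \<beta> R.
        borel_prob_measure \<nu> \<and> weakly_converges \<mu> \<nu> \<and> \<alpha> > 0 \<and> \<beta> > 0 \<and>
        (\<forall>n. bifree_R_defined \<alpha> \<beta> (\<mu> n)) \<and>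
        (\<forall>z\<in>double_stolz \<alpha> \<beta>. \<forall>w\<in>double_stolz \<alpha> \<beta>.
           (\<lambda>n. bifree_R (\<mu> n) z w) \<longlonglongrightarrow> R z w)
        \<longrightarrow> bifree_R_defined \<alpha> \<beta> \<nu> \<and>
            (\<forall>z\<in>double_stolz \<alpha> \<beta>. \<forall>w\<in>double_stolz \<alpha> \<beta>. R z w = bifree_R \<nu> z w))"
proof (intro conjI iffI, goal_cases)
  case 1
  then obtain \<nu> where \<nu>: "borel_prob_measure \<nu>" "weakly_converges \<mu> \<nu>" by blast
  show ?case
  proof (rule weakly_converges_imp_bifree_R[OF assms \<nu> zero_less_one], goal_cases)
    case (1 \<beta>)
    then show ?case
      by (intro exI[of _ "1::real"] exI[of _ \<beta>] exI[of _ "bifree_R \<nu>"] conjI) auto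
  qed
next
  case 2
  then obtain \<alpha> \<beta> R where pos: "0 < \<alpha>" "0 < \<beta>" and def: "\<And>n. bifree_R_defined \<alpha> \<beta> (\<mu> n)"
    and lim: "\<And>z w. z \<in> double_stolz \<alpha> \<beta> \<Longrightarrow> w \<in> double_stolz \<alpha> \<beta> \<Longrightarrow> (\<lambda>n. bifree_R (\<mu> n) z w) \<longlonglongrightarrow> R z w"
    and unif: "uniform_limit UNIV
          (\<lambda>(y, v) n. bifree_R (\<mu> n) (- \<i> * complex_of_real y) (- \<i> * complex_of_real v))
          (\<lambda>n. 0) (at_right 0 \<times>\<^sub>F at_right 0)"
    by blast
  show ?case by (rule bifree_R_imp_weakly_converges[OF assms pos def lim unif])
next
  case 3
  show ?case
  proof (intro allI impI, elim conjE)
    fix \<nu> \<alpha> \<beta> R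
    assume \<nu>: "borel_prob_measure \<nu>" "weakly_converges \<mu> \<nu>" and pos: "0 < \<alpha>" "0 < \<beta>"
      and def: "\<forall>n. bifree_R_defined \<alpha> \<beta> (\<mu> n)"
      and lim: "\<forall>z\<in>double_stolz \<alpha> \<beta>. \<forall>w\<in>double_stolz \<alpha> \<beta>. (\<lambda>n. bifree_R (\<mu> n) z w) \<longlonglongrightarrow> R z w"
    have lim': "(\<lambda>n. bifree_R (\<mu> n) z w) \<longlonglongrightarrow> R z w"
      if "z \<in> double_stolz \<alpha> \<beta>" "w \<in> double_stolz \<alpha> \<beta>" for z w
      using lim that by blast
    note L = bifree_R_limit[OF assms \<nu> pos def[rule_format] lim']
    show "bifree_R_defined \<alpha> \<beta> \<nu> \<and>
        (\<forall>z\<in>double_stolz \<alpha> \<beta>. \<forall>w\<in>double_stolz \<alpha> \<beta>. R z w = bifree_R \<nu> z w)"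
      using L by (intro conjI ballI)
  qed
qed

end
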